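(* Let $\underline{\mathcal C}$ be a $G$-$A$-coring with left dual graded ring $R$. There is a functor $F_3:\mathcal M^{G,\underline{\mathcal C}}\to\mathcal M^G_R$, given by $F_3(\underline M)=\bigoplus_{\alpha\in G}M_\alpha$ with right $R$-action $m\cdot f=m_{[0,\alpha\beta]}f(m_{[1,\beta^{-1}]})$ for $m\in M_\alpha$, $f\in R_\beta$, and $F_3(\underline f)=\bigoplus_\alpha f_\alpha$ on morphisms. The functor $F_3$ is an isomorphism of categories if $\underline{\mathcal C}$ is left homogeneously finite.
   Context: $G$ is a group with unit $e$, $A$ is a ring with unit. A $G$-$A$-coring (group coring) $\underline{\mathcal C}$ is a family $(\mathcal C_\alpha)_{\alpha\in G}$ of $A$-bimodules with $A$-bimodule maps $\Delta_{\alpha,\beta}:\mathcal C_{\alpha\beta}\to\mathcal C_\alpha\otimes_A\mathcal C_\beta$, written $\Delta_{\alpha,\beta}(c)=c_{(1,\alpha)}\otimes_Ac_{(2,\beta)}$, and $\varepsilon:\mathcal C_e\to A$ such that, for all $\alpha,\beta,\gamma\in G$, $(\Delta_{\alpha,\beta}\otimes_A\mathcal C_\gamma)\circ\Delta_{\alpha\beta,\gamma}=(\mathcal C_\alpha\otimes_A\Delta_{\beta,\gamma})\circ\Delta_{\alpha,\beta\gamma}$ and $(\mathcal C_\alpha\otimes_A\varepsilon)\circ\Delta_{\alpha,e}=\mathcal C_\alpha=(\varepsilon\otimes_A\mathcal C_\alpha)\circ\Delta_{e,\alpha}$ (an object also denotes its identity map). $\underline{\mathcal C}$ is left homogeneously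 finite if every $\mathcal C_\alpha$ is finitely generated and projective as a left $A$-module. A right $G$-$\underline{\mathcal C}$-comodule is a family $\underline M=(M_\alpha)_{\alpha\in G}$ of right $A$-modules with right $A$-linear maps $\rho_{\alpha,\beta}:M_{\alpha\beta}\to M_\alpha\otimes_A\mathcal C_\beta$, written $\rho_{\alpha,\beta}(m)=m_{[0,\alpha]}\otimes_Am_{[1,\beta]}$, such that $(M_\alpha\otimes_A\Delta_{\beta,\gamma})\circ\rho_{\alpha,\beta\gamma}=(\rho_{\alpha,\beta}\otimes_A\mathcal C_\gamma)\circ\rho_{\alpha\beta,\gamma}$ and $(M_\alpha\otimes_A\varepsilon)\circ\rho_{\alpha,e}=M_\alpha$. Morphisms are families of right $A$-linear maps $f_\alpha:M_\alpha\to N_\alpha$ with $(f_\alpha\otimes_A\mathcal C_\beta)\circ\rho_{\alpha,\beta}=\rho_{\alpha,\beta}\circ f_{\alpha\beta}$. The category is $\mathcal M^{G,\underline{\mathcal C}}$. The left dual graded ring of $\underline{\mathcal C}$ is $R={}^*\underline{\mathcal C}=\bigoplus_{\alpha\in G}R_\alpha$, $R_\alpha={}_A\mathrm{Hom}(\mathcal C_{\alpha^{-1}},A)$ (left $A$-linear maps), with $A$-bimodule structure $(a\cdot f\cdot b)(c)=f(ca)b$, multiplication $(f\#g)(c)=g(c_{(1,\beta^{-1})}f(c_{(2,\alpha^{-1})}))$ for $f\in R_\alpha$, $g\in R_\beta$, $c\in\mathcal C_{(\alpha\beta)^{-1}}$, and unit $\varepsilon\in R_e$. It is a $G$-graded ring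 with ring morphism $A\to R_e$, $a\mapsto(c\mapsto\varepsilon(c)a)$. $\mathcal M^G_R$ is the category of $G$-graded right $R$-modules (morphisms: $R$-linear maps preserving degree). *)

theory Defs
  imports "HOL-Algebra.Algebra"
begin

text \<open>
  Additive groups of modules are \<^const>\<open>comm_group\<close> records, as for
  \<^const>\<open>free_Abelian_group\<close> and \<^const>\<open>sum_group\<close>: their addition and zero are therefore
  written with the multiplicative names \<^const>\<open>monoid.mult\<close> and \<^const>\<open>one\<close>.
  Rings have a unit; they need not be commutative.
\<close>

section \<open>Categories\<close>

record ('o, 'f) category_data =
  Obj :: "'o set"
  Hom :: "'o \<Rightarrow> 'o \<Rightarrow> 'f set"
  Idm :: "'o \<Rightarrow> 'f"
  Cmp :: "'o \<Rightarrow> 'o \<Rightarrow> 'o \<Rightarrow> 'f \<Rightarrow> 'f \<Rightarrow> 'f"  \<comment> \<open>\<open>Cmp K U V W g f\<close> is \<open>g\<close> after \<open>f\<close>, for \<open>f : U \<rightarrow> V\<close>, \<open>g : V \<rightarrow> W\<close>\<close>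

locale category =
  fixes K :: "('o, 'f) category_data"
  assumes Idm_in: "U \<in> Obj K \<Longrightarrow> Idm K U \<in> Hom K U U"
    and Cmp_in: "\<lbrakk>U \<in> Obj K; V \<in> Obj K; W \<in> Obj K; f \<in> Hom K U V; g \<in> Hom K V W\<rbrakk>
      \<Longrightarrow> Cmp K U V W g f \<in> Hom K U W"
    and Cmp_Idm_right: "\<lbrakk>U \<in> Obj K; V \<in> Obj K; f \<in> Hom K U V\<rbrakk> \<Longrightarrow> Cmp K U U V f (Idm K U) = f"
    and Cmp_Idm_left: "\<lbrakk>U \<in> Obj K; V \<in> Obj K; f \<in> Hom K U V\<rbrakk> \<Longrightarrow> Cmp K U V V (Idm K V) f = f"
    and Cmp_assoc: "\<lbrakk>U \<in> Obj K; V \<in> Obj K; W \<in> Obj K; S \<in> Obj K;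
        f \<in> Hom K U V; g \<in> Hom K V W; h \<in> Hom K W S\<rbrakk>
      \<Longrightarrow> Cmp K U V S (Cmp K V W S h g) f = Cmp K U W S h (Cmp K U V W g f)"

record ('o, 'f, 'p, 'h) functor_data =
  FObj :: "'o \<Rightarrow> 'p"
  FMor :: "'o \<Rightarrow> 'o \<Rightarrow> 'f \<Rightarrow> 'h"

locale cat_functor = K: category K + L: category L
  for K :: "('o, 'f) category_data" and L :: "('p, 'h) category_data" +
  fixes F :: "('o, 'f, 'p, 'h) functor_data"
  assumes FObj_in: "U \<in> Obj K \<Longrightarrow> FObj F U \<in> Obj L"
    and FMor_in: "\<lbrakk>U \<in> Obj K; V \<in> Obj K; f \<in> Hom K U V\<rbrakk>
      \<Longrightarrow> FMor F U V f \<in> Hom L (FObj F U) (FObj F V)"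
    and FMor_Idm: "U \<in> Obj K \<Longrightarrow> FMor F U U (Idm K U) = Idm L (FObj F U)"
    and FMor_Cmp: "\<lbrakk>U \<in> Obj K; V \<in> Obj K; W \<in> Obj K; f \<in> Hom K U V; g \<in> Hom K V W\<rbrakk>
      \<Longrightarrow> FMor F U W (Cmp K U V W g f)
          = Cmp L (FObj F U) (FObj F V) (FObj F W) (FMor F V W g) (FMor F U V f)"

text \<open>\<open>left_inverse_functor K F E\<close>: the composite of \<open>F\<close> followed by \<open>E\<close> is the identity of \<open>K\<close>.\<close>

definition left_inverse_functor ::
  "('o, 'f) category_data \<Rightarrow> ('o, 'f, 'p, 'h) functor_data \<Rightarrow> ('p, 'h, 'o, 'f) functor_data \<Rightarrow> bool"
  where "left_inverse_functor K F E \<longleftrightarrow>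
    (\<forall>U\<in>Obj K. FObj E (FObj F U) = U) \<and>
    (\<forall>U\<in>Obj K. \<forall>V\<in>Obj K. \<forall>f\<in>Hom K U V. FMor E (FObj F U) (FObj F V) (FMor F U V f) = f)"

definition isomorphism_of_categories ::
  "('o, 'f) category_data \<Rightarrow> ('p, 'h) category_data \<Rightarrow> ('o, 'f, 'p, 'h) functor_data \<Rightarrow> bool"
  where "isomorphism_of_categories K L F \<longleftrightarrow> cat_functor K L F \<and>
    (\<exists>E. cat_functor L K E \<and> left_inverse_functor K F E \<and> left_inverse_functor L E F)"


section \<open>Modules and bimodules over a ring\<close>

record ('a, 'm) rmod = "'m monoid" +
  ract :: "'m \<Rightarrow> 'a \<Rightarrow> 'm"

record ('a, 'm) lmod = "'m monoid" +
  lact :: "'a \<Rightarrow> 'm \<Rightarrow> 'm"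

record ('a, 'm) bimod = "('a, 'm) lmod" +
  bract :: "'m \<Rightarrow> 'a \<Rightarrow> 'm"  \<comment> \<open>the right action\<close>

definition right_of :: "('a, 'm) bimod \<Rightarrow> ('a, 'm) rmod"
  where "right_of B = \<lparr>carrier = carrier B, monoid.mult = monoid.mult B, one = one B, ract = bract B\<rparr>"

locale right_module = ring A + M: comm_group M
  for A :: "('a, 'x) ring_scheme" (structure) and M :: "('a, 'm, 'y) rmod_scheme" +
  assumes ract_closed: "\<lbrakk>m \<in> carrier M; a \<in> carrier A\<rbrakk> \<Longrightarrow> ract M m a \<in> carrier M"
    and ract_add_left: "\<lbrakk>m \<in> carrier M; n \<in> carrier M; a \<in> carrier A\<rbrakk>
      \<Longrightarrow> ract M (m \<otimes>\<^bsub>M\<^esub> n) a = ract M m a \<otimes>\<^bsub>M\<^esub> ract M n a"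
    and ract_add_right: "\<lbrakk>m \<in> carrier M; a \<in> carrier A; b \<in> carrier A\<rbrakk>
      \<Longrightarrow> ract M m (a \<oplus>\<^bsub>A\<^esub> b) = ract M m a \<otimes>\<^bsub>M\<^esub> ract M m b"
    and ract_mult: "\<lbrakk>m \<in> carrier M; a \<in> carrier A; b \<in> carrier A\<rbrakk>
      \<Longrightarrow> ract M m (a \<otimes>\<^bsub>A\<^esub> b) = ract M (ract M m a) b"
    and ract_one: "m \<in> carrier M \<Longrightarrow> ract M m \<one>\<^bsub>A\<^esub> = m"

locale left_module = ring A + M: comm_group M
  for A :: "('a, 'x) ring_scheme" (structure) and M :: "('a, 'm, 'y) lmod_scheme" +
  assumes lact_closed: "\<lbrakk>m \<in> carrier M; a \<in> carrier A\<rbrakk> \<Longrightarrow> lact M a m \<in> carrier M"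
    and lact_add_right: "\<lbrakk>m \<in> carrier M; n \<in> carrier M; a \<in> carrier A\<rbrakk>
      \<Longrightarrow> lact M a (m \<otimes>\<^bsub>M\<^esub> n) = lact M a m \<otimes>\<^bsub>M\<^esub> lact M a n"
    and lact_add_left: "\<lbrakk>m \<in> carrier M; a \<in> carrier A; b \<in> carrier A\<rbrakk>
      \<Longrightarrow> lact M (a \<oplus>\<^bsub>A\<^esub> b) m = lact M a m \<otimes>\<^bsub>M\<^esub> lact M b m"
    and lact_mult: "\<lbrakk>m \<in> carrier M; a \<in> carrier A; b \<in> carrier A\<rbrakk>
      \<Longrightarrow> lact M (a \<otimes>\<^bsub>A\<^esub> b) m = lact M a (lact M b m)"
    and lact_one: "m \<in> carrier M \<Longrightarrow> lact M \<one>\<^bsub>A\<^esub> m = m"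

locale bimodule = left_module A B + right: right_module A "right_of B"
  for A :: "('a, 'x) ring_scheme" (structure) and B :: "('a, 'm) bimod" +
  assumes lact_bract: "\<lbrakk>m \<in> carrier B; a \<in> carrier A; b \<in> carrier A\<rbrakk>
      \<Longrightarrow> bract B (lact B a m) b = lact B a (bract B m b)"

definition right_linear ::
  "('a, 'x) ring_scheme \<Rightarrow> ('a, 'm, 'y) rmod_scheme \<Rightarrow> ('a, 'n, 'z) rmod_scheme \<Rightarrow> ('m \<Rightarrow> 'n) set"
  where "right_linear A M N =
    {f \<in> hom M N. \<forall>m\<in>carrier M. \<forall>a\<in>carrier A. f (ract M m a) = ract N (f m) a}"

definition left_linear ::
  "('a, 'x) ring_scheme \<Rightarrow> ('a, 'm, 'y) lmod_scheme \<Rightarrow> ('a, 'n, 'z) lmod_scheme \<Rightarrow> ('m \<Rightarrow> 'n) set"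
  where "left_linear A M N =
    {f \<in> hom M N. \<forall>m\<in>carrier M. \<forall>a\<in>carrier A. f (lact M a m) = lact N a (f m)}"

definition bilinear ::
  "('a, 'x) ring_scheme \<Rightarrow> ('a, 'm) bimod \<Rightarrow> ('a, 'n) bimod \<Rightarrow> ('m \<Rightarrow> 'n) set"
  where "bilinear A B B' = left_linear A B B' \<inter> right_linear A (right_of B) (right_of B')"

definition regular :: "('a, 'x) ring_scheme \<Rightarrow> ('a, 'a) bimod"
  where "regular A = \<lparr>carrier = carrier A, monoid.mult = add A, one = ring.zero A,
    lact = monoid.mult A, bract = monoid.mult A\<rparr>"

definition finitely_generated :: "('a, 'x) ring_scheme \<Rightarrow> ('a, 'm, 'y) lmod_scheme \<Rightarrow> bool"
  where "finitely_generated A P \<longleftrightarrow> (\<exists>S. finite S \<and> S \<subseteq> carrier P \<and>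
    (\<forall>p\<in>carrier P. \<exists>a \<in> S \<rightarrow> carrier A. p = finprod P (\<lambda>s. lact P (a s) s) S))"

text \<open>
  The lifting property of projective modules. HOL cannot quantify over types inside a
  definition, so the test modules \<open>U\<close>, \<open>V\<close> live on fixed types. These are large enough
  to make this the usual notion: they include \<open>V = P\<close> and as \<open>U\<close> the free module on the
  elements of \<open>P\<close> (finitely supported functions).
\<close>

definition projective :: "('a, 'x) ring_scheme \<Rightarrow> ('a, 'm, 'y) lmod_scheme \<Rightarrow> bool"
  where "projective A P \<longleftrightarrow> left_module A P \<and>
    (\<forall>(U :: ('a, 'm \<Rightarrow> 'a) lmod) (V :: ('a, 'm) lmod).
      left_module A U \<longrightarrow> left_module A V \<longrightarrow>
      (\<forall>q \<in> left_linear A U V. \<forall>f \<in> left_linear A P V. q ` carrier U = carrier V \<longrightarrow>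
        (\<exists>h \<in> left_linear A P U. \<forall>p\<in>carrier P. q (h p) = f p)))"


section \<open>Tensor products over a ring\<close>

definition tensor_relations ::
  "('a, 'x) ring_scheme \<Rightarrow> ('a, 'm, 'y) rmod_scheme \<Rightarrow> ('a, 'n, 'z) lmod_scheme \<Rightarrow> ('m \<times> 'n \<Rightarrow>\<^sub>0 int) set"
  where "tensor_relations A M N =
    {frag_of (m \<otimes>\<^bsub>M\<^esub> m', n) - frag_of (m, n) - frag_of (m', n) | m m' n.
       m \<in> carrier M \<and> m' \<in> carrier M \<and> n \<in> carrier N} \<union>
    {frag_of (m, n \<otimes>\<^bsub>N\<^esub> n') - frag_of (m, n) - frag_of (m, n') | m n n'.
       m \<in> carrier M \<and> n \<in> carrier N \<and> n' \<in> carrier N} \<union>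
    {frag_of (ract M m a, n) - frag_of (m, lact N a n) | m a n.
       m \<in> carrier M \<and> a \<in> carrier A \<and> n \<in> carrier N}"

definition tensor_kernel ::
  "('a, 'x) ring_scheme \<Rightarrow> ('a, 'm, 'y) rmod_scheme \<Rightarrow> ('a, 'n, 'z) lmod_scheme \<Rightarrow> ('m \<times> 'n \<Rightarrow>\<^sub>0 int) set"
  where "tensor_kernel A M N =
    generate (free_Abelian_group (carrier M \<times> carrier N)) (tensor_relations A M N)"

definition tensor ::
  "('a, 'x) ring_scheme \<Rightarrow> ('a, 'm, 'y) rmod_scheme \<Rightarrow> ('a, 'n, 'z) lmod_scheme \<Rightarrow> ('m \<times> 'n \<Rightarrow>\<^sub>0 int) set monoid"
  where "tensor A M N = free_Abelian_group (carrier M \<times> carrier N) Mod tensor_kernel A M N"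

definition pure_tensor ::
  "('a, 'x) ring_scheme \<Rightarrow> ('a, 'm, 'y) rmod_scheme \<Rightarrow> ('a, 'n, 'z) lmod_scheme \<Rightarrow> 'm \<Rightarrow> 'n \<Rightarrow> ('m \<times> 'n \<Rightarrow>\<^sub>0 int) set"
  where "pure_tensor A M N m n =
    tensor_kernel A M N #>\<^bsub>free_Abelian_group (carrier M \<times> carrier N)\<^esub> frag_of (m, n)"

text \<open>
  The homomorphism \<open>M \<otimes>\<^sub>A N \<rightarrow> Q\<close> with \<open>m \<otimes> n \<mapsto> b m n\<close> given by the universal property;
  it is determined by \<open>b\<close>, and exists when \<open>b\<close> is biadditive and \<open>A\<close>-balanced, as it is
  wherever \<open>tensor_lift\<close> is used.
\<close>

definition tensor_lift ::
  "('a, 'x) ring_scheme \<Rightarrow> ('a, 'm, 'y) rmod_scheme \<Rightarrow> ('a, 'n, 'z) lmod_scheme \<Rightarrow> ('q, 'w) monoid_scheme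
    \<Rightarrow> ('m \<Rightarrow> 'n \<Rightarrow> 'q) \<Rightarrow> ('m \<times> 'n \<Rightarrow>\<^sub>0 int) set \<Rightarrow> 'q"
  where "tensor_lift A M N Q b =
    (THE h. h \<in> hom (tensor A M N) Q \<and> h \<in> extensional (carrier (tensor A M N)) \<and>
      (\<forall>m\<in>carrier M. \<forall>n\<in>carrier N. h (pure_tensor A M N m n) = b m n))"

definition tensor_map ::
  "('a, 'x) ring_scheme \<Rightarrow> ('a, 'm, 'y) rmod_scheme \<Rightarrow> ('a, 'n, 'z) lmod_scheme
    \<Rightarrow> ('a, 'm', 'y') rmod_scheme \<Rightarrow> ('a, 'n', 'z') lmod_scheme
    \<Rightarrow> ('m \<Rightarrow> 'm') \<Rightarrow> ('n \<Rightarrow> 'n') \<Rightarrow> ('m \<times> 'n \<Rightarrow>\<^sub>0 int) set \<Rightarrow> ('m' \<times> 'n' \<Rightarrow>\<^sub>0 int) set"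
  where "tensor_map A M N M' N' f g =
    tensor_lift A M N (tensor A M' N') (\<lambda>m n. pure_tensor A M' N' (f m) (g n))"

definition tensor_rmod ::
  "('a, 'x) ring_scheme \<Rightarrow> ('a, 'm) rmod \<Rightarrow> ('a, 'n) bimod \<Rightarrow> ('a, ('m \<times> 'n \<Rightarrow>\<^sub>0 int) set) rmod"
  where "tensor_rmod A M B =
    \<lparr>carrier = carrier (tensor A M B), monoid.mult = monoid.mult (tensor A M B), one = one (tensor A M B),
     ract = (\<lambda>t a. tensor_map A M B M B (\<lambda>m. m) (\<lambda>b. bract B b a) t)\<rparr>"

definition tensor_bimod ::
  "('a, 'x) ring_scheme \<Rightarrow> ('a, 'm) bimod \<Rightarrow> ('a, 'n) bimod \<Rightarrow> ('a, ('m \<times> 'n \<Rightarrow>\<^sub>0 int) set) bimod"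
  where "tensor_bimod A B B' =
    \<lparr>carrier = carrier (tensor A (right_of B) B'), monoid.mult = monoid.mult (tensor A (right_of B) B'),
     one = one (tensor A (right_of B) B'),
     lact = (\<lambda>a t. tensor_map A (right_of B) B' (right_of B) B' (\<lambda>b. lact B a b) (\<lambda>b'. b') t),
     bract = (\<lambda>t a. tensor_map A (right_of B) B' (right_of B) B' (\<lambda>b. b) (\<lambda>b'. bract B' b' a) t)\<rparr>"

text \<open>The canonical isomorphisms \<open>(M \<otimes> B) \<otimes> B' \<cong> M \<otimes> (B \<otimes> B')\<close>, \<open>M \<otimes> A \<cong> M\<close>, \<open>A \<otimes> N \<cong> N\<close>.\<close>

definition associator ::
  "('a, 'x) ring_scheme \<Rightarrow> ('a, 'm) rmod \<Rightarrow> ('a, 'n) bimod \<Rightarrow> ('a, 'p) bimod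
    \<Rightarrow> (('m \<times> 'n \<Rightarrow>\<^sub>0 int) set \<times> 'p \<Rightarrow>\<^sub>0 int) set \<Rightarrow> ('m \<times> ('n \<times> 'p \<Rightarrow>\<^sub>0 int) set \<Rightarrow>\<^sub>0 int) set"
  where "associator A M B B' =
    tensor_lift A (tensor_rmod A M B) B' (tensor A M (tensor_bimod A B B'))
      (\<lambda>t b'. tensor_lift A M B (tensor A M (tensor_bimod A B B'))
        (\<lambda>m b. pure_tensor A M (tensor_bimod A B B') m (pure_tensor A (right_of B) B' b b')) t)"

definition right_unitor ::
  "('a, 'x) ring_scheme \<Rightarrow> ('a, 'm) rmod \<Rightarrow> ('m \<times> 'a \<Rightarrow>\<^sub>0 int) set \<Rightarrow> 'm"
  where "right_unitor A M = tensor_lift A M (regular A) M (\<lambda>m a. ract M m a)"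

definition left_unitor ::
  "('a, 'x) ring_scheme \<Rightarrow> ('a, 'n, 'z) lmod_scheme \<Rightarrow> ('a \<times> 'n \<Rightarrow>\<^sub>0 int) set \<Rightarrow> 'n"
  where "left_unitor A N = tensor_lift A (right_of (regular A)) N N (\<lambda>a n. lact N a n)"


section \<open>Group corings and their comodules\<close>

record ('g, 'a, 'c) coring =
  ccomp :: "'g \<Rightarrow> ('a, 'c) bimod"
  comult :: "'g \<Rightarrow> 'g \<Rightarrow> 'c \<Rightarrow> ('c \<times> 'c \<Rightarrow>\<^sub>0 int) set"
  counit :: "'c \<Rightarrow> 'a"

locale group_coring = G: group G + A: ring A
  for G :: "('g, 'y) monoid_scheme" (structure) and A :: "('a, 'x) ring_scheme" +
  fixes C :: "('g, 'a, 'c) coring"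
  assumes ccomp_bimodule: "\<alpha> \<in> carrier G \<Longrightarrow> bimodule A (ccomp C \<alpha>)"
    and comult_bilinear: "\<lbrakk>\<alpha> \<in> carrier G; \<beta> \<in> carrier G\<rbrakk> \<Longrightarrow>
      comult C \<alpha> \<beta> \<in> bilinear A (ccomp C (\<alpha> \<otimes> \<beta>)) (tensor_bimod A (ccomp C \<alpha>) (ccomp C \<beta>))"
    and counit_bilinear: "counit C \<in> bilinear A (ccomp C \<one>) (regular A)"
    and coassoc: "\<lbrakk>\<alpha> \<in> carrier G; \<beta> \<in> carrier G; \<gamma> \<in> carrier G; c \<in> carrier (ccomp C (\<alpha> \<otimes> \<beta> \<otimes> \<gamma>))\<rbrakk> \<Longrightarrow>
      associator A (right_of (ccomp C \<alpha>)) (ccomp C \<beta>) (ccomp C \<gamma>)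
        (tensor_map A (right_of (ccomp C (\<alpha> \<otimes> \<beta>))) (ccomp C \<gamma>)
            (right_of (tensor_bimod A (ccomp C \<alpha>) (ccomp C \<beta>))) (ccomp C \<gamma>)
          (comult C \<alpha> \<beta>) (\<lambda>c. c) (comult C (\<alpha> \<otimes> \<beta>) \<gamma> c))
      = tensor_map A (right_of (ccomp C \<alpha>)) (ccomp C (\<beta> \<otimes> \<gamma>))
            (right_of (ccomp C \<alpha>)) (tensor_bimod A (ccomp C \<beta>) (ccomp C \<gamma>))
          (\<lambda>c. c) (comult C \<beta> \<gamma>) (comult C \<alpha> (\<beta> \<otimes> \<gamma>) c)"
    and counit_right: "\<lbrakk>\<alpha> \<in> carrier G; c \<in> carrier (ccomp C \<alpha>)\<rbrakk> \<Longrightarrow>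
      right_unitor A (right_of (ccomp C \<alpha>))
        (tensor_map A (right_of (ccomp C \<alpha>)) (ccomp C \<one>) (right_of (ccomp C \<alpha>)) (regular A)
          (\<lambda>c. c) (counit C) (comult C \<alpha> \<one> c)) = c"
    and counit_left: "\<lbrakk>\<alpha> \<in> carrier G; c \<in> carrier (ccomp C \<alpha>)\<rbrakk> \<Longrightarrow>
      left_unitor A (ccomp C \<alpha>)
        (tensor_map A (right_of (ccomp C \<one>)) (ccomp C \<alpha>) (right_of (regular A)) (ccomp C \<alpha>)
          (counit C) (\<lambda>c. c) (comult C \<one> \<alpha> c)) = c"

definition left_homogeneously_finite ::
  "('g, 'y) monoid_scheme \<Rightarrow> ('a, 'x) ring_scheme \<Rightarrow> ('g, 'a, 'c) coring \<Rightarrow> bool"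
  where "left_homogeneously_finite G A C \<longleftrightarrow>
    (\<forall>\<alpha>\<in>carrier G. finitely_generated A (ccomp C \<alpha>) \<and> projective A (ccomp C \<alpha>))"

record ('g, 'a, 'c, 'm) comodule =
  mcomp :: "'g \<Rightarrow> ('a, 'm) rmod"
  coact :: "'g \<Rightarrow> 'g \<Rightarrow> 'm \<Rightarrow> ('m \<times> 'c \<Rightarrow>\<^sub>0 int) set"

locale group_comodule = group_coring G A C
  for G :: "('g, 'y) monoid_scheme" (structure) and A :: "('a, 'x) ring_scheme"
    and C :: "('g, 'a, 'c) coring" +
  fixes M :: "('g, 'a, 'c, 'm) comodule"
  assumes mcomp_module: "\<alpha> \<in> carrier G \<Longrightarrow> right_module A (mcomp M \<alpha>)"
    and coact_linear: "\<lbrakk>\<alpha> \<in> carrier G; \<beta> \<in> carrier G\<rbrakk> \<Longrightarrow>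
      coact M \<alpha> \<beta> \<in> right_linear A (mcomp M (\<alpha> \<otimes> \<beta>)) (tensor_rmod A (mcomp M \<alpha>) (ccomp C \<beta>))"
    and coact_coassoc: "\<lbrakk>\<alpha> \<in> carrier G; \<beta> \<in> carrier G; \<gamma> \<in> carrier G; m \<in> carrier (mcomp M (\<alpha> \<otimes> \<beta> \<otimes> \<gamma>))\<rbrakk> \<Longrightarrow>
      tensor_map A (mcomp M \<alpha>) (ccomp C (\<beta> \<otimes> \<gamma>)) (mcomp M \<alpha>) (tensor_bimod A (ccomp C \<beta>) (ccomp C \<gamma>))
        (\<lambda>m. m) (comult C \<beta> \<gamma>) (coact M \<alpha> (\<beta> \<otimes> \<gamma>) m)
      = associator A (mcomp M \<alpha>) (ccomp C \<beta>) (ccomp C \<gamma>)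
          (tensor_map A (mcomp M (\<alpha> \<otimes> \<beta>)) (ccomp C \<gamma>) (tensor_rmod A (mcomp M \<alpha>) (ccomp C \<beta>)) (ccomp C \<gamma>)
            (coact M \<alpha> \<beta>) (\<lambda>c. c) (coact M (\<alpha> \<otimes> \<beta>) \<gamma> m))"
    and coact_counit: "\<lbrakk>\<alpha> \<in> carrier G; m \<in> carrier (mcomp M \<alpha>)\<rbrakk> \<Longrightarrow>
      right_unitor A (mcomp M \<alpha>)
        (tensor_map A (mcomp M \<alpha>) (ccomp C \<one>) (mcomp M \<alpha>) (regular A)
          (\<lambda>m. m) (counit C) (coact M \<alpha> \<one> m)) = m"

text \<open>
  HOL functions also have values outside the carriers. Objects of the categories below carry
  the value \<^const>\<open>undefined\<close> there (compare \<^const>\<open>extensional\<close>), so that two objects are equal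
  in HOL exactly if they are the same mathematical structure; this makes isomorphism of
  categories a meaningful notion.
\<close>

definition extensional_monoid :: "('m, 'y) monoid_scheme \<Rightarrow> bool"
  where "extensional_monoid M \<longleftrightarrow>
    (\<forall>x y. \<not> (x \<in> carrier M \<and> y \<in> carrier M) \<longrightarrow> x \<otimes>\<^bsub>M\<^esub> y = undefined)"

definition extensional_comodule ::
  "('g, 'y) monoid_scheme \<Rightarrow> ('a, 'x) ring_scheme \<Rightarrow> ('g, 'a, 'c, 'm) comodule \<Rightarrow> bool"
  where "extensional_comodule G A M \<longleftrightarrow>
    mcomp M \<in> extensional (carrier G) \<and>
    (\<forall>\<alpha>\<in>carrier G. extensional_monoid (mcomp M \<alpha>) \<and>
      (\<forall>m a. \<not> (m \<in> carrier (mcomp M \<alpha>) \<and> a \<in> carrier A) \<longrightarrow> ract (mcomp M \<alpha>) m a = undefined)) \<and>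
    (\<forall>\<alpha> \<beta> m. \<not> (\<alpha> \<in> carrier G \<and> \<beta> \<in> carrier G \<and> m \<in> carrier (mcomp M (\<alpha> \<otimes>\<^bsub>G\<^esub> \<beta>))) \<longrightarrow>
      coact M \<alpha> \<beta> m = undefined)"

definition comodule_morphisms ::
  "('g, 'y) monoid_scheme \<Rightarrow> ('a, 'x) ring_scheme \<Rightarrow> ('g, 'a, 'c) coring
    \<Rightarrow> ('g, 'a, 'c, 'm) comodule \<Rightarrow> ('g, 'a, 'c, 'm) comodule \<Rightarrow> ('g \<Rightarrow> 'm \<Rightarrow> 'm) set"
  where "comodule_morphisms G A C M N =
    {f \<in> \<Pi>\<^sub>E \<alpha>\<in>carrier G. right_linear A (mcomp M \<alpha>) (mcomp N \<alpha>) \<inter> extensional (carrier (mcomp M \<alpha>)).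
      \<forall>\<alpha>\<in>carrier G. \<forall>\<beta>\<in>carrier G. \<forall>m\<in>carrier (mcomp M (\<alpha> \<otimes>\<^bsub>G\<^esub> \<beta>)).
        tensor_map A (mcomp M \<alpha>) (ccomp C \<beta>) (mcomp N \<alpha>) (ccomp C \<beta>) (f \<alpha>) (\<lambda>c. c) (coact M \<alpha> \<beta> m)
        = coact N \<alpha> \<beta> (f (\<alpha> \<otimes>\<^bsub>G\<^esub> \<beta>) m)}"

definition comodule_category ::
  "('g, 'y) monoid_scheme \<Rightarrow> ('a, 'x) ring_scheme \<Rightarrow> ('g, 'a, 'c) coring
    \<Rightarrow> (('g, 'a, 'c, 'm) comodule, 'g \<Rightarrow> 'm \<Rightarrow> 'm) category_data"
  where "comodule_category G A C =
    \<lparr>Obj = {M. group_comodule G A C M \<and> extensional_comodule G A M},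
     Hom = comodule_morphisms G A C,
     Idm = (\<lambda>M. \<lambda>\<alpha>\<in>carrier G. \<lambda>m\<in>carrier (mcomp M \<alpha>). m),
     Cmp = (\<lambda>M N P g f. \<lambda>\<alpha>\<in>carrier G. compose (carrier (mcomp M \<alpha>)) (g \<alpha>) (f \<alpha>))\<rparr>"


section \<open>Graded rings and graded modules\<close>

text \<open>
  A graded group is the direct sum \<open>sum_group (carrier G) D\<close> of a family \<open>D\<close>. With graded rings
  and modules given in this way the direct sum decomposition is part of the data, as in
  \<open>R = \<Oplus>\<^sub>\<alpha> R\<^sub>\<alpha>\<close>.
\<close>

definition homogeneous ::
  "('g, 'y) monoid_scheme \<Rightarrow> ('g \<Rightarrow> ('d, 'z) monoid_scheme) \<Rightarrow> 'g \<Rightarrow> ('g \<Rightarrow> 'd) set"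
  where "homogeneous G D \<alpha> =
    {x \<in> carrier (sum_group (carrier G) D). \<forall>\<gamma>\<in>carrier G. \<gamma> \<noteq> \<alpha> \<longrightarrow> x \<gamma> = \<one>\<^bsub>D \<gamma>\<^esub>}"

locale graded_ring = G: group G + R: ring R
  for G :: "('g, 'y) monoid_scheme" (structure) and R :: "('g \<Rightarrow> 'd, 'x) ring_scheme" +
  fixes D :: "'g \<Rightarrow> 'd monoid"
  assumes D_comm_group: "\<alpha> \<in> carrier G \<Longrightarrow> comm_group (D \<alpha>)"
    and carrier_sum: "carrier R = carrier (sum_group (carrier G) D)"
    and zero_sum: "\<zero>\<^bsub>R\<^esub> = \<one>\<^bsub>sum_group (carrier G) D\<^esub>"
    and add_sum: "\<lbrakk>r \<in> carrier R; s \<in> carrier R\<rbrakk> \<Longrightarrow> r \<oplus>\<^bsub>R\<^esub> s = r \<otimes>\<^bsub>sum_group (carrier G) D\<^esub> s"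
    and one_homogeneous: "\<one>\<^bsub>R\<^esub> \<in> homogeneous G D \<one>"
    and mult_homogeneous: "\<lbrakk>\<alpha> \<in> carrier G; \<beta> \<in> carrier G; r \<in> homogeneous G D \<alpha>; s \<in> homogeneous G D \<beta>\<rbrakk>
      \<Longrightarrow> r \<otimes>\<^bsub>R\<^esub> s \<in> homogeneous G D (\<alpha> \<otimes> \<beta>)"

record ('g, 'r, 'm) gr_module =
  gcomp :: "'g \<Rightarrow> 'm monoid"
  gact :: "('g \<Rightarrow> 'm) \<Rightarrow> 'r \<Rightarrow> ('g \<Rightarrow> 'm)"  \<comment> \<open>the action on the whole direct sum\<close>

definition total ::
  "('g, 'y) monoid_scheme \<Rightarrow> ('g, 'r, 'm) gr_module \<Rightarrow> ('r, 'g \<Rightarrow> 'm) rmod"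
  where "total G N = \<lparr>carrier = carrier (sum_group (carrier G) (gcomp N)),
    monoid.mult = monoid.mult (sum_group (carrier G) (gcomp N)),
    one = one (sum_group (carrier G) (gcomp N)), ract = gact N\<rparr>"

locale graded_module = graded_ring G R D + right_module R "total G N"
  for G :: "('g, 'y) monoid_scheme" (structure) and R :: "('g \<Rightarrow> 'd, 'x) ring_scheme"
    and D :: "'g \<Rightarrow> 'd monoid" and N :: "('g, 'g \<Rightarrow> 'd, 'm) gr_module" +
  assumes gcomp_comm_group: "\<alpha> \<in> carrier G \<Longrightarrow> comm_group (gcomp N \<alpha>)"
    and gact_homogeneous: "\<lbrakk>\<alpha> \<in> carrier G; \<beta> \<in> carrier G; x \<in> homogeneous G (gcomp N) \<alpha>; r \<in> homogeneous G D \<beta>\<rbrakk>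
      \<Longrightarrow> gact N x r \<in> homogeneous G (gcomp N) (\<alpha> \<otimes> \<beta>)"

definition extensional_gr_module ::
  "('g, 'y) monoid_scheme \<Rightarrow> ('r, 'x) ring_scheme \<Rightarrow> ('g, 'r, 'm) gr_module \<Rightarrow> bool"
  where "extensional_gr_module G R N \<longleftrightarrow>
    gcomp N \<in> extensional (carrier G) \<and>
    (\<forall>\<alpha>\<in>carrier G. extensional_monoid (gcomp N \<alpha>)) \<and>
    (\<forall>x r. \<not> (x \<in> carrier (total G N) \<and> r \<in> carrier R) \<longrightarrow> gact N x r = undefined)"

definition graded_morphisms ::
  "('g, 'y) monoid_scheme \<Rightarrow> ('r, 'x) ring_scheme
    \<Rightarrow> ('g, 'r, 'm) gr_module \<Rightarrow> ('g, 'r, 'm) gr_module \<Rightarrow> (('g \<Rightarrow> 'm) \<Rightarrow> ('g \<Rightarrow> 'm)) set"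
  where "graded_morphisms G R N N' =
    {h \<in> right_linear R (total G N) (total G N') \<inter> extensional (carrier (total G N)).
      \<forall>\<alpha>\<in>carrier G. h ` homogeneous G (gcomp N) \<alpha> \<subseteq> homogeneous G (gcomp N') \<alpha>}"

definition graded_module_category ::
  "('g, 'y) monoid_scheme \<Rightarrow> ('g \<Rightarrow> 'd, 'x) ring_scheme \<Rightarrow> ('g \<Rightarrow> 'd monoid)
    \<Rightarrow> (('g, 'g \<Rightarrow> 'd, 'm) gr_module, ('g \<Rightarrow> 'm) \<Rightarrow> ('g \<Rightarrow> 'm)) category_data"
  where "graded_module_category G R D =
    \<lparr>Obj = {N. graded_module G R D N \<and> extensional_gr_module G R N},
     Hom = graded_morphisms G R,
     Idm = (\<lambda>N. \<lambda>x\<in>carrier (total G N). x),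
     Cmp = (\<lambda>N N' N'' g f. compose (carrier (total G N)) g f)\<rparr>"


section \<open>The left dual graded ring\<close>

definition dual_comp ::
  "('g, 'y) monoid_scheme \<Rightarrow> ('a, 'x) ring_scheme \<Rightarrow> ('g, 'a, 'c) coring \<Rightarrow> 'g \<Rightarrow> ('c \<Rightarrow> 'a) monoid"
  where "dual_comp G A C \<alpha> = (let B = ccomp C (inv\<^bsub>G\<^esub> \<alpha>) in
    \<lparr>carrier = left_linear A B (regular A) \<inter> extensional (carrier B),
     monoid.mult = (\<lambda>f g. \<lambda>c\<in>carrier B. f c \<oplus>\<^bsub>A\<^esub> g c),
     one = (\<lambda>c\<in>carrier B. \<zero>\<^bsub>A\<^esub>)\<rparr>)"

text \<open>\<open>(f # g)(c) = g (c\<^sub>1 f(c\<^sub>2))\<close>, where \<open>f\<close> has degree \<open>\<alpha>\<close>, \<open>g\<close> has degree \<open>\<beta>\<close> and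
  \<open>c\<^sub>1 \<otimes> c\<^sub>2\<close> is the comultiplication of \<open>c\<close> in degrees \<open>\<beta>\<inverse>\<close>, \<open>\<alpha>\<inverse>\<close>.\<close>

definition dual_mult ::
  "('g, 'y) monoid_scheme \<Rightarrow> ('a, 'x) ring_scheme \<Rightarrow> ('g, 'a, 'c) coring
    \<Rightarrow> 'g \<Rightarrow> 'g \<Rightarrow> ('c \<Rightarrow> 'a) \<Rightarrow> ('c \<Rightarrow> 'a) \<Rightarrow> ('c \<Rightarrow> 'a)"
  where "dual_mult G A C \<alpha> \<beta> f g = (\<lambda>c\<in>carrier (ccomp C (inv\<^bsub>G\<^esub> (\<alpha> \<otimes>\<^bsub>G\<^esub> \<beta>))).
    let B = ccomp C (inv\<^bsub>G\<^esub> \<beta>); B' = ccomp C (inv\<^bsub>G\<^esub> \<alpha>) in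
    g (tensor_lift A (right_of B) B' B (\<lambda>c1 c2. bract B c1 (f c2))
        (comult C (inv\<^bsub>G\<^esub> \<beta>) (inv\<^bsub>G\<^esub> \<alpha>) c)))"

definition left_dual_ring ::
  "('g, 'y) monoid_scheme \<Rightarrow> ('a, 'x) ring_scheme \<Rightarrow> ('g, 'a, 'c) coring \<Rightarrow> ('g \<Rightarrow> 'c \<Rightarrow> 'a) ring"
  where "left_dual_ring G A C = (let D = dual_comp G A C in
    \<lparr>carrier = carrier (sum_group (carrier G) D),
     monoid.mult = (\<lambda>r s. \<lambda>\<gamma>\<in>carrier G. gfinprod (D \<gamma>)
       (\<lambda>\<alpha>. dual_mult G A C \<alpha> (inv\<^bsub>G\<^esub> \<alpha> \<otimes>\<^bsub>G\<^esub> \<gamma>) (r \<alpha>) (s (inv\<^bsub>G\<^esub> \<alpha> \<otimes>\<^bsub>G\<^esub> \<gamma>))) (carrier G)),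
     one = (\<lambda>\<gamma>\<in>carrier G. if \<gamma> = \<one>\<^bsub>G\<^esub> then restrict (counit C) (carrier (ccomp C \<one>\<^bsub>G\<^esub>)) else \<one>\<^bsub>D \<gamma>\<^esub>),
     ring.zero = \<one>\<^bsub>sum_group (carrier G) D\<^esub>,
     add = monoid.mult (sum_group (carrier G) D)\<rparr>)"


section \<open>The functor to graded modules\<close>

text \<open>\<open>m \<cdot> f = m\<^sub>0 f(m\<^sub>1)\<close>, where \<open>m\<close> has degree \<open>\<alpha>\<close>, \<open>f\<close> has degree \<open>\<beta>\<close> and \<open>m\<^sub>0 \<otimes> m\<^sub>1\<close> is
  the coaction on \<open>m\<close> in degrees \<open>\<alpha>\<beta>\<close>, \<open>\<beta>\<inverse>\<close>.\<close>

definition dual_action ::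
  "('g, 'y) monoid_scheme \<Rightarrow> ('a, 'x) ring_scheme \<Rightarrow> ('g, 'a, 'c) coring \<Rightarrow> ('g, 'a, 'c, 'm) comodule
    \<Rightarrow> 'g \<Rightarrow> 'g \<Rightarrow> 'm \<Rightarrow> ('c \<Rightarrow> 'a) \<Rightarrow> 'm"
  where "dual_action G A C M \<alpha> \<beta> m f = (let Q = mcomp M (\<alpha> \<otimes>\<^bsub>G\<^esub> \<beta>) in
    tensor_lift A Q (ccomp C (inv\<^bsub>G\<^esub> \<beta>)) Q (\<lambda>n c. ract Q n (f c))
      (coact M (\<alpha> \<otimes>\<^bsub>G\<^esub> \<beta>) (inv\<^bsub>G\<^esub> \<beta>) m))"

definition F3_obj ::
  "('g, 'y) monoid_scheme \<Rightarrow> ('a, 'x) ring_scheme \<Rightarrow> ('g, 'a, 'c) coring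
    \<Rightarrow> ('g, 'a, 'c, 'm) comodule \<Rightarrow> ('g, 'g \<Rightarrow> 'c \<Rightarrow> 'a, 'm) gr_module"
  where "F3_obj G A C M =
    \<lparr>gcomp = (\<lambda>\<alpha>\<in>carrier G. \<lparr>carrier = carrier (mcomp M \<alpha>),
        monoid.mult = monoid.mult (mcomp M \<alpha>), one = one (mcomp M \<alpha>)\<rparr>),
     gact = (\<lambda>x r.
       if x \<in> carrier (sum_group (carrier G) (mcomp M)) \<and> r \<in> carrier (left_dual_ring G A C)
       then \<lambda>\<gamma>\<in>carrier G. gfinprod (mcomp M \<gamma>)
         (\<lambda>\<alpha>. dual_action G A C M \<alpha> (inv\<^bsub>G\<^esub> \<alpha> \<otimes>\<^bsub>G\<^esub> \<gamma>) (x \<alpha>) (r (inv\<^bsub>G\<^esub> \<alpha> \<otimes>\<^bsub>G\<^esub> \<gamma>))) (carrier G)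
       else undefined)\<rparr>"

definition F3 ::
  "('g, 'y) monoid_scheme \<Rightarrow> ('a, 'x) ring_scheme \<Rightarrow> ('g, 'a, 'c) coring
    \<Rightarrow> (('g, 'a, 'c, 'm) comodule, 'g \<Rightarrow> 'm \<Rightarrow> 'm,
        ('g, 'g \<Rightarrow> 'c \<Rightarrow> 'a, 'm) gr_module, ('g \<Rightarrow> 'm) \<Rightarrow> ('g \<Rightarrow> 'm)) functor_data"
  where "F3 G A C =
    \<lparr>FObj = F3_obj G A C,
     FMor = (\<lambda>M N f. \<lambda>x\<in>carrier (sum_group (carrier G) (mcomp M)). \<lambda>\<alpha>\<in>carrier G. f \<alpha> (x \<alpha>))\<rparr>"

end

theory Submission
  imports Defs
begin

text \<open>
  Everything rests on one operation. For a right \<open>A\<close>-module \<open>Q\<close>, a left \<open>A\<close>-module \<open>P\<close> and a left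
  linear functional \<open>f : P \<rightarrow> A\<close>, slicing by \<open>f\<close> is the additive map \<open>Q \<otimes>\<^sub>A P \<rightarrow> Q\<close>,
  \<open>q \<otimes> p \<mapsto> q f(p)\<close>. The action of the dual ring on a comodule is slicing of the coaction:
  \<open>m \<cdot> f\<close> is the slice of \<open>\<rho>(m)\<close> by \<open>f\<close>. Slicing is natural in both tensor factors, and slicing
  \<open>(Q \<otimes> B) \<otimes> B'\<close> first by \<open>f\<close> on \<open>B'\<close> and then by \<open>g\<close> on \<open>B\<close> is the same as slicing
  \<open>Q \<otimes> (B \<otimes> B')\<close> by \<open>b \<otimes> b' \<mapsto> g(b f(b'))\<close> (\<open>slice_associator\<close>). The latter is the functional in
  the definition of \<open>f # g\<close>, so coassociativity of \<open>\<rho>\<close> turns into \<open>(m \<cdot> f) \<cdot> g = m \<cdot> (f # g)\<close>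
  (\<open>action_dual_mult\<close>), and counitality into \<open>m \<cdot> \<epsilon> = m\<close> and, more generally,
  \<open>m \<cdot> \<epsilon>(-)a = m a\<close> (\<open>action_scalar\<close>). Compatibility of a comodule morphism with the coactions
  turns into linearity over the dual ring (\<open>comodule_morphism_action\<close>).

  The dual ring comes out of the same calculation. The coring \<open>C\<close> is a comodule over itself, and
  \<open>(f # g)(c) = g(c \<cdot> f)\<close> (\<open>dual_mult_action\<close>). Hence both sides of the associativity law send \<open>c\<close>
  to the value of the last factor at \<open>(c \<cdot> f) \<cdot> g\<close>; that \<open>\<epsilon>\<close> is a unit on the right uses the left
  counit law. The passage from homogeneous elements to direct sums is a general construction
  (\<open>graded_pairing\<close>): a family of biadditive maps extends uniquely to the direct sums, and identities
  between biadditive extensions need to be checked on elements of a single degree only, since these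
  generate.

  Now let every \<open>C\<^sub>i\<close> be finitely generated projective on the left, so that it has a finite dual basis
  \<open>(s, f\<^sub>s)\<close> (\<open>fg_projective_dual_basis\<close>). An element \<open>t\<close> of \<open>Q \<otimes> C\<^sub>i\<close> is then the sum of the
  \<open>t\<^sub>s \<otimes> s\<close>, where \<open>t\<^sub>s\<close> is its slice by \<open>f\<^sub>s\<close>. So slices determine \<open>t\<close>, and conversely every additive
  map \<open>F\<close> from the dual of \<open>C\<^sub>i\<close> to \<open>Q\<close> with \<open>F(f a) = F(f) a\<close> consists of the slices of exactly one
  \<open>t\<close> (\<open>functional_is_slice\<close>). This inverts all the translations above. On objects: in a graded module
  \<open>N\<close>, the ring \<open>A\<close> acts through the elements \<open>\<epsilon>(-)a\<close>, the maps \<open>f \<mapsto> m \<cdot> f\<close> are given by a unique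
  element \<open>\<rho>(m)\<close>, and linearity, coassociativity and counitality of \<open>\<rho>\<close> hold because they hold after
  slicing. On morphisms: a graded linear map commutes with all slices of the coactions, hence with the
  coactions. The functor is therefore bijective on objects and on morphisms
  (\<open>isomorphism_of_categoriesI\<close>).
\<close>

section \<open>Tensor products and their universal property\<close>

definition balanced ::
  "('a, 'x) ring_scheme \<Rightarrow> ('a, 'm, 'y) rmod_scheme \<Rightarrow> ('a, 'n, 'z) lmod_scheme \<Rightarrow> ('q, 'w) monoid_scheme
    \<Rightarrow> ('m \<Rightarrow> 'n \<Rightarrow> 'q) \<Rightarrow> bool"
  where "balanced A M N Q b \<longleftrightarrow>
    (\<forall>m\<in>carrier M. \<forall>n\<in>carrier N. b m n \<in> carrier Q) \<and>
    (\<forall>m\<in>carrier M. \<forall>m'\<in>carrier M. \<forall>n\<in>carrier N. b (m \<otimes>\<^bsub>M\<^esub> m') n = b m n \<otimes>\<^bsub>Q\<^esub> b m' n) \<and>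
    (\<forall>m\<in>carrier M. \<forall>n\<in>carrier N. \<forall>n'\<in>carrier N. b m (n \<otimes>\<^bsub>N\<^esub> n') = b m n \<otimes>\<^bsub>Q\<^esub> b m n') \<and>
    (\<forall>m\<in>carrier M. \<forall>a\<in>carrier A. \<forall>n\<in>carrier N. b (ract M m a) n = b m (lact N a n))"

lemma balancedI:
  assumes "\<And>m n. \<lbrakk>m \<in> carrier M; n \<in> carrier N\<rbrakk> \<Longrightarrow> b m n \<in> carrier Q"
    and "\<And>m m' n. \<lbrakk>m \<in> carrier M; m' \<in> carrier M; n \<in> carrier N\<rbrakk>
      \<Longrightarrow> b (m \<otimes>\<^bsub>M\<^esub> m') n = b m n \<otimes>\<^bsub>Q\<^esub> b m' n"
    and "\<And>m n n'. \<lbrakk>m \<in> carrier M; n \<in> carrier N; n' \<in> carrier N\<rbrakk>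
      \<Longrightarrow> b m (n \<otimes>\<^bsub>N\<^esub> n') = b m n \<otimes>\<^bsub>Q\<^esub> b m n'"
    and "\<And>m a n. \<lbrakk>m \<in> carrier M; a \<in> carrier A; n \<in> carrier N\<rbrakk> \<Longrightarrow> b (ract M m a) n = b m (lact N a n)"
  shows "balanced A M N Q b"
  using assms by (simp add: balanced_def)

lemma hom_free_Abelian_group_diff:
  assumes "group_hom (free_Abelian_group S) Q h"
    and "x \<in> carrier (free_Abelian_group S)" "y \<in> carrier (free_Abelian_group S)"
  shows "h (x - y) = h x \<otimes>\<^bsub>Q\<^esub> inv\<^bsub>Q\<^esub> h y"
proof -
  interpret h: group_hom "free_Abelian_group S" Q h by fact
  have "x - y = x \<otimes>\<^bsub>free_Abelian_group S\<^esub> inv\<^bsub>free_Abelian_group S\<^esub> y" using assms(2,3) by simp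
  then show ?thesis using assms(2,3) by (simp add: h.hom_inv del: mult_free_Abelian_group inv_free_Abelian_group carrier_free_Abelian_group_iff)
qed

locale tensor_product = M: right_module A M + N: left_module A N
  for A :: "('a, 'x) ring_scheme" (structure)
    and M :: "('a, 'm, 'y) rmod_scheme" and N :: "('a, 'n, 'z) lmod_scheme"
begin

abbreviation "free_group \<equiv> free_Abelian_group (carrier M \<times> carrier N)"
abbreviation "T \<equiv> tensor A M N"
abbreviation "ptensor \<equiv> pure_tensor A M N"
abbreviation "proj x \<equiv> tensor_kernel A M N #>\<^bsub>free_group\<^esub> x"

lemma tensor_relations_subset: "tensor_relations A M N \<subseteq> carrier free_group"
proof -
  have diff: "x - y \<in> carrier free_group" if "x \<in> carrier free_group" "y \<in> carrier free_group" for x y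
    using that keys_diff[of x y] by auto
  show ?thesis
    unfolding tensor_relations_def
    by (auto intro!: diff simp: M.ract_closed N.lact_closed simp del: carrier_free_Abelian_group_iff)
qed

lemma tensor_kernel_subgroup: "subgroup (tensor_kernel A M N) free_group"
  unfolding tensor_kernel_def
  by (rule group.generate_is_subgroup[OF group_free_Abelian_group tensor_relations_subset])

lemma tensor_kernel_normal: "tensor_kernel A M N \<lhd> free_group"
  by (metis tensor_kernel_subgroup abelian_free_Abelian_group comm_group.normal_iff_subgroup)

lemma tensor_comm_group: "comm_group T"
  unfolding tensor_def
  by (rule comm_group.abelian_FactGroup[OF abelian_free_Abelian_group tensor_kernel_subgroup])

sublocale T: comm_group T by (rule tensor_comm_group)

lemma proj_hom: "group_hom free_group T (\<lambda>x. proj x)"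
  by (intro group_hom.intro group_free_Abelian_group T.is_group group_hom_axioms.intro)
    (simp add: tensor_def normal.r_coset_hom_Mod[OF tensor_kernel_normal])

sublocale proj: group_hom free_group T "\<lambda>x. proj x" by (rule proj_hom)

lemma proj_relation:
  assumes "r \<in> tensor_relations A M N"
  shows "proj r = \<one>\<^bsub>T\<^esub>"
proof -
  have "r \<in> carrier free_group" "r \<in> tensor_kernel A M N"
    using assms tensor_relations_subset by (auto simp: tensor_kernel_def simp del: carrier_free_Abelian_group_iff intro: generate.incl)
  then show ?thesis
    using group.coset_join2[OF group_free_Abelian_group _ tensor_kernel_subgroup] by (simp add: tensor_def)
qed

lemmas proj_diff = hom_free_Abelian_group_diff[OF proj_hom]

lemma pure_closed [simp]: "\<lbrakk>m \<in> carrier M; n \<in> carrier N\<rbrakk> \<Longrightarrow> ptensor m n \<in> carrier T"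
  unfolding pure_tensor_def by (rule proj.hom_closed) simp

lemma proj_relation_add:
  assumes "x - y - z \<in> tensor_relations A M N" "y \<in> carrier free_group" "z \<in> carrier free_group"
  shows "proj x = proj y \<otimes>\<^bsub>T\<^esub> proj z"
proof -
  have "proj ((x - y - z) \<otimes>\<^bsub>free_group\<^esub> (y \<otimes>\<^bsub>free_group\<^esub> z)) = proj y \<otimes>\<^bsub>T\<^esub> proj z"
    using assms tensor_relations_subset
    by (simp add: proj_relation subset_iff del: mult_free_Abelian_group carrier_free_Abelian_group_iff)
  then show ?thesis by simp
qed

lemma pure_add_left:
  assumes "m \<in> carrier M" "m' \<in> carrier M" "n \<in> carrier N"
  shows "ptensor (m \<otimes>\<^bsub>M\<^esub> m') n = ptensor m n \<otimes>\<^bsub>T\<^esub> ptensor m' n"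
  unfolding pure_tensor_def using assms
  by (intro proj_relation_add) (auto simp: tensor_relations_def)

lemma pure_add_right:
  assumes "m \<in> carrier M" "n' \<in> carrier N" "n \<in> carrier N"
  shows "ptensor m (n \<otimes>\<^bsub>N\<^esub> n') = ptensor m n \<otimes>\<^bsub>T\<^esub> ptensor m n'"
  unfolding pure_tensor_def using assms
  by (intro proj_relation_add) (auto simp: tensor_relations_def)

lemma pure_balanced:
  assumes "m \<in> carrier M" "a \<in> carrier A" "n \<in> carrier N"
  shows "ptensor (ract M m a) n = ptensor m (lact N a n)"
proof -
  have "proj (frag_of (ract M m a, n) - frag_of (m, lact N a n)) = \<one>\<^bsub>T\<^esub>"
    using assms by (intro proj_relation) (auto simp: tensor_relations_def)
  then have "proj (frag_of (ract M m a, n)) \<otimes>\<^bsub>T\<^esub> inv\<^bsub>T\<^esub> proj (frag_of (m, lact N a n)) = \<one>\<^bsub>T\<^esub>"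
    using assms by (subst (asm) proj_diff) (simp_all add: M.ract_closed N.lact_closed)
  then show ?thesis using assms unfolding pure_tensor_def
    by (metis M.ract_closed N.lact_closed SigmaI T.inv_equality T.inv_inv T.inv_closed frag_of_in_free_Abelian_group proj.hom_closed)
qed

lemma pure_zero_left: "n \<in> carrier N \<Longrightarrow> ptensor \<one>\<^bsub>M\<^esub> n = \<one>\<^bsub>T\<^esub>"
  by (metis M.M.l_one M.M.one_closed T.l_cancel_one' pure_add_left pure_closed)

lemma inv_pure: "\<lbrakk>m \<in> carrier M; n \<in> carrier N\<rbrakk> \<Longrightarrow> inv\<^bsub>T\<^esub> ptensor m n = ptensor (inv\<^bsub>M\<^esub> m) n"
  by (metis M.M.inv_closed M.M.l_inv T.inv_equality pure_add_left pure_closed pure_zero_left)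

text \<open>Pure tensors are closed under inverses, so they generate under addition alone.\<close>

lemma tensor_induct [consumes 1, case_names pure add]:
  assumes t: "t \<in> carrier T"
    and pure: "\<And>m n. \<lbrakk>m \<in> carrier M; n \<in> carrier N\<rbrakk> \<Longrightarrow> P (ptensor m n)"
    and add: "\<And>s t. \<lbrakk>s \<in> carrier T; t \<in> carrier T; P s; P t\<rbrakk> \<Longrightarrow> P (s \<otimes>\<^bsub>T\<^esub> t)"
  shows "P t"
proof -
  obtain x where x: "x \<in> carrier free_group" "t = proj x"
    using t by (auto simp: tensor_def carrier_FactGroup)
  have "P (proj x) \<and> P (inv\<^bsub>T\<^esub> proj x)"
    using x(1)[unfolded carrier_free_Abelian_group_iff]
  proof (induction x rule: free_Abelian_group_induct[consumes 1, case_names zero diff frag])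
    case zero
    have "P \<one>\<^bsub>T\<^esub>" using pure[OF M.M.one_closed N.M.one_closed] by (simp add: pure_zero_left)
    then show ?case using proj.hom_one by simp
  next
    case (diff x y)
    then have *: "proj x \<in> carrier T" "proj y \<in> carrier T" "proj (x - y) = proj x \<otimes>\<^bsub>T\<^esub> inv\<^bsub>T\<^esub> proj y"
      by (simp_all add: proj_diff)
    have "inv\<^bsub>T\<^esub> (proj x \<otimes>\<^bsub>T\<^esub> inv\<^bsub>T\<^esub> proj y) = proj y \<otimes>\<^bsub>T\<^esub> inv\<^bsub>T\<^esub> proj x"
      using * by (simp add: T.inv_mult_group)
    then show ?case using * diff add by simp
  next
    case (frag p)
    then obtain m n where p: "p = (m, n)" "m \<in> carrier M" "n \<in> carrier N" by auto
    then have "inv\<^bsub>T\<^esub> proj (frag_of p) = ptensor (inv\<^bsub>M\<^esub> m) n"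
      by (simp add: inv_pure flip: pure_tensor_def)
    then show ?case using p pure by (simp flip: pure_tensor_def)
  qed
  then show ?thesis by (simp add: x)
qed

lemma tensor_hom_eqI:
  assumes "h \<in> hom T Q" "k \<in> hom T Q"
    and "\<And>m n. \<lbrakk>m \<in> carrier M; n \<in> carrier N\<rbrakk> \<Longrightarrow> h (ptensor m n) = k (ptensor m n)"
    and "t \<in> carrier T"
  shows "h t = k t"
  using assms(4) by (induction rule: tensor_induct) (simp_all add: assms hom_mult[OF assms(1)] hom_mult[OF assms(2)])

text \<open>
  Uniqueness holds because pure tensors generate. For existence the map on generators extends to the
  free abelian group; it kills the three families of relations, hence the subgroup that they generate.
\<close>

lemma tensor_lift_ex1:
  assumes "comm_group Q" and b: "balanced A M N Q b"
  shows "\<exists>!h. h \<in> hom T Q \<and> h \<in> extensional (carrier T) \<and>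
    (\<forall>m\<in>carrier M. \<forall>n\<in>carrier N. h (ptensor m n) = b m n)"
proof (rule ex_ex1I)
  interpret Q: comm_group Q by fact
  have "(\<lambda>(m, n). b m n) ` (carrier M \<times> carrier N) \<subseteq> carrier Q"
    using b by (auto simp: balanced_def)
  then obtain h where h: "h \<in> hom free_group Q"
      and hb: "\<And>p. p \<in> carrier M \<times> carrier N \<Longrightarrow> h (frag_of p) = (\<lambda>(m, n). b m n) p"
    by (rule Q.free_Abelian_group_universal) blast
  interpret h: group_hom free_group Q h
    by (intro group_hom.intro group_free_Abelian_group Q.is_group group_hom_axioms.intro h)
  note h_diff = hom_free_Abelian_group_diff[OF h.group_hom_axioms]
  have diff: "x - y \<in> carrier free_group" if "x \<in> carrier free_group" "y \<in> carrier free_group" for x y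
    using that keys_diff[of x y] by auto
  have bc: "b m n \<in> carrier Q" if "m \<in> carrier M" "n \<in> carrier N" for m n
    using b that by (simp add: balanced_def)
  \<comment> \<open>every relation has the form \<open>u - v - w\<close> or \<open>u - v\<close>\<close>
  have cancel: "u = v \<otimes>\<^bsub>Q\<^esub> w \<Longrightarrow> u \<otimes>\<^bsub>Q\<^esub> inv\<^bsub>Q\<^esub> v \<otimes>\<^bsub>Q\<^esub> inv\<^bsub>Q\<^esub> w = \<one>\<^bsub>Q\<^esub>"
    if "v \<in> carrier Q" "w \<in> carrier Q" for u v w
    using that by (metis Q.inv_mult Q.m_assoc Q.m_closed Q.inv_closed Q.r_inv)
  have "h r = \<one>\<^bsub>Q\<^esub>" if "r \<in> tensor_relations A M N" for r
    using that b unfolding tensor_relations_def balanced_def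
    by (auto simp: h_diff diff hb M.ract_closed N.lact_closed cancel simp del: carrier_free_Abelian_group_iff)
  then have "tensor_relations A M N \<subseteq> kernel free_group Q h"
    using tensor_relations_subset by (auto simp: kernel_def simp del: carrier_free_Abelian_group_iff)
  then have "tensor_kernel A M N \<subseteq> kernel free_group Q h"
    unfolding tensor_kernel_def
    by (intro group.generate_subgroup_incl[OF group_free_Abelian_group] h.subgroup_kernel)
  then have ker: "h k = \<one>\<^bsub>Q\<^esub>" "k \<in> carrier free_group" if "k \<in> tensor_kernel A M N" for k
    using that by (auto simp: kernel_def)
  have same: "h x = h y" if "x \<in> carrier free_group" "y \<in> carrier free_group" "proj x = proj y" for x y
  proof -
    have "x \<in> proj y"
      using group.rcos_self[OF group_free_Abelian_group that(1) tensor_kernel_subgroup] unfolding that(3) .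
    then obtain k where k: "k \<in> tensor_kernel A M N" "x = k \<otimes>\<^bsub>free_group\<^esub> y"
      unfolding r_coset_def by blast
    have "h x = h k \<otimes>\<^bsub>Q\<^esub> h y"
      unfolding k(2) by (rule h.hom_mult[OF ker(2)[OF k(1)] that(2)])
    then show ?thesis using ker(1)[OF k(1)] h.hom_closed[OF that(2)] by simp
  qed
  obtain g where "g \<in> hom (free_group Mod tensor_kernel A M N) Q"
      and g': "\<And>x. x \<in> carrier free_group \<Longrightarrow> g (proj x) = h x"
    by (rule FactGroup_universal[OF h tensor_kernel_normal same], assumption+) (rule that)
  then have g: "g \<in> hom T Q" by (simp add: tensor_def)
  have "restrict g (carrier T) \<in> hom T Q"
    using g by (auto simp: hom_def)
  moreover have "restrict g (carrier T) (ptensor m n) = b m n" if "m \<in> carrier M" "n \<in> carrier N" for m n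
    using that g' hb[of "(m, n)"] pure_closed[OF that] by (simp add: pure_tensor_def)
  ultimately show "\<exists>h. h \<in> hom T Q \<and> h \<in> extensional (carrier T) \<and>
      (\<forall>m\<in>carrier M. \<forall>n\<in>carrier N. h (ptensor m n) = b m n)"
    by (intro exI[of _ "restrict g (carrier T)"]) simp
next
  fix h k
  assume h: "h \<in> hom T Q \<and> h \<in> extensional (carrier T) \<and> (\<forall>m\<in>carrier M. \<forall>n\<in>carrier N. h (ptensor m n) = b m n)"
    and k: "k \<in> hom T Q \<and> k \<in> extensional (carrier T) \<and> (\<forall>m\<in>carrier M. \<forall>n\<in>carrier N. k (ptensor m n) = b m n)"
  show "h = k"
  proof (rule extensionalityI[of _ "carrier T"])
    show "h t = k t" if "t \<in> carrier T" for t
      by (rule tensor_hom_eqI[OF _ _ _ that, of _ Q]) (simp_all add: h k)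
  qed (use h k in blast)+
qed

lemma
  assumes "comm_group Q" and "balanced A M N Q b"
  shows tensor_lift_hom: "tensor_lift A M N Q b \<in> hom T Q"
    and tensor_lift_pure: "\<lbrakk>m \<in> carrier M; n \<in> carrier N\<rbrakk> \<Longrightarrow> tensor_lift A M N Q b (ptensor m n) = b m n"
  using theI'[OF tensor_lift_ex1[OF assms]] unfolding tensor_lift_def by auto

lemma tensor_lift_cong:
  assumes "\<And>m n. \<lbrakk>m \<in> carrier M; n \<in> carrier N\<rbrakk> \<Longrightarrow> b m n = b' m n"
  shows "tensor_lift A M N Q b = tensor_lift A M N Q b'"
  unfolding tensor_lift_def using assms by (intro arg_cong[of _ _ The] ext) auto

end


section \<open>Linear maps\<close>

lemma right_of_simps [simp]:
  "carrier (right_of B) = carrier B" "x \<otimes>\<^bsub>right_of B\<^esub> y = x \<otimes>\<^bsub>B\<^esub> y" "\<one>\<^bsub>right_of B\<^esub> = \<one>\<^bsub>B\<^esub>"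
  "ract (right_of B) = bract B"
  by (simp_all add: right_of_def)

lemma hom_right_of [simp]: "hom H (right_of B) = hom H B" "hom (right_of B) H = hom B H"
  by (simp_all add: hom_def)

lemma regular_simps [simp]:
  "carrier (regular A) = carrier A" "x \<otimes>\<^bsub>regular A\<^esub> y = x \<oplus>\<^bsub>A\<^esub> y" "\<one>\<^bsub>regular A\<^esub> = \<zero>\<^bsub>A\<^esub>"
  "lact (regular A) = monoid.mult A" "bract (regular A) = monoid.mult A"
  by (simp_all add: regular_def)

text \<open>
  The same additive group occurs inside records of different types (one-sided modules, bimodules,
  plain monoids); this lemma moves the group axioms between them.
\<close>

lemma comm_group_transfer:
  assumes "comm_group M" "carrier N = carrier M" "\<And>x y. x \<otimes>\<^bsub>N\<^esub> y = x \<otimes>\<^bsub>M\<^esub> y" "\<one>\<^bsub>N\<^esub> = \<one>\<^bsub>M\<^esub>"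
  shows "comm_group N"
proof -
  interpret M: comm_group M by fact
  show ?thesis by (rule comm_groupI) (auto simp: assms(2-) M.m_ac intro: M.l_inv_ex)
qed

lemma regular_bimodule: "ring A \<Longrightarrow> bimodule A (regular A)"
proof -
  assume "ring A"
  then interpret ring A .
  have "comm_group (add_monoid A)" by (rule a_comm_group)
  then have "comm_group (regular A)" "comm_group (right_of (regular A))"
    by (rule comm_group_transfer; simp)+
  then show ?thesis
    by (intro bimodule.intro left_module.intro right_module.intro left_module_axioms.intro
        right_module_axioms.intro bimodule_axioms.intro \<open>ring A\<close>) (simp_all add: l_distr r_distr m_assoc)
qed

lemma right_linear_iff:
  "f \<in> right_linear A M N \<longleftrightarrow>
    (\<forall>m\<in>carrier M. f m \<in> carrier N) \<and>
    (\<forall>m\<in>carrier M. \<forall>m'\<in>carrier M. f (m \<otimes>\<^bsub>M\<^esub> m') = f m \<otimes>\<^bsub>N\<^esub> f m') \<and>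
    (\<forall>m\<in>carrier M. \<forall>a\<in>carrier A. f (ract M m a) = ract N (f m) a)"
  by (auto simp: right_linear_def hom_def)

lemma left_linear_iff:
  "f \<in> left_linear A M N \<longleftrightarrow>
    (\<forall>m\<in>carrier M. f m \<in> carrier N) \<and>
    (\<forall>m\<in>carrier M. \<forall>m'\<in>carrier M. f (m \<otimes>\<^bsub>M\<^esub> m') = f m \<otimes>\<^bsub>N\<^esub> f m') \<and>
    (\<forall>m\<in>carrier M. \<forall>a\<in>carrier A. f (lact M a m) = lact N a (f m))"
  by (auto simp: left_linear_def hom_def)

lemma left_linear_comp:
  "\<lbrakk>f \<in> left_linear A M N; g \<in> left_linear A N P\<rbrakk> \<Longrightarrow> (\<lambda>m. g (f m)) \<in> left_linear A M P"
  by (simp add: left_linear_iff)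

lemma left_linear_id: "(\<lambda>m. m) \<in> left_linear A M M" by (simp add: left_linear_iff)
lemma right_linear_id: "(\<lambda>m. m) \<in> right_linear A M M" by (simp add: right_linear_iff)

lemma left_linear_cong:
  assumes "left_module A M" "\<And>m. m \<in> carrier M \<Longrightarrow> f m = g m"
  shows "f \<in> left_linear A M N \<longleftrightarrow> g \<in> left_linear A M N"
proof -
  interpret M: left_module A M by fact
  show ?thesis by (simp add: left_linear_iff assms(2) M.lact_closed)
qed

lemma hom_finprod:
  assumes "h \<in> hom H K" "comm_group H" "comm_group K" "g \<in> I \<rightarrow> carrier H"
  shows "h (finprod H g I) = finprod K (\<lambda>i. h (g i)) I"
proof -
  interpret H: comm_group H by fact
  interpret K: comm_group K by fact
  have "h \<one>\<^bsub>H\<^esub> = \<one>\<^bsub>K\<^esub>" using assms(1) by (intro hom_one H.is_group K.is_group)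
  moreover have "h x \<in> carrier K" if "x \<in> carrier H" for x using assms(1) that by (auto simp: hom_def)
  ultimately show ?thesis using assms(4)
  proof (induction I rule: infinite_finite_induct)
    case (insert i I)
    then have "g \<in> I \<rightarrow> carrier H" "g i \<in> carrier H" "(\<lambda>i. h (g i)) \<in> I \<rightarrow> carrier K" "h (g i) \<in> carrier K"
      by (auto simp: Pi_iff)
    then show ?case using insert by (simp add: hom_mult[OF assms(1)])
  qed simp_all
qed


section \<open>Maps between tensor products\<close>

lemma tensor_productI: "\<lbrakk>right_module A M; left_module A N\<rbrakk> \<Longrightarrow> tensor_product A M N"
  by (rule tensor_product.intro)

lemma
  assumes "tensor_product A M N" "tensor_product A M' N'"
    and f: "f \<in> right_linear A M M'" and g: "g \<in> left_linear A N N'"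
  shows tensor_map_hom: "tensor_map A M N M' N' f g \<in> hom (tensor A M N) (tensor A M' N')"
    and tensor_map_pure: "\<lbrakk>m \<in> carrier M; n \<in> carrier N\<rbrakk>
      \<Longrightarrow> tensor_map A M N M' N' f g (pure_tensor A M N m n) = pure_tensor A M' N' (f m) (g n)"
proof -
  interpret X: tensor_product A M N by fact
  interpret Y: tensor_product A M' N' by fact
  have b: "balanced A M N (tensor A M' N') (\<lambda>m n. pure_tensor A M' N' (f m) (g n))"
    using f g by (intro balancedI)
      (simp_all add: right_linear_iff left_linear_iff Y.pure_add_left Y.pure_add_right Y.pure_balanced)
  show "tensor_map A M N M' N' f g \<in> hom (tensor A M N) (tensor A M' N')"
    and "\<lbrakk>m \<in> carrier M; n \<in> carrier N\<rbrakk>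
      \<Longrightarrow> tensor_map A M N M' N' f g (pure_tensor A M N m n) = pure_tensor A M' N' (f m) (g n)"
    unfolding tensor_map_def
    by (simp_all add: X.tensor_lift_hom[OF Y.tensor_comm_group b] X.tensor_lift_pure[OF Y.tensor_comm_group b])
qed

lemma
  assumes "tensor_product A M N" "tensor_product A M' N'"
    and "f \<in> right_linear A M M'" and "g \<in> left_linear A N N'"
  shows tensor_map_closed: "t \<in> carrier (tensor A M N) \<Longrightarrow> tensor_map A M N M' N' f g t \<in> carrier (tensor A M' N')"
    and tensor_map_mult: "\<lbrakk>s \<in> carrier (tensor A M N); t \<in> carrier (tensor A M N)\<rbrakk> \<Longrightarrow>
      tensor_map A M N M' N' f g (s \<otimes>\<^bsub>tensor A M N\<^esub> t)
      = tensor_map A M N M' N' f g s \<otimes>\<^bsub>tensor A M' N'\<^esub> tensor_map A M N M' N' f g t"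
  using tensor_map_hom[OF assms] by (auto simp: hom_def)

lemma tensor_map_id:
  assumes "tensor_product A M N" "t \<in> carrier (tensor A M N)"
    and "\<And>m. m \<in> carrier M \<Longrightarrow> f m = m" "\<And>n. n \<in> carrier N \<Longrightarrow> g n = n"
  shows "tensor_map A M N M N f g t = t"
proof -
  interpret X: tensor_product A M N by fact
  have f: "f \<in> right_linear A M M" and g: "g \<in> left_linear A N N"
    by (simp_all add: right_linear_iff left_linear_iff assms(3,4) X.M.ract_closed X.N.lact_closed)
  from assms(2) show ?thesis
    by (induction rule: X.tensor_induct)
      (simp_all add: tensor_map_pure[OF assms(1,1) f g] tensor_map_mult[OF assms(1,1) f g] assms(3,4))
qed

lemma tensor_map_comp:
  assumes X: "tensor_product A M N" and Y: "tensor_product A M' N'" and Z: "tensor_product A M'' N''"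
    and f: "f \<in> right_linear A M M'" and g: "g \<in> left_linear A N N'"
    and f': "f' \<in> right_linear A M' M''" and g': "g' \<in> left_linear A N' N''"
    and k: "\<And>m. m \<in> carrier M \<Longrightarrow> k m = f' (f m)" and l: "\<And>n. n \<in> carrier N \<Longrightarrow> l n = g' (g n)"
    and t: "t \<in> carrier (tensor A M N)"
  shows "tensor_map A M N M'' N'' k l t = tensor_map A M' N' M'' N'' f' g' (tensor_map A M N M' N' f g t)"
proof -
  interpret X: tensor_product A M N by fact
  interpret Y: tensor_product A M' N' by fact
  have k': "k \<in> right_linear A M M''" and l': "l \<in> left_linear A N N''"
    using f f' g g' by (simp_all add: right_linear_iff left_linear_iff k l X.M.ract_closed X.N.lact_closed)
  have c: "f m \<in> carrier M'" "g n \<in> carrier N'" if "m \<in> carrier M" "n \<in> carrier N" for m n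
    using f g that by (simp_all add: right_linear_iff left_linear_iff)
  from t show ?thesis
    by (induction rule: X.tensor_induct)
      (simp_all add: tensor_map_pure[OF X Z k' l'] tensor_map_mult[OF X Z k' l'] tensor_map_pure[OF X Y f g]
        tensor_map_mult[OF X Y f g] tensor_map_pure[OF Y Z f' g'] tensor_map_mult[OF Y Z f' g']
        tensor_map_closed[OF X Y f g] c k l)
qed

lemma (in bimodule) left_mod: "left_module A B" and right_mod: "right_module A (right_of B)"
  by (rule left_module_axioms, rule right.right_module_axioms)

lemma (in bimodule) bract_facts:
  "\<lbrakk>m \<in> carrier B; a \<in> carrier A\<rbrakk> \<Longrightarrow> bract B m a \<in> carrier B"
  "\<lbrakk>m \<in> carrier B; n \<in> carrier B; a \<in> carrier A\<rbrakk> \<Longrightarrow> bract B (m \<otimes>\<^bsub>B\<^esub> n) a = bract B m a \<otimes>\<^bsub>B\<^esub> bract B n a"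
  "\<lbrakk>m \<in> carrier B; a \<in> carrier A; b \<in> carrier A\<rbrakk> \<Longrightarrow> bract B m (a \<oplus> b) = bract B m a \<otimes>\<^bsub>B\<^esub> bract B m b"
  "\<lbrakk>m \<in> carrier B; a \<in> carrier A; b \<in> carrier A\<rbrakk> \<Longrightarrow> bract B m (a \<otimes> b) = bract B (bract B m a) b"
  "m \<in> carrier B \<Longrightarrow> bract B m \<one> = m"
  using right.ract_closed[of m a] right.ract_add_left[of m n a] right.ract_add_right[of m a b]
    right.ract_mult[of m a b] right.ract_one[of m] by simp_all

lemma (in bimodule) bract_left_linear: "a \<in> carrier A \<Longrightarrow> (\<lambda>b. bract B b a) \<in> left_linear A B B"
  by (simp add: left_linear_iff bract_facts lact_bract)

lemma (in bimodule) lact_right_linear: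
  "a \<in> carrier A \<Longrightarrow> (\<lambda>b. lact B a b) \<in> right_linear A (right_of B) (right_of B)"
  by (simp add: right_linear_iff lact_closed lact_add_right lact_bract)

lemma tensor_rmod_simps [simp]:
  "carrier (tensor_rmod A M B) = carrier (tensor A M B)"
  "x \<otimes>\<^bsub>tensor_rmod A M B\<^esub> y = x \<otimes>\<^bsub>tensor A M B\<^esub> y"
  "\<one>\<^bsub>tensor_rmod A M B\<^esub> = \<one>\<^bsub>tensor A M B\<^esub>"
  by (simp_all add: tensor_rmod_def)

lemma tensor_bimod_simps [simp]:
  "carrier (tensor_bimod A B B') = carrier (tensor A (right_of B) B')"
  "x \<otimes>\<^bsub>tensor_bimod A B B'\<^esub> y = x \<otimes>\<^bsub>tensor A (right_of B) B'\<^esub> y"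
  "\<one>\<^bsub>tensor_bimod A B B'\<^esub> = \<one>\<^bsub>tensor A (right_of B) B'\<^esub>"
  by (simp_all add: tensor_bimod_def)

text \<open>
  The right module underlying the bimodule \<open>B \<otimes> B'\<close> is literally the right module \<open>B \<otimes> B'\<close>, so one
  set of lemmas serves for corings and for comodules.
\<close>

lemma right_of_tensor_bimod: "right_of (tensor_bimod A B B') = tensor_rmod A (right_of B) B'"
  by (simp add: right_of_def tensor_bimod_def tensor_rmod_def)

lemma tensor_rmod_ract:
  assumes "right_module A M" "bimodule A B" "m \<in> carrier M" "b \<in> carrier B" "a \<in> carrier A"
  shows "ract (tensor_rmod A M B) (pure_tensor A M B m b) a = pure_tensor A M B m (bract B b a)"
proof -
  interpret B: bimodule A B by fact
  have X: "tensor_product A M B" by (intro tensor_productI assms B.left_mod)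
  show ?thesis unfolding tensor_rmod_def
    using tensor_map_pure[OF X X right_linear_id B.bract_left_linear[OF assms(5)] assms(3,4)] by simp
qed

lemma tensor_rmod_right_module:
  assumes "right_module A M" "bimodule A B"
  shows "right_module A (tensor_rmod A M B)"
proof -
  interpret B: bimodule A B by fact
  interpret X: tensor_product A M B by (intro tensor_productI assms B.left_mod)
  note X = X.tensor_product_axioms
  define r where "r = ract (tensor_rmod A M B)"
  have r: "r t a = tensor_map A M B M B (\<lambda>m. m) (\<lambda>b. bract B b a) t" for t a
    by (simp add: r_def tensor_rmod_def)
  have closed: "r t a \<in> carrier X.T" if "t \<in> carrier X.T" "a \<in> carrier A" for t a
    unfolding r using tensor_map_closed[OF X X right_linear_id B.bract_left_linear[OF that(2)] that(1)] .
  have add: "r (s \<otimes>\<^bsub>X.T\<^esub> t) a = r s a \<otimes>\<^bsub>X.T\<^esub> r t a"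
    if "s \<in> carrier X.T" "t \<in> carrier X.T" "a \<in> carrier A" for s t a
    unfolding r using tensor_map_mult[OF X X right_linear_id B.bract_left_linear[OF that(3)] that(1,2)] .
  have pure: "r (X.ptensor m b) a = X.ptensor m (bract B b a)"
    if "m \<in> carrier M" "b \<in> carrier B" "a \<in> carrier A" for m b a
    unfolding r_def by (rule tensor_rmod_ract[OF assms that])
  note B.bract_facts [simp]
  show ?thesis
  proof (intro right_module.intro right_module_axioms.intro, unfold tensor_rmod_simps r_def[symmetric])
    show "ring A" by (rule B.ring_axioms)
    show "comm_group (tensor_rmod A M B)" by (rule comm_group_transfer[OF X.tensor_comm_group]) simp_all
    fix t a b assume "t \<in> carrier X.T" "a \<in> carrier A" "b \<in> carrier A"
    then show "r t (a \<oplus>\<^bsub>A\<^esub> b) = r t a \<otimes>\<^bsub>X.T\<^esub> r t b" "r t (a \<otimes>\<^bsub>A\<^esub> b) = r (r t a) b"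
      by (induction rule: X.tensor_induct)
        (simp_all add: pure X.pure_add_right add closed X.T.m_ac)
  next
    fix t assume "t \<in> carrier X.T"
    then show "r t \<one>\<^bsub>A\<^esub> = t" by (induction rule: X.tensor_induct) (simp_all add: pure add)
  qed (simp_all add: closed add)
qed

lemma tensor_bimod_lact:
  assumes "bimodule A B" "bimodule A B'" "b \<in> carrier B" "b' \<in> carrier B'" "a \<in> carrier A"
  shows "lact (tensor_bimod A B B') a (pure_tensor A (right_of B) B' b b')
    = pure_tensor A (right_of B) B' (lact B a b) b'"
proof -
  interpret B: bimodule A B by fact
  interpret B': bimodule A B' by fact
  have X: "tensor_product A (right_of B) B'" by (intro tensor_productI B.right_mod B'.left_mod)
  show ?thesis unfolding tensor_bimod_def
    using tensor_map_pure[OF X X B.lact_right_linear[OF assms(5)] left_linear_id, of b b'] assms by simp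
qed

lemma tensor_bimod_left_module:
  assumes "bimodule A B" "bimodule A B'"
  shows "left_module A (tensor_bimod A B B')"
proof -
  interpret B: bimodule A B by fact
  interpret B': bimodule A B' by fact
  interpret X: tensor_product A "right_of B" B' by (intro tensor_productI B.right_mod B'.left_mod)
  note X = X.tensor_product_axioms
  define l where "l = lact (tensor_bimod A B B')"
  have l: "l a t = tensor_map A (right_of B) B' (right_of B) B' (\<lambda>b. lact B a b) (\<lambda>b. b) t" for t a
    by (simp add: l_def tensor_bimod_def)
  have closed: "l a t \<in> carrier X.T" if "t \<in> carrier X.T" "a \<in> carrier A" for t a
    unfolding l using tensor_map_closed[OF X X B.lact_right_linear[OF that(2)] left_linear_id that(1)] .
  have add: "l a (s \<otimes>\<^bsub>X.T\<^esub> t) = l a s \<otimes>\<^bsub>X.T\<^esub> l a t"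
    if "s \<in> carrier X.T" "t \<in> carrier X.T" "a \<in> carrier A" for s t a
    unfolding l using tensor_map_mult[OF X X B.lact_right_linear[OF that(3)] left_linear_id that(1,2)] .
  have pure: "l a (X.ptensor m b) = X.ptensor (lact B a m) b"
    if "m \<in> carrier B" "b \<in> carrier B'" "a \<in> carrier A" for m b a
    unfolding l_def by (rule tensor_bimod_lact[OF assms that])
  note B.lact_closed [simp] B.lact_one [simp] B.lact_add_left [simp] B.lact_mult [simp]
  have pal: "X.ptensor (m \<otimes>\<^bsub>B\<^esub> m') n = X.ptensor m n \<otimes>\<^bsub>X.T\<^esub> X.ptensor m' n"
    if "m \<in> carrier B" "m' \<in> carrier B" "n \<in> carrier B'" for m m' n
    using X.pure_add_left[of m m' n] that by simp
  show ?thesis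
  proof (intro left_module.intro left_module_axioms.intro, unfold tensor_bimod_simps l_def[symmetric])
    show "ring A" by (rule B.ring_axioms)
    show "comm_group (tensor_bimod A B B')" by (rule comm_group_transfer[OF X.tensor_comm_group]) simp_all
    fix t a b assume "t \<in> carrier X.T" "a \<in> carrier A" "b \<in> carrier A"
    then show "l (a \<oplus>\<^bsub>A\<^esub> b) t = l a t \<otimes>\<^bsub>X.T\<^esub> l b t" "l (a \<otimes>\<^bsub>A\<^esub> b) t = l a (l b t)"
      by (induction rule: X.tensor_induct)
        (simp_all add: pure pal add closed X.T.m_ac)
  next
    fix t assume "t \<in> carrier X.T"
    then show "l \<one>\<^bsub>A\<^esub> t = t" by (induction rule: X.tensor_induct) (simp_all add: pure add)
  qed (simp_all add: closed add)
qed


section \<open>Slices by functionals\<close>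

text \<open>The composite of \<open>M \<otimes> f : M \<otimes> N \<rightarrow> M \<otimes> A\<close> with the isomorphism \<open>M \<otimes> A \<cong> M\<close>.\<close>

definition slice ::
  "('a, 'x) ring_scheme \<Rightarrow> ('a, 'm, 'y) rmod_scheme \<Rightarrow> ('a, 'n, 'z) lmod_scheme \<Rightarrow> ('n \<Rightarrow> 'a)
    \<Rightarrow> ('m \<times> 'n \<Rightarrow>\<^sub>0 int) set \<Rightarrow> 'm"
  where "slice A M N f = tensor_lift A M N M (\<lambda>m n. ract M m (f n))"

context tensor_product
begin

lemma slice_balanced:
  assumes "f \<in> left_linear A N (regular A)"
  shows "balanced A M N M (\<lambda>m n. ract M m (f n))"
  using assms
  by (intro balancedI)
    (simp_all add: left_linear_iff M.ract_closed M.ract_add_left M.ract_add_right M.ract_mult)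

lemma
  assumes "f \<in> left_linear A N (regular A)"
  shows slice_hom: "slice A M N f \<in> hom T M"
    and slice_pure: "\<lbrakk>m \<in> carrier M; n \<in> carrier N\<rbrakk> \<Longrightarrow> slice A M N f (ptensor m n) = ract M m (f n)"
  unfolding slice_def
  using tensor_lift_hom[OF M.M.comm_group_axioms slice_balanced[OF assms]]
    tensor_lift_pure[OF M.M.comm_group_axioms slice_balanced[OF assms]] by auto

lemma
  assumes "f \<in> left_linear A N (regular A)"
  shows slice_closed: "t \<in> carrier T \<Longrightarrow> slice A M N f t \<in> carrier M"
    and slice_mult: "\<lbrakk>s \<in> carrier T; t \<in> carrier T\<rbrakk>
      \<Longrightarrow> slice A M N f (s \<otimes>\<^bsub>T\<^esub> t) = slice A M N f s \<otimes>\<^bsub>M\<^esub> slice A M N f t"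
  using slice_hom[OF assms] by (auto simp: hom_def)

lemma slice_cong:
  assumes "\<And>n. n \<in> carrier N \<Longrightarrow> f n = g n"
  shows "slice A M N f = slice A M N g"
  unfolding slice_def by (rule tensor_lift_cong) (simp add: assms)

lemma slice_add:
  assumes f: "f \<in> left_linear A N (regular A)" and g: "g \<in> left_linear A N (regular A)"
    and k: "\<And>n. n \<in> carrier N \<Longrightarrow> k n = f n \<oplus> g n" and t: "t \<in> carrier T"
  shows "slice A M N k t = slice A M N f t \<otimes>\<^bsub>M\<^esub> slice A M N g t"
proof -
  have c: "f n \<in> carrier A" "g n \<in> carrier A" if "n \<in> carrier N" for n
    using f g that by (simp_all add: left_linear_iff)
  have kl: "k \<in> left_linear A N (regular A)"
    using f g by (simp add: left_linear_iff k M.r_distr M.a_ac N.lact_closed)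
  from t show ?thesis
    by (induction rule: tensor_induct)
      (simp_all add: slice_pure[OF f] slice_pure[OF g] slice_pure[OF kl] slice_mult[OF f] slice_mult[OF g]
        slice_mult[OF kl] slice_closed[OF f] slice_closed[OF g] k c M.ract_add_right M.M.m_ac)
qed

lemma slice_scale:
  assumes f: "f \<in> left_linear A N (regular A)" and a: "a \<in> carrier A"
    and k: "\<And>n. n \<in> carrier N \<Longrightarrow> k n = f n \<otimes> a" and t: "t \<in> carrier T"
  shows "slice A M N k t = ract M (slice A M N f t) a"
proof -
  have c: "f n \<in> carrier A" if "n \<in> carrier N" for n
    using f that by (simp_all add: left_linear_iff)
  have kl: "k \<in> left_linear A N (regular A)"
    using f a by (simp add: left_linear_iff k M.l_distr M.m_assoc N.lact_closed)
  from t show ?thesis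
    by (induction rule: tensor_induct)
      (simp_all add: slice_pure[OF f] slice_pure[OF kl] slice_mult[OF f]
        slice_mult[OF kl] slice_closed[OF f] k c a M.ract_mult M.ract_add_left)
qed

end

lemma slice_tensor_map_right:
  assumes M: "right_module A M" and N: "left_module A N" and N': "left_module A N'"
    and d: "d \<in> left_linear A N N'" and f: "f \<in> left_linear A N' (regular A)"
    and t: "t \<in> carrier (tensor A M N)"
  shows "slice A M N' f (tensor_map A M N M N' (\<lambda>m. m) d t) = slice A M N (\<lambda>n. f (d n)) t"
proof -
  interpret X: tensor_product A M N by (intro tensor_productI assms)
  interpret Y: tensor_product A M N' by (intro tensor_productI assms)
  note axs = X.tensor_product_axioms Y.tensor_product_axioms right_linear_id d
  have c: "d n \<in> carrier N'" if "n \<in> carrier N" for n using d that by (simp add: left_linear_iff)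
  from t show ?thesis
    by (induction rule: X.tensor_induct)
      (simp_all add: tensor_map_pure[OF axs] tensor_map_mult[OF axs] tensor_map_closed[OF axs] c
        Y.slice_pure[OF f] Y.slice_mult[OF f] X.slice_pure[OF left_linear_comp[OF d f]]
        X.slice_mult[OF left_linear_comp[OF d f]])
qed

lemma slice_tensor_map_left:
  assumes M: "right_module A M" and M': "right_module A M'" and N: "left_module A N"
    and h: "h \<in> right_linear A M M'" and f: "f \<in> left_linear A N (regular A)"
    and t: "t \<in> carrier (tensor A M N)"
  shows "slice A M' N f (tensor_map A M N M' N h (\<lambda>n. n) t) = h (slice A M N f t)"
proof -
  interpret X: tensor_product A M N by (intro tensor_productI assms)
  interpret Y: tensor_product A M' N by (intro tensor_productI assms)
  note axs = X.tensor_product_axioms Y.tensor_product_axioms h left_linear_id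
  have c: "h m \<in> carrier M'" if "m \<in> carrier M" for m using h that by (simp add: right_linear_iff)
  have r: "h (ract M m (f n)) = ract M' (h m) (f n)" if "m \<in> carrier M" "n \<in> carrier N" for m n
    using h f that by (simp add: left_linear_iff right_linear_iff)
  have a: "h (m \<otimes>\<^bsub>M\<^esub> m') = h m \<otimes>\<^bsub>M'\<^esub> h m'" if "m \<in> carrier M" "m' \<in> carrier M" for m m'
    using h that by (simp add: right_linear_iff)
  from t show ?thesis
    by (induction rule: X.tensor_induct)
      (simp_all add: tensor_map_pure[OF axs] tensor_map_mult[OF axs] tensor_map_closed[OF axs] c r a
        Y.slice_pure[OF f] Y.slice_mult[OF f] X.slice_pure[OF f] X.slice_mult[OF f] X.slice_closed[OF f])
qed

lemma right_unitor_slice: "right_unitor A M = slice A M (regular A) (\<lambda>a. a)"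
  by (simp add: right_unitor_def slice_def)

lemma right_unitor_tensor_map:
  assumes "right_module A M" and "left_module A N"
    and "e \<in> left_linear A N (regular A)" and "t \<in> carrier (tensor A M N)"
  shows "right_unitor A M (tensor_map A M N M (regular A) (\<lambda>m. m) e t) = slice A M N e t"
proof -
  interpret N: left_module A N by fact
  interpret reg: bimodule A "regular A" by (rule regular_bimodule[OF N.ring_axioms])
  show ?thesis unfolding right_unitor_slice
    by (rule slice_tensor_map_right[OF assms(1,2) reg.left_mod assms(3) left_linear_id assms(4)])
qed

lemma left_unitor_slice:
  assumes N: "left_module A N" and f: "f \<in> left_linear A N (regular A)"
    and t: "t \<in> carrier (tensor A (right_of (regular A)) N)"
  shows "f (left_unitor A N t) = slice A (right_of (regular A)) N f t"
proof -
  interpret N: left_module A N by fact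
  interpret reg: bimodule A "regular A" by (rule regular_bimodule[OF N.ring_axioms])
  interpret X: tensor_product A "right_of (regular A)" N by (intro tensor_productI assms reg.right_mod)
  have b: "balanced A (right_of (regular A)) N N (\<lambda>a n. lact N a n)"
    by (intro balancedI) (simp_all add: N.lact_closed N.lact_add_left N.lact_add_right N.lact_mult)
  note l = X.tensor_lift_hom[OF N.M.comm_group_axioms b, folded left_unitor_def]
    X.tensor_lift_pure[OF N.M.comm_group_axioms b, folded left_unitor_def]
  have c: "left_unitor A N s \<in> carrier N" if "s \<in> carrier X.T" for s
    using l(1) that by (auto simp: hom_def)
  have fm: "f (m \<otimes>\<^bsub>N\<^esub> n) = f m \<oplus>\<^bsub>A\<^esub> f n" if "m \<in> carrier N" "n \<in> carrier N" for m n
    using f that by (simp add: left_linear_iff)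
  have fl: "f (lact N a n) = a \<otimes>\<^bsub>A\<^esub> f n" if "a \<in> carrier A" "n \<in> carrier N" for a n
    using f that by (simp add: left_linear_iff)
  from t show "f (left_unitor A N t) = slice A (right_of (regular A)) N f t"
    by (induction rule: X.tensor_induct)
      (simp_all add: l(2) hom_mult[OF l(1)] X.slice_pure[OF f] X.slice_mult[OF f] c fm fl)
qed

text \<open>
  The unit isomorphism \<open>A \<otimes> N \<cong> N\<close> is not itself a slice, but it becomes one when a functional is
  applied to it: \<open>f(e(b) n) = e(b) f(n) = e(b f(n))\<close>.
\<close>

lemma left_unitor_tensor_map:
  assumes B: "bimodule A B" and N: "left_module A N"
    and e: "e \<in> right_linear A (right_of B) (right_of (regular A))" and f: "f \<in> left_linear A N (regular A)"
    and t: "t \<in> carrier (tensor A (right_of B) N)"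
  shows "f (left_unitor A N (tensor_map A (right_of B) N (right_of (regular A)) N e (\<lambda>n. n) t))
    = e (slice A (right_of B) N f t)"
proof -
  interpret B: bimodule A B by fact
  interpret reg: bimodule A "regular A" by (rule regular_bimodule[OF B.ring_axioms])
  have X: "tensor_product A (right_of B) N" "tensor_product A (right_of (regular A)) N"
    by (intro tensor_productI B.right_mod reg.right_mod N)+
  show ?thesis
    using left_unitor_slice[OF N f tensor_map_closed[OF X e left_linear_id t]]
      slice_tensor_map_left[OF B.right_mod reg.right_mod N e f t] by simp
qed

lemma slice_tensor_rmod_ract:
  assumes M: "right_module A M" and B: "bimodule A B" and f: "f \<in> left_linear A B (regular A)"
    and t: "t \<in> carrier (tensor A M B)" and a: "a \<in> carrier A"
  shows "slice A M B f (ract (tensor_rmod A M B) t a) = slice A M B (\<lambda>b. f (bract B b a)) t"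
proof -
  interpret B: bimodule A B by fact
  show ?thesis unfolding tensor_rmod_def
    using slice_tensor_map_right[OF M B.left_mod B.left_mod B.bract_left_linear[OF a] f t] by simp
qed

lemma slice_left_linear:
  assumes B: "bimodule A B" and B': "bimodule A B'" and f: "f \<in> left_linear A B' (regular A)"
  shows "slice A (right_of B) B' f \<in> left_linear A (tensor_bimod A B B') B"
proof -
  interpret B: bimodule A B by fact
  interpret B': bimodule A B' by fact
  interpret X: tensor_product A "right_of B" B' by (intro tensor_productI B.right_mod B'.left_mod)
  interpret BB: left_module A "tensor_bimod A B B'" by (rule tensor_bimod_left_module[OF B B'])
  have fc: "f b \<in> carrier A" if "b \<in> carrier B'" for b using f that by (simp add: left_linear_iff)
  have "slice A (right_of B) B' f (lact (tensor_bimod A B B') a t) = lact B a (slice A (right_of B) B' f t)"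
    if "t \<in> carrier X.T" and a: "a \<in> carrier A" for t a
    using that(1)
  proof (induction rule: X.tensor_induct)
    case (pure m n)
    then show ?case using a
      by (simp add: tensor_bimod_lact[OF B B'] X.slice_pure[OF f] B.lact_closed fc B.lact_bract)
  next
    case (add s t)
    moreover have "lact (tensor_bimod A B B') a u \<in> carrier X.T" if "u \<in> carrier X.T" for u
      using BB.lact_closed[of u a] that a by simp
    ultimately show ?case using BB.lact_add_right[of s t a] a X.slice_closed[OF f]
      by (simp add: X.slice_mult[OF f] B.lact_add_right)
  qed
  then show ?thesis using X.slice_closed[OF f] X.slice_mult[OF f] by (simp add: left_linear_iff)
qed

lemma
  assumes M: "right_module A M" and B: "bimodule A B" and B': "bimodule A B'"
  shows associator_hom: "associator A M B B'
      \<in> hom (tensor A (tensor_rmod A M B) B') (tensor A M (tensor_bimod A B B'))"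
    and associator_pure: "\<lbrakk>m \<in> carrier M; b \<in> carrier B; b' \<in> carrier B'\<rbrakk> \<Longrightarrow>
      associator A M B B' (pure_tensor A (tensor_rmod A M B) B' (pure_tensor A M B m b) b')
      = pure_tensor A M (tensor_bimod A B B') m (pure_tensor A (right_of B) B' b b')"
proof -
  interpret B: bimodule A B by fact
  interpret B': bimodule A B' by fact
  interpret MB: tensor_product A M B by (intro tensor_productI M B.left_mod)
  interpret BB: tensor_product A "right_of B" B' by (intro tensor_productI B.right_mod B'.left_mod)
  interpret L: tensor_product A "tensor_rmod A M B" B'
    by (intro tensor_productI tensor_rmod_right_module M B B'.left_mod)
  interpret R: tensor_product A M "tensor_bimod A B B'"
    by (intro tensor_productI tensor_bimod_left_module M B B')
  define b0 where "b0 b' m b = R.ptensor m (BB.ptensor b b')" for b' m b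
  have pal: "BB.ptensor (b1 \<otimes>\<^bsub>B\<^esub> b2) b' = BB.ptensor b1 b' \<otimes>\<^bsub>BB.T\<^esub> BB.ptensor b2 b'"
    if "b1 \<in> carrier B" "b2 \<in> carrier B" "b' \<in> carrier B'" for b1 b2 b'
    using BB.pure_add_left[of b1 b2 b'] that by simp
  have par: "R.ptensor m (s \<otimes>\<^bsub>BB.T\<^esub> t) = R.ptensor m s \<otimes>\<^bsub>R.T\<^esub> R.ptensor m t"
    if "m \<in> carrier M" "s \<in> carrier BB.T" "t \<in> carrier BB.T" for m s t
    using R.pure_add_right[of m t s] that by simp
  have pc: "R.ptensor m t \<in> carrier R.T" if "m \<in> carrier M" "t \<in> carrier BB.T" for m t
    using R.pure_closed that by simp
  have bc: "BB.ptensor b b' \<in> carrier BB.T" if "b \<in> carrier B" "b' \<in> carrier B'" for b b'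
    using BB.pure_closed that by simp
  have rpl: "R.ptensor (m \<otimes>\<^bsub>M\<^esub> m') t = R.ptensor m t \<otimes>\<^bsub>R.T\<^esub> R.ptensor m' t"
    if "m \<in> carrier M" "m' \<in> carrier M" "t \<in> carrier BB.T" for m m' t
    using R.pure_add_left that by simp
  have b0: "balanced A M B R.T (b0 b')" if b': "b' \<in> carrier B'" for b'
  proof (intro balancedI)
    fix m a n assume "m \<in> carrier M" "a \<in> carrier A" "n \<in> carrier B"
    then show "b0 b' (ract M m a) n = b0 b' m (lact B a n)"
      using R.pure_balanced[of m a "BB.ptensor n b'"] b'
      by (simp add: b0_def bc tensor_bimod_lact[OF B B'])
  qed (use b' in \<open>simp_all add: b0_def pal par pc bc rpl\<close>)
  define g where "g t b' = tensor_lift A M B R.T (b0 b') t" for t b'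
  note ghom = MB.tensor_lift_hom[OF R.tensor_comm_group b0]
    and gpure = MB.tensor_lift_pure[OF R.tensor_comm_group b0, folded g_def]
  have gc: "g t b' \<in> carrier R.T" if "t \<in> carrier MB.T" "b' \<in> carrier B'" for t b'
    using ghom[OF that(2)] that(1) unfolding g_def hom_def by auto
  have gm: "g (s \<otimes>\<^bsub>MB.T\<^esub> t) b' = g s b' \<otimes>\<^bsub>R.T\<^esub> g t b'"
    if "s \<in> carrier MB.T" "t \<in> carrier MB.T" "b' \<in> carrier B'" for s t b'
    unfolding g_def by (rule hom_mult[OF ghom[OF that(3)] that(1,2)])
  have rc: "ract (tensor_rmod A M B) t a \<in> carrier MB.T" if "t \<in> carrier MB.T" "a \<in> carrier A" for t a
    using L.M.ract_closed[of t a] that by simp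
  have ra: "ract (tensor_rmod A M B) (s \<otimes>\<^bsub>MB.T\<^esub> t) a
      = ract (tensor_rmod A M B) s a \<otimes>\<^bsub>MB.T\<^esub> ract (tensor_rmod A M B) t a"
    if "s \<in> carrier MB.T" "t \<in> carrier MB.T" "a \<in> carrier A" for s t a
    using L.M.ract_add_left[of s t a] that by simp
  have gb: "balanced A (tensor_rmod A M B) B' R.T g"
  proof (intro balancedI, unfold tensor_rmod_simps)
    fix t b1 b2 assume "t \<in> carrier MB.T" and *: "b1 \<in> carrier B'" "b2 \<in> carrier B'"
    then show "g t (b1 \<otimes>\<^bsub>B'\<^esub> b2) = g t b1 \<otimes>\<^bsub>R.T\<^esub> g t b2"
    proof (induction rule: MB.tensor_induct)
      case (pure m b)
      then show ?case using * BB.pure_add_right[of b b2 b1] by (simp add: gpure b0_def par bc)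
    next
      case (add s t)
      then show ?case using * by (simp add: gm gc R.T.m_ac)
    qed
  next
    fix t a b' assume "t \<in> carrier MB.T" and *: "a \<in> carrier A" "b' \<in> carrier B'"
    then show "g (ract (tensor_rmod A M B) t a) b' = g t (lact B' a b')"
    proof (induction rule: MB.tensor_induct)
      case (pure m b)
      then show ?case using * BB.pure_balanced[of b a b']
        by (simp add: tensor_rmod_ract[OF M B] gpure b0_def B.bract_facts B'.lact_closed)
    next
      case (add s t)
      then show ?case using * by (simp add: gm gc ra rc B'.lact_closed)
    qed
  qed (simp_all add: gc gm)
  have a: "associator A M B B' = tensor_lift A (tensor_rmod A M B) B' R.T g"
    by (simp add: associator_def g_def[abs_def] b0_def[abs_def])
  show "associator A M B B' \<in> hom L.T R.T"
    unfolding a by (rule L.tensor_lift_hom[OF R.tensor_comm_group gb])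
  show "\<lbrakk>m \<in> carrier M; b \<in> carrier B; b' \<in> carrier B'\<rbrakk> \<Longrightarrow>
      associator A M B B' (L.ptensor (MB.ptensor m b) b') = R.ptensor m (BB.ptensor b b')"
    unfolding a by (simp add: L.tensor_lift_pure[OF R.tensor_comm_group gb] gpure b0_def)
qed

text \<open>
  On \<open>(m \<otimes> b) \<otimes> b'\<close> both sides are \<open>m g(b f(b'))\<close>. This identity is what turns coassociativity of a
  coaction into associativity of the action of the dual ring.
\<close>

lemma slice_associator:
  assumes M: "right_module A M" and B: "bimodule A B" and B': "bimodule A B'"
    and f: "f \<in> left_linear A B' (regular A)" and g: "g \<in> left_linear A B (regular A)"
    and t: "t \<in> carrier (tensor A (tensor_rmod A M B) B')"
  shows "slice A M (tensor_bimod A B B') (\<lambda>s. g (slice A (right_of B) B' f s)) (associator A M B B' t)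
    = slice A M B g (slice A (tensor_rmod A M B) B' f t)"
proof -
  interpret B: bimodule A B by fact
  interpret B': bimodule A B' by fact
  interpret MB: tensor_product A M B by (intro tensor_productI M B.left_mod)
  interpret BB: tensor_product A "right_of B" B' by (intro tensor_productI B.right_mod B'.left_mod)
  interpret L: tensor_product A "tensor_rmod A M B" B'
    by (intro tensor_productI tensor_rmod_right_module M B B'.left_mod)
  interpret R: tensor_product A M "tensor_bimod A B B'"
    by (intro tensor_productI tensor_bimod_left_module M B B')
  let ?phi = "\<lambda>s. g (slice A (right_of B) B' f s)"
  have phi: "?phi \<in> left_linear A (tensor_bimod A B B') (regular A)"
    by (rule left_linear_comp[OF slice_left_linear[OF B B' f] g])
  note ahom = associator_hom[OF M B B']
  have ac: "associator A M B B' s \<in> carrier R.T" if "s \<in> carrier L.T" for s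
    using ahom that by (auto simp: hom_def)
  have fc: "f b' \<in> carrier A" if "b' \<in> carrier B'" for b' using f that by (simp add: left_linear_iff)
  have rm: "ract (tensor_rmod A M B) (s \<otimes>\<^bsub>MB.T\<^esub> t) a
      = ract (tensor_rmod A M B) s a \<otimes>\<^bsub>MB.T\<^esub> ract (tensor_rmod A M B) t a"
    if "s \<in> carrier MB.T" "t \<in> carrier MB.T" "a \<in> carrier A" for s t a
    using L.M.ract_add_left[of s t a] that by simp
  have rc: "ract (tensor_rmod A M B) t a \<in> carrier MB.T" if "t \<in> carrier MB.T" "a \<in> carrier A" for t a
    using L.M.ract_closed[of t a] that by simp
  have lc: "L.ptensor s b' \<in> carrier L.T" if "s \<in> carrier MB.T" "b' \<in> carrier B'" for s b'
    using L.pure_closed that by simp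
  have lm: "L.ptensor (s \<otimes>\<^bsub>MB.T\<^esub> t) b' = L.ptensor s b' \<otimes>\<^bsub>L.T\<^esub> L.ptensor t b'"
    if "s \<in> carrier MB.T" "t \<in> carrier MB.T" "b' \<in> carrier B'" for s t b'
    using L.pure_add_left[of s t b'] that by simp
  \<comment> \<open>one tensor factor at a time: \<open>b'\<close> is fixed while the inner tensor \<open>s\<close> varies\<close>
  have on_pure: "slice A M (tensor_bimod A B B') ?phi (associator A M B B' (L.ptensor s b'))
      = slice A M B g (ract (tensor_rmod A M B) s (f b'))"
    if "s \<in> carrier MB.T" and b': "b' \<in> carrier B'" for s b'
    using that(1)
  proof (induction rule: MB.tensor_induct)
    case (pure m b)
    moreover have "BB.ptensor b b' \<in> carrier (tensor_bimod A B B')" using BB.pure_closed[of b b'] pure b' by simp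
    ultimately show ?case using b'
      by (simp add: associator_pure[OF M B B'] R.slice_pure[OF phi] BB.slice_pure[OF f]
          tensor_rmod_ract[OF M B] fc MB.slice_pure[OF g] B.bract_facts)
  next
    case (add s t)
    then show ?case using b'
      by (simp add: lm lc hom_mult[OF ahom] ac R.slice_mult[OF phi] rm rc fc MB.slice_mult[OF g])
  qed
  from t show ?thesis
  proof (induction rule: L.tensor_induct)
    case (pure s b')
    then show ?case using L.slice_pure[OF f, of s b'] by (simp add: on_pure)
  next
    case (add s t)
    then show ?case using L.slice_mult[OF f, of s t] L.slice_closed[OF f]
      by (simp add: hom_mult[OF ahom] ac R.slice_mult[OF phi] MB.slice_mult[OF g])
  qed
qed

text \<open>
  The form in which the preceding identity meets a coaction \<open>r\<close>: slicing the doubly coacted element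
  at once is slicing, coacting and slicing again.
\<close>

lemma slice_associator_tensor_map:
  assumes Q: "right_module A Q" and P: "right_module A P" and B: "bimodule A B" and B': "bimodule A B'"
    and f: "f \<in> left_linear A B' (regular A)" and g: "g \<in> left_linear A B (regular A)"
    and r: "r \<in> right_linear A P (tensor_rmod A Q B)" and t: "t \<in> carrier (tensor A P B')"
  shows "slice A Q (tensor_bimod A B B') (\<lambda>s. g (slice A (right_of B) B' f s))
      (associator A Q B B' (tensor_map A P B' (tensor_rmod A Q B) B' r (\<lambda>c. c) t))
    = slice A Q B g (r (slice A P B' f t))"
proof -
  have B'l: "left_module A B'" using B' by (rule bimodule.left_mod)
  have QB: "right_module A (tensor_rmod A Q B)" by (rule tensor_rmod_right_module[OF Q B])
  show ?thesis
    using slice_associator[OF Q B B' f g tensor_map_closed[OF tensor_productI[OF P B'l] tensor_productI[OF QB B'l]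
          r left_linear_id t]]
    by (simp add: slice_tensor_map_left[OF P QB B'l r f t])
qed


section \<open>Dual modules and dual bases\<close>

definition dual :: "('a, 'x) ring_scheme \<Rightarrow> ('a, 'm, 'y) lmod_scheme \<Rightarrow> ('m \<Rightarrow> 'a) monoid"
  where "dual A P =
    \<lparr>carrier = left_linear A P (regular A) \<inter> extensional (carrier P),
     monoid.mult = (\<lambda>f g. \<lambda>c\<in>carrier P. f c \<oplus>\<^bsub>A\<^esub> g c),
     one = (\<lambda>c\<in>carrier P. \<zero>\<^bsub>A\<^esub>)\<rparr>"

lemma dual_simps:
  "carrier (dual A P) = left_linear A P (regular A) \<inter> extensional (carrier P)"
  "f \<otimes>\<^bsub>dual A P\<^esub> g = (\<lambda>c\<in>carrier P. f c \<oplus>\<^bsub>A\<^esub> g c)"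
  "\<one>\<^bsub>dual A P\<^esub> = (\<lambda>c\<in>carrier P. \<zero>\<^bsub>A\<^esub>)"
  by (simp_all add: dual_def)

lemma dual_closed: "\<lbrakk>f \<in> carrier (dual A P); c \<in> carrier P\<rbrakk> \<Longrightarrow> f c \<in> carrier A"
  by (simp add: dual_simps left_linear_iff)

lemma dual_linear: "f \<in> carrier (dual A P) \<Longrightarrow> f \<in> left_linear A P (regular A)"
  by (simp add: dual_simps)

lemma dual_eqI:
  "\<lbrakk>f \<in> carrier (dual A P); g \<in> carrier (dual A P); \<And>c. c \<in> carrier P \<Longrightarrow> f c = g c\<rbrakk> \<Longrightarrow> f = g"
  by (rule extensionalityI[of _ "carrier P"]) (simp_all add: dual_simps)

context left_module
begin

lemma restrict_dual: "f \<in> left_linear A M (regular A) \<Longrightarrow> restrict f (carrier M) \<in> carrier (dual A M)"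
  by (simp add: dual_simps left_linear_iff lact_closed)

lemma dual_comm_group: "comm_group (dual A M)"
proof (rule comm_groupI)
  fix f g assume "f \<in> carrier (dual A M)" "g \<in> carrier (dual A M)"
  then show "f \<otimes>\<^bsub>dual A M\<^esub> g \<in> carrier (dual A M)"
    by (simp add: dual_simps left_linear_iff lact_closed r_distr a_ac)
next
  show "\<one>\<^bsub>dual A M\<^esub> \<in> carrier (dual A M)"
    by (simp add: dual_simps left_linear_iff lact_closed)
next
  fix f g h assume "f \<in> carrier (dual A M)" "g \<in> carrier (dual A M)" "h \<in> carrier (dual A M)"
  then show "f \<otimes>\<^bsub>dual A M\<^esub> g \<otimes>\<^bsub>dual A M\<^esub> h = f \<otimes>\<^bsub>dual A M\<^esub> (g \<otimes>\<^bsub>dual A M\<^esub> h)"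
    by (auto simp: dual_simps left_linear_iff a_assoc intro!: restrict_ext)
next
  fix f g assume "f \<in> carrier (dual A M)" "g \<in> carrier (dual A M)"
  then show "f \<otimes>\<^bsub>dual A M\<^esub> g = g \<otimes>\<^bsub>dual A M\<^esub> f"
    by (auto simp: dual_simps left_linear_iff a_comm intro!: restrict_ext)
next
  fix f assume f: "f \<in> carrier (dual A M)"
  then show "\<one>\<^bsub>dual A M\<^esub> \<otimes>\<^bsub>dual A M\<^esub> f = f"
    by (intro extensionalityI[of _ "carrier M"]) (auto simp: dual_simps left_linear_iff)
  have "(\<lambda>c\<in>carrier M. \<ominus> f c) \<in> carrier (dual A M)"
    using f by (simp add: dual_simps left_linear_iff lact_closed minus_add r_minus a_comm)
  moreover have "(\<lambda>c\<in>carrier M. \<ominus> f c) \<otimes>\<^bsub>dual A M\<^esub> f = \<one>\<^bsub>dual A M\<^esub>"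
    using f by (auto simp: dual_simps left_linear_iff l_neg intro!: restrict_ext)
  ultimately show "\<exists>g\<in>carrier (dual A M). g \<otimes>\<^bsub>dual A M\<^esub> f = \<one>\<^bsub>dual A M\<^esub>" by blast
qed

lemma lact_hom: "a \<in> carrier A \<Longrightarrow> lact M a \<in> hom M M"
  by (simp add: hom_def lact_closed lact_add_right)

end

text \<open>
  The basis elements index themselves: \<open>f s\<close> is the coordinate functional of \<open>s \<in> S\<close>.
\<close>

definition dual_basis ::
  "('a, 'x) ring_scheme \<Rightarrow> ('a, 'm, 'y) lmod_scheme \<Rightarrow> 'm set \<Rightarrow> ('m \<Rightarrow> 'm \<Rightarrow> 'a) \<Rightarrow> bool"
  where "dual_basis A P S f \<longleftrightarrow> finite S \<and> S \<subseteq> carrier P \<and> f \<in> S \<rightarrow> carrier (dual A P) \<and>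
    (\<forall>p\<in>carrier P. p = finprod P (\<lambda>s. lact P (f s p) s) S)"

text \<open>
  With generators \<open>S\<close>, the evaluation map from the free module \<open>A\<^bsup>S\<^esup>\<close> to \<open>P\<close> is onto. By projectivity
  it has a section, whose coordinates are the functionals of the dual basis.
\<close>

lemma fg_projective_dual_basis:
  fixes A :: "('a, 'x) ring_scheme" and P :: "('a, 'm, 'y) lmod_scheme"
  assumes "finitely_generated A P" and proj: "projective A P"
  obtains S f where "dual_basis A P S f"
proof -
  interpret P: left_module A P using proj by (simp add: projective_def)
  obtain S where S: "finite S" "S \<subseteq> carrier P"
      and gen: "\<And>p. p \<in> carrier P \<Longrightarrow> \<exists>a \<in> S \<rightarrow> carrier A. p = finprod P (\<lambda>s. lact P (a s) s) S"
    using assms(1) unfolding finitely_generated_def by blast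
  \<comment> \<open>the lifting property has test modules of this type: functions on \<open>S\<close> serve as \<open>A\<^bsup>S\<^esup>\<close>\<close>
  define U :: "('a, 'm \<Rightarrow> 'a) lmod" where "U =
    \<lparr>carrier = S \<rightarrow>\<^sub>E carrier A, monoid.mult = (\<lambda>u v. \<lambda>s\<in>S. u s \<oplus>\<^bsub>A\<^esub> v s), one = (\<lambda>s\<in>S. \<zero>\<^bsub>A\<^esub>),
     lact = (\<lambda>a u. \<lambda>s\<in>S. a \<otimes>\<^bsub>A\<^esub> u s)\<rparr>"
  define V :: "('a, 'm) lmod" where "V =
    \<lparr>carrier = carrier P, monoid.mult = monoid.mult P, one = one P, lact = lact P\<rparr>"
  have U_simps: "carrier U = S \<rightarrow>\<^sub>E carrier A" "u \<otimes>\<^bsub>U\<^esub> v = (\<lambda>s\<in>S. u s \<oplus>\<^bsub>A\<^esub> v s)" "\<one>\<^bsub>U\<^esub> = (\<lambda>s\<in>S. \<zero>\<^bsub>A\<^esub>)"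
    "lact U a u = (\<lambda>s\<in>S. a \<otimes>\<^bsub>A\<^esub> u s)" for u v a by (simp_all add: U_def)
  have V_simps: "carrier V = carrier P" "x \<otimes>\<^bsub>V\<^esub> y = x \<otimes>\<^bsub>P\<^esub> y" "\<one>\<^bsub>V\<^esub> = \<one>\<^bsub>P\<^esub>" "lact V = lact P" for x y
    by (simp_all add: V_def)
  have "comm_group U"
  proof (rule comm_groupI)
    fix u assume u: "u \<in> carrier U"
    have "(\<lambda>s\<in>S. \<ominus>\<^bsub>A\<^esub> u s) \<in> carrier U" "(\<lambda>s\<in>S. \<ominus>\<^bsub>A\<^esub> u s) \<otimes>\<^bsub>U\<^esub> u = \<one>\<^bsub>U\<^esub>"
      using u by (auto simp: U_simps PiE_iff P.l_neg intro!: restrict_ext)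
    then show "\<exists>v\<in>carrier U. v \<otimes>\<^bsub>U\<^esub> u = \<one>\<^bsub>U\<^esub>" by blast
    show "\<one>\<^bsub>U\<^esub> \<otimes>\<^bsub>U\<^esub> u = u" using u
      by (intro extensionalityI[of _ S]) (auto simp: U_simps PiE_iff)
  qed (auto simp: U_simps PiE_iff P.a_ac intro!: restrict_ext)
  then have "left_module A U"
    by (intro left_module.intro left_module_axioms.intro P.ring_axioms)
      (auto simp: U_simps PiE_iff P.l_distr P.r_distr P.m_assoc extensional_restrict intro!: restrict_ext ext,
       auto simp: extensional_def)
  moreover have "left_module A V"
    by (intro left_module.intro left_module_axioms.intro P.ring_axioms
        comm_group_transfer[OF P.M.comm_group_axioms])
      (simp_all add: V_simps P.lact_closed P.lact_add_left P.lact_add_right P.lact_mult P.lact_one)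
  moreover
  let ?q = "\<lambda>u. finprod P (\<lambda>s. lact P (u s) s) S"
  have sc: "s \<in> S \<Longrightarrow> s \<in> carrier P" for s using S by blast
  have cl: "(\<lambda>s. lact P (u s) s) \<in> S \<rightarrow> carrier P" if "u \<in> S \<rightarrow> carrier A" for u
    using that S by (auto intro!: P.lact_closed)
  have "?q \<in> left_linear A U V"
    unfolding left_linear_iff
  proof (intro conjI ballI)
    fix u assume u: "u \<in> carrier U"
    then have uS: "u \<in> S \<rightarrow> carrier A" by (auto simp: U_simps)
    show "?q u \<in> carrier V" using cl[OF uS] by (simp add: V_simps)
    fix v assume v: "v \<in> carrier U"
    then have vS: "v \<in> S \<rightarrow> carrier A" by (auto simp: U_simps)
    have "?q (u \<otimes>\<^bsub>U\<^esub> v) = finprod P (\<lambda>s. lact P (u s) s \<otimes>\<^bsub>P\<^esub> lact P (v s) s) S"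
      using uS vS sc
      by (intro P.M.finprod_cong') (auto simp: U_simps P.lact_add_left Pi_iff intro!: P.M.m_closed P.lact_closed)
    then show "?q (u \<otimes>\<^bsub>U\<^esub> v) = ?q u \<otimes>\<^bsub>V\<^esub> ?q v"
      by (simp add: P.M.finprod_multf[OF cl[OF uS] cl[OF vS]] V_simps)
  next
    fix u a assume u: "u \<in> carrier U" and a: "a \<in> carrier A"
    then have uS: "u \<in> S \<rightarrow> carrier A" by (auto simp: U_simps)
    have "?q (lact U a u) = finprod P (\<lambda>s. lact P a (lact P (u s) s)) S"
      using uS sc a
      by (intro P.M.finprod_cong') (auto simp: U_simps P.lact_mult Pi_iff intro!: P.lact_closed)
    then show "?q (lact U a u) = lact V a (?q u)"
      by (simp add: hom_finprod[OF P.lact_hom[OF a] P.M.comm_group_axioms P.M.comm_group_axioms cl[OF uS]] V_simps)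
  qed
  moreover have "(\<lambda>p. p) \<in> left_linear A P V" by (simp add: left_linear_iff V_simps)
  moreover have "?q ` carrier U = carrier V"
  proof (intro equalityI subsetI)
    fix p assume "p \<in> carrier V"
    then obtain a where a: "a \<in> S \<rightarrow> carrier A" "p = ?q a" using gen V_simps by metis
    have "?q (restrict a S) = ?q a" using cl[OF a(1)] by (intro P.M.finprod_cong') auto
    then show "p \<in> ?q ` carrier U" using a by (auto simp: U_simps intro!: image_eqI[of _ _ "restrict a S"])
  qed (auto simp: U_simps V_simps intro!: P.M.finprod_closed cl)
  ultimately have "\<exists>h\<in>left_linear A P U. \<forall>p\<in>carrier P. ?q (h p) = p"
    using proj[unfolded projective_def, THEN conjunct2, rule_format, of U V ?q "\<lambda>p. p"] by simp
  then obtain h where h: "h \<in> left_linear A P U" and qh: "\<And>p. p \<in> carrier P \<Longrightarrow> ?q (h p) = p"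
    by blast
  let ?f = "\<lambda>s. \<lambda>p\<in>carrier P. h p s"
  have f: "?f s \<in> carrier (dual A P)" if "s \<in> S" for s
    using h that
    by (intro P.restrict_dual) (simp add: left_linear_iff U_simps PiE_iff)
  have "finprod P (\<lambda>s. lact P (?f s p) s) S = p" if "p \<in> carrier P" for p
    using qh[OF that] that by simp
  then have "dual_basis A P S ?f"
    using f S by (auto simp: dual_basis_def)
  then show thesis by (rule that)
qed

context tensor_product
begin

lemma pure_hom: "m \<in> carrier M \<Longrightarrow> ptensor m \<in> hom N T"
  by (simp add: hom_def pure_add_right)

text \<open>
  For \<open>t = m \<otimes> n\<close> this is the expansion of \<open>n\<close> in the dual basis, with the coefficients moved across
  the tensor sign.
\<close>

lemma tensor_dual_basis:
  assumes "dual_basis A N S f" and "t \<in> carrier T"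
  shows "t = finprod T (\<lambda>s. ptensor (slice A M N (f s) t) s) S"
proof -
  have S: "finite S" "\<And>s. s \<in> S \<Longrightarrow> s \<in> carrier N"
      and f: "\<And>s. s \<in> S \<Longrightarrow> f s \<in> carrier (dual A N)"
      and rep: "\<And>n. n \<in> carrier N \<Longrightarrow> finprod N (\<lambda>s. lact N (f s n) s) S = n"
    using assms(1) by (auto simp: dual_basis_def)
  note fl = dual_linear[OF f]
  have c: "(\<lambda>s. ptensor (slice A M N (f s) u) s) \<in> S \<rightarrow> carrier T" if "u \<in> carrier T" for u
    using S fl that by (auto simp: slice_closed)
  from assms(2) show ?thesis
  proof (induction rule: tensor_induct)
    case (pure m n)
    have fn: "f s n \<in> carrier A" if "s \<in> S" for s using dual_closed[OF f] that pure by blast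
    have "ptensor m n = ptensor m (finprod N (\<lambda>s. lact N (f s n) s) S)" using rep pure by simp
    also have "\<dots> = finprod T (\<lambda>s. ptensor m (lact N (f s n) s)) S"
      using fn S pure
      by (intro hom_finprod[OF pure_hom N.M.comm_group_axioms tensor_comm_group]) (auto intro!: N.lact_closed)
    also have "\<dots> = finprod T (\<lambda>s. ptensor (slice A M N (f s) (ptensor m n)) s) S"
      using fn S pure fl
      by (intro T.finprod_cong') (auto simp: slice_pure pure_balanced M.ract_closed N.lact_closed)
    finally show ?case .
  next
    case (add s t)
    have "finprod T (\<lambda>x. ptensor (slice A M N (f x) (s \<otimes>\<^bsub>T\<^esub> t)) x) S
        = finprod T (\<lambda>x. ptensor (slice A M N (f x) s) x \<otimes>\<^bsub>T\<^esub> ptensor (slice A M N (f x) t) x) S"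
      using S fl add c
      by (intro T.finprod_cong') (auto simp: slice_mult slice_closed pure_add_left)
    also have "\<dots> = s \<otimes>\<^bsub>T\<^esub> t"
      using add c by (simp add: T.finprod_multf)
    finally show ?case ..
  qed
qed

lemma slices_separate:
  assumes B: "dual_basis A N S f" and "s \<in> carrier T" "t \<in> carrier T"
    and eq: "\<And>g. g \<in> carrier (dual A N) \<Longrightarrow> slice A M N g s = slice A M N g t"
  shows "s = t"
proof -
  have f: "\<And>x. x \<in> S \<Longrightarrow> x \<in> carrier N" "\<And>x. x \<in> S \<Longrightarrow> f x \<in> carrier (dual A N)"
    using B by (auto simp: dual_basis_def)
  have "finprod T (\<lambda>x. ptensor (slice A M N (f x) s) x) S = finprod T (\<lambda>x. ptensor (slice A M N (f x) t) x) S"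
    using f assms(2,3) by (intro T.finprod_cong') (auto simp: eq slice_closed dual_linear)
  then show ?thesis using tensor_dual_basis[OF B assms(2)] tensor_dual_basis[OF B assms(3)] by simp
qed

text \<open>
  The witness is the sum of the \<open>F(f\<^sub>s) \<otimes> s\<close>. Its slice by \<open>g\<close> is the sum of the
  \<open>F(f\<^sub>s) g(s) = F(f\<^sub>s g(s))\<close>, and the functionals \<open>f\<^sub>s g(s)\<close> add up to \<open>g\<close>.
\<close>

lemma functional_is_slice:
  assumes B: "dual_basis A N S f"
    and F: "F \<in> hom (dual A N) M"
    and F_scale: "\<And>g a. \<lbrakk>g \<in> carrier (dual A N); a \<in> carrier A\<rbrakk>
      \<Longrightarrow> F (\<lambda>n\<in>carrier N. g n \<otimes> a) = ract M (F g) a"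
  shows "\<exists>!t. t \<in> carrier T \<and> (\<forall>g\<in>carrier (dual A N). slice A M N g t = F g)"
proof (rule ex_ex1I)
  interpret D: comm_group "dual A N" by (rule N.dual_comm_group)
  have S: "finite S" "\<And>s. s \<in> S \<Longrightarrow> s \<in> carrier N"
      and f: "\<And>s. s \<in> S \<Longrightarrow> f s \<in> carrier (dual A N)"
      and rep: "\<And>n. n \<in> carrier N \<Longrightarrow> finprod N (\<lambda>s. lact N (f s n) s) S = n"
    using B by (auto simp: dual_basis_def)
  have Fc: "F g \<in> carrier M" if "g \<in> carrier (dual A N)" for g using F that by (auto simp: hom_def)
  let ?t = "finprod T (\<lambda>s. ptensor (F (f s)) s) S"
  have tc: "(\<lambda>s. ptensor (F (f s)) s) \<in> S \<rightarrow> carrier T" using S f Fc by auto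
  have "slice A M N g ?t = F g" if g: "g \<in> carrier (dual A N)" for g
  proof -
    have gl: "g \<in> left_linear A N (regular A)" by (rule dual_linear[OF g])
    have ga: "g s \<in> carrier A" if "s \<in> S" for s using dual_closed[OF g] S that by blast
    let ?k = "\<lambda>s. \<lambda>n\<in>carrier N. f s n \<otimes> g s"
    have k: "?k s \<in> carrier (dual A N)" if "s \<in> S" for s
    proof (rule N.restrict_dual)
      show "(\<lambda>n. f s n \<otimes> g s) \<in> left_linear A N (regular A)"
        using f[OF that] ga[OF that] by (simp add: dual_simps left_linear_iff M.l_distr M.m_assoc)
    qed
    have "slice A M N g ?t = finprod M (\<lambda>s. slice A M N g (ptensor (F (f s)) s)) S"
      by (rule hom_finprod[OF slice_hom[OF gl] tensor_comm_group M.M.comm_group_axioms tc])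
    also have "\<dots> = finprod M (\<lambda>s. F (?k s)) S"
      using S f Fc ga by (intro M.M.finprod_cong') (auto simp: slice_pure[OF gl] F_scale M.ract_closed k)
    also have "\<dots> = F (finprod (dual A N) ?k S)"
      using k by (intro hom_finprod[OF F N.dual_comm_group M.M.comm_group_axioms, symmetric]) auto
    also have "finprod (dual A N) ?k S = g"
    proof (rule dual_eqI[of _ A N])
      show "finprod (dual A N) ?k S \<in> carrier (dual A N)" using k by auto
      fix n assume n: "n \<in> carrier N"
      have ev: "(\<lambda>h. h n) \<in> hom (dual A N) (regular A)"
        using n by (auto simp: hom_def dual_simps left_linear_iff)
      have reg: "comm_group (regular A)" using regular_bimodule[OF M.ring_axioms]
        by (simp add: bimodule_def left_module_def)
      have gh: "g \<in> hom N (regular A)" using gl by (auto simp: hom_def left_linear_iff)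
      have "finprod (dual A N) ?k S n = finprod (regular A) (\<lambda>s. ?k s n) S"
        using k by (intro hom_finprod[OF ev N.dual_comm_group reg]) auto
      also have "\<dots> = finprod (regular A) (\<lambda>s. g (lact N (f s n) s)) S"
        using n gl S dual_closed[OF f n] ga
        by (intro comm_monoid.finprod_cong'[OF comm_group.axioms(1)[OF reg]]) (auto simp: left_linear_iff)
      also have "\<dots> = g (finprod N (\<lambda>s. lact N (f s n) s) S)"
        using n S dual_closed[OF f n]
        by (intro hom_finprod[OF gh N.M.comm_group_axioms reg, symmetric]) (auto intro!: N.lact_closed)
      finally show "finprod (dual A N) ?k S n = g n" using rep n by simp
    qed (rule g)
    finally show ?thesis .
  qed
  then show "\<exists>t. t \<in> carrier T \<and> (\<forall>g\<in>carrier (dual A N). slice A M N g t = F g)"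
    using tc by (intro exI[of _ ?t]) auto
next
  fix s t
  assume "s \<in> carrier T \<and> (\<forall>g\<in>carrier (dual A N). slice A M N g s = F g)"
    "t \<in> carrier T \<and> (\<forall>g\<in>carrier (dual A N). slice A M N g t = F g)"
  then show "s = t" by (intro slices_separate[OF B]) auto
qed

end

text \<open>
  The functionals \<open>g \<circ> slice h\<close> need not exhaust the dual of \<open>B \<otimes> B'\<close>, but they suffice. For a fixed
  \<open>h\<close>, the element of \<open>M \<otimes> B\<close> that is left after slicing \<open>B'\<close> by \<open>h\<close> is determined by its slices
  by all \<open>g\<close>, and the dual basis of \<open>B'\<close> recovers the original element from these.
\<close>

lemma iterated_slices_separate:
  assumes M: "right_module A M" and B: "bimodule A B" and B': "bimodule A B'"
    and b: "dual_basis A B S f" and b': "dual_basis A B' S' f'"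
    and s: "s \<in> carrier (tensor A M (tensor_bimod A B B'))"
    and t: "t \<in> carrier (tensor A M (tensor_bimod A B B'))"
    and eq: "\<And>g h. \<lbrakk>g \<in> carrier (dual A B); h \<in> carrier (dual A B')\<rbrakk> \<Longrightarrow>
      slice A M (tensor_bimod A B B') (\<lambda>x. g (slice A (right_of B) B' h x)) s
      = slice A M (tensor_bimod A B B') (\<lambda>x. g (slice A (right_of B) B' h x)) t"
  shows "s = t"
proof -
  interpret B: bimodule A B by fact
  interpret B': bimodule A B' by fact
  interpret MB: tensor_product A M B by (intro tensor_productI M B.left_mod)
  interpret BB: tensor_product A "right_of B" B' by (intro tensor_productI B.right_mod B'.left_mod)
  interpret R: tensor_product A M "tensor_bimod A B B'"
    by (intro tensor_productI tensor_bimod_left_module M B B')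
  note ax = R.tensor_product_axioms MB.tensor_product_axioms
  \<comment> \<open>\<open>p h\<close> slices away the factor \<open>B'\<close>, and \<open>q b'\<close> puts \<open>b'\<close> back into it\<close>
  define p where "p h = tensor_map A M (tensor_bimod A B B') M B (\<lambda>m. m) (slice A (right_of B) B' h)" for h
  define q where "q b' = tensor_map A M B M (tensor_bimod A B B') (\<lambda>m. m) (\<lambda>b. BB.ptensor b b')" for b'
  have S': "\<And>x. x \<in> S' \<Longrightarrow> x \<in> carrier B'" "\<And>x. x \<in> S' \<Longrightarrow> f' x \<in> carrier (dual A B')"
    using b' by (auto simp: dual_basis_def)
  have sl: "slice A (right_of B) B' h \<in> left_linear A (tensor_bimod A B B') B"
    if "h \<in> carrier (dual A B')" for h by (rule slice_left_linear[OF B B' dual_linear[OF that]])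
  have pl: "(\<lambda>b. BB.ptensor b b') \<in> left_linear A B (tensor_bimod A B B')" if "b' \<in> carrier B'" for b'
    using that BB.pure_add_left[of _ _ b'] BB.pure_closed[of _ b']
    by (simp add: left_linear_iff tensor_bimod_lact[OF B B'])
  note p = tensor_map_pure[OF ax right_linear_id sl, folded p_def]
    and pc = tensor_map_closed[OF ax right_linear_id sl, folded p_def]
    and pm = tensor_map_mult[OF ax right_linear_id sl, folded p_def]
    and q = tensor_map_pure[OF ax(2,1) right_linear_id pl, folded q_def]
    and qc = tensor_map_closed[OF ax(2,1) right_linear_id pl, folded q_def]
    and qm = tensor_map_mult[OF ax(2,1) right_linear_id pl, folded q_def]
  have rep: "u = finprod R.T (\<lambda>x. q x (p (f' x) u)) S'" if "u \<in> carrier R.T" for u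
    using that
  proof (induction rule: R.tensor_induct)
    case (pure m x)
    then have x: "x \<in> carrier BB.T" by simp
    have c: "slice A (right_of B) B' (f' y) x \<in> carrier B" if "y \<in> S'" for y
      using BB.slice_closed[OF dual_linear[OF S'(2)[OF that]] x] by simp
    have BBc: "BB.ptensor b b' \<in> carrier BB.T" if "b \<in> carrier B" "b' \<in> carrier B'" for b b'
      using BB.pure_closed that by simp
    have h: "R.ptensor m \<in> hom BB.T R.T" using R.pure_hom[OF pure(1)] by (simp add: hom_def)
    have "R.ptensor m x = R.ptensor m (finprod BB.T (\<lambda>y. BB.ptensor (slice A (right_of B) B' (f' y) x) y) S')"
      using BB.tensor_dual_basis[OF b' x] by simp
    also have "\<dots> = finprod R.T (\<lambda>y. R.ptensor m (BB.ptensor (slice A (right_of B) B' (f' y) x) y)) S'"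
      using S' c by (intro hom_finprod[OF h BB.tensor_comm_group R.tensor_comm_group]) (auto simp: BBc)
    also have "\<dots> = finprod R.T (\<lambda>y. q y (p (f' y) (R.ptensor m x))) S'"
      using S' c pure x
      by (intro R.T.finprod_cong') (auto simp: p q BBc intro!: qc)
    finally show ?case .
  next
    case (add u v)
    have "finprod R.T (\<lambda>x. q x (p (f' x) (u \<otimes>\<^bsub>R.T\<^esub> v))) S'
        = finprod R.T (\<lambda>x. q x (p (f' x) u) \<otimes>\<^bsub>R.T\<^esub> q x (p (f' x) v)) S'"
      using S' add(1,2) by (intro R.T.finprod_cong') (auto simp: pm qm pc intro!: qc pc)
    also have "\<dots> = finprod R.T (\<lambda>x. q x (p (f' x) u)) S' \<otimes>\<^bsub>R.T\<^esub> finprod R.T (\<lambda>x. q x (p (f' x) v)) S'"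
      using S' add(1,2) by (intro R.T.finprod_multf) (auto intro!: qc pc)
    finally show ?case using add(3,4) by simp
  qed
  have peq: "p h s = p h t" if h: "h \<in> carrier (dual A B')" for h
  proof (rule MB.slices_separate[OF b pc[OF h s] pc[OF h t]])
    fix g assume g: "g \<in> carrier (dual A B)"
    show "slice A M B g (p h s) = slice A M B g (p h t)"
      unfolding p_def
      using slice_tensor_map_right[OF M R.N.left_module_axioms B.left_mod sl[OF h] dual_linear[OF g]] s t eq[OF g h]
      by simp
  qed
  have "finprod R.T (\<lambda>x. q x (p (f' x) s)) S' = finprod R.T (\<lambda>x. q x (p (f' x) t)) S'"
    using S' t peq by (intro R.T.finprod_cong') (auto intro!: qc pc)
  then show ?thesis using rep[OF s] rep[OF t] by simp
qed


section \<open>Graded multiplications on direct sums\<close>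

definition single ::
  "('g, 'y) monoid_scheme \<Rightarrow> ('g \<Rightarrow> ('d, 'z) monoid_scheme) \<Rightarrow> 'g \<Rightarrow> 'd \<Rightarrow> ('g \<Rightarrow> 'd)"
  where "single G D i d = (\<lambda>k\<in>carrier G. if k = i then d else \<one>\<^bsub>D k\<^esub>)"

lemma sum_group_cong:
  assumes "\<And>i. i \<in> I \<Longrightarrow> carrier (D i) = carrier (D' i)"
    and "\<And>i x y. i \<in> I \<Longrightarrow> x \<otimes>\<^bsub>D i\<^esub> y = x \<otimes>\<^bsub>D' i\<^esub> y"
    and "\<And>i. i \<in> I \<Longrightarrow> \<one>\<^bsub>D i\<^esub> = \<one>\<^bsub>D' i\<^esub>"
  shows "sum_group I D = sum_group I D'"
proof -
  have "(\<Pi>\<^sub>E i\<in>I. carrier (D i)) = (\<Pi>\<^sub>E i\<in>I. carrier (D' i))" by (rule PiE_cong) (rule assms(1))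
  moreover have "(\<lambda>x y. \<lambda>i\<in>I. x i \<otimes>\<^bsub>D i\<^esub> y i) = (\<lambda>x y. \<lambda>i\<in>I. x i \<otimes>\<^bsub>D' i\<^esub> y i)"
    using assms(2) by (intro ext) (simp add: restrict_def)
  moreover have "(\<lambda>i\<in>I. \<one>\<^bsub>D i\<^esub>) = (\<lambda>i\<in>I. \<one>\<^bsub>D' i\<^esub>)" by (rule restrict_ext) (rule assms(3))
  moreover have "finite {i \<in> I. x i \<noteq> \<one>\<^bsub>D i\<^esub>} \<longleftrightarrow> finite {i \<in> I. x i \<noteq> \<one>\<^bsub>D' i\<^esub>}" for x
    by (rule arg_cong[of _ _ finite]) (use assms(3) in auto)
  ultimately show ?thesis by (simp add: sum_group_def product_group_def)
qed

locale graded_group = G: group G for G :: "('g, 'y) monoid_scheme" (structure) +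
  fixes D :: "'g \<Rightarrow> ('d, 'z) monoid_scheme"
  assumes comm_group_comp: "i \<in> carrier G \<Longrightarrow> comm_group (D i)"
begin

abbreviation "dirsum \<equiv> sum_group (carrier G) D"

lemma group_comp: "i \<in> carrier G \<Longrightarrow> group (D i)"
  using comm_group_comp comm_group.axioms(2) by blast

lemma monoid_comp: "i \<in> carrier G \<Longrightarrow> monoid (D i)"
  using group_comp group.axioms(1) by blast

lemma carrier_dirsum: "carrier dirsum = {x \<in> \<Pi>\<^sub>E i\<in>carrier G. carrier (D i). finite {i \<in> carrier G. x i \<noteq> \<one>\<^bsub>D i\<^esub>}}"
  by (rule carrier_sum_group) (rule group_comp)

lemma dirsum_comp: "\<lbrakk>x \<in> carrier dirsum; i \<in> carrier G\<rbrakk> \<Longrightarrow> x i \<in> carrier (D i)"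
  by (auto simp: carrier_dirsum)

lemma dirsum_eqI: "\<lbrakk>x \<in> carrier dirsum; y \<in> carrier dirsum; \<And>i. i \<in> carrier G \<Longrightarrow> x i = y i\<rbrakk> \<Longrightarrow> x = y"
  by (rule extensionalityI[of _ "carrier G"]) (auto simp: carrier_dirsum PiE_iff)

lemma dirsum_comm_group: "comm_group dirsum"
proof (rule group.group_comm_groupI)
  show "group dirsum" using group_comp by simp
  fix x y assume "x \<in> carrier dirsum" "y \<in> carrier dirsum"
  then show "x \<otimes>\<^bsub>dirsum\<^esub> y = y \<otimes>\<^bsub>dirsum\<^esub> x"
    using comm_monoid.m_comm[OF comm_group.axioms(1)[OF comm_group_comp]] dirsum_comp
    by (auto intro!: restrict_ext)
qed

sublocale dirsum: comm_group dirsum by (rule dirsum_comm_group)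

lemma single_apply [simp]:
  "k \<in> carrier G \<Longrightarrow> single G D i d k = (if k = i then d else \<one>\<^bsub>D k\<^esub>)"
  by (simp add: single_def)

lemma single_closed [simp]:
  assumes "i \<in> carrier G" "d \<in> carrier (D i)"
  shows "single G D i d \<in> carrier dirsum"
proof -
  have "{k \<in> carrier G. single G D i d k \<noteq> \<one>\<^bsub>D k\<^esub>} \<subseteq> {i}" by (auto split: if_splits)
  then show ?thesis using assms monoid.one_closed[OF monoid_comp]
    by (auto simp: carrier_dirsum single_def PiE_iff intro: finite_subset)
qed

lemma single_mult:
  assumes "i \<in> carrier G" "d \<in> carrier (D i)" "d' \<in> carrier (D i)"
  shows "single G D i (d \<otimes>\<^bsub>D i\<^esub> d') = single G D i d \<otimes>\<^bsub>dirsum\<^esub> single G D i d'"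
  using assms monoid.l_one[OF monoid_comp monoid.one_closed[OF monoid_comp]]
  by (auto simp: single_def intro!: restrict_ext)

lemma single_one: "i \<in> carrier G \<Longrightarrow> single G D i \<one>\<^bsub>D i\<^esub> = \<one>\<^bsub>dirsum\<^esub>"
  by (auto simp: single_def intro!: restrict_ext)

lemma homogeneous_iff:
  assumes "i \<in> carrier G"
  shows "x \<in> homogeneous G D i \<longleftrightarrow> (\<exists>d\<in>carrier (D i). x = single G D i d)"
proof
  assume x: "x \<in> homogeneous G D i"
  then have "x = single G D i (x i)"
    using assms by (intro dirsum_eqI) (auto simp: homogeneous_def dirsum_comp)
  then show "\<exists>d\<in>carrier (D i). x = single G D i d"
    using x assms by (auto simp: homogeneous_def intro: dirsum_comp)
next
  assume "\<exists>d\<in>carrier (D i). x = single G D i d"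
  then show "x \<in> homogeneous G D i" using assms by (auto simp: homogeneous_def)
qed

lemma homogeneous_single [simp]:
  "\<lbrakk>i \<in> carrier G; d \<in> carrier (D i)\<rbrakk> \<Longrightarrow> single G D i d \<in> homogeneous G D i"
  by (auto simp: homogeneous_iff)

text \<open>
  Zero is covered by the first case, being an element of any single degree.
\<close>

lemma dirsum_induct [consumes 1, case_names single add]:
  assumes "x \<in> carrier dirsum"
    and single: "\<And>i d. \<lbrakk>i \<in> carrier G; d \<in> carrier (D i)\<rbrakk> \<Longrightarrow> P (single G D i d)"
    and add: "\<And>x y. \<lbrakk>x \<in> carrier dirsum; y \<in> carrier dirsum; P x; P y\<rbrakk> \<Longrightarrow> P (x \<otimes>\<^bsub>dirsum\<^esub> y)"
  shows "P x"
proof -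
  have "finite F \<Longrightarrow> \<forall>x\<in>carrier dirsum. {i \<in> carrier G. x i \<noteq> \<one>\<^bsub>D i\<^esub>} \<subseteq> F \<longrightarrow> P x" for F
  proof (induction F rule: finite_induct)
    case empty
    have "P \<one>\<^bsub>dirsum\<^esub>"
      using single[OF G.one_closed monoid.one_closed[OF monoid_comp[OF G.one_closed]]]
      by (simp add: single_one)
    moreover have "x = \<one>\<^bsub>dirsum\<^esub>"
      if "x \<in> carrier dirsum" "{i \<in> carrier G. x i \<noteq> \<one>\<^bsub>D i\<^esub>} \<subseteq> {}" for x
      using that dirsum.one_closed by (intro dirsum_eqI) auto
    ultimately show ?case by blast
  next
    case (insert i F)
    show ?case
    proof (intro ballI impI)
      fix x assume x: "x \<in> carrier dirsum" and sup: "{k \<in> carrier G. x k \<noteq> \<one>\<^bsub>D k\<^esub>} \<subseteq> insert i F"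
      show "P x"
      proof (cases "i \<in> carrier G")
        case False
        then have "{k \<in> carrier G. x k \<noteq> \<one>\<^bsub>D k\<^esub>} \<subseteq> F" using sup by blast
        then show ?thesis using insert.IH x by blast
      next
        case True
        let ?y = "\<lambda>k\<in>carrier G. if k = i then \<one>\<^bsub>D k\<^esub> else x k"
        have sub: "{k \<in> carrier G. ?y k \<noteq> \<one>\<^bsub>D k\<^esub>} \<subseteq> F"
          using sup by auto
        have y: "?y \<in> carrier dirsum"
          using x finite_subset[OF sub insert.hyps(1)] monoid.one_closed[OF monoid_comp]
          by (auto simp: carrier_dirsum PiE_iff)
        have "x = single G D i (x i) \<otimes>\<^bsub>dirsum\<^esub> ?y"
        proof (rule dirsum_eqI[OF x])
          show "single G D i (x i) \<otimes>\<^bsub>dirsum\<^esub> ?y \<in> carrier dirsum"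
            using y x True by (intro dirsum.m_closed single_closed dirsum_comp)
          fix k assume "k \<in> carrier G"
          then show "x k = (single G D i (x i) \<otimes>\<^bsub>dirsum\<^esub> ?y) k"
            using dirsum_comp[OF x, of k] monoid.l_one[OF monoid_comp[of k]] monoid.r_one[OF monoid_comp[of k]]
            by (cases "k = i") simp_all
        qed
        moreover have "P ?y" using insert.IH y sub by blast
        moreover have "P (single G D i (x i))" using single True x by (simp add: dirsum_comp)
        ultimately show ?thesis
          using add[of "single G D i (x i)" ?y] y x True by (simp add: dirsum_comp)
      qed
    qed
  qed
  then show ?thesis using assms(1) by (auto simp: carrier_dirsum)
qed

lemma dirsum_hom_eqI:
  assumes "h \<in> hom dirsum Q" "k \<in> hom dirsum Q" "x \<in> carrier dirsum"
    and "\<And>i d. \<lbrakk>i \<in> carrier G; d \<in> carrier (D i)\<rbrakk> \<Longrightarrow> h (single G D i d) = k (single G D i d)"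
  shows "h x = k x"
  using assms(3) by (induction rule: dirsum_induct) (simp_all only: assms(4) hom_mult[OF assms(1)] hom_mult[OF assms(2)])

end

text \<open>
  The extension of a family of pairings \<open>M\<^sub>i \<times> D\<^sub>j \<rightarrow> M\<^sub>i\<^sub>j\<close> to the direct sums. In degree \<open>k\<close> the sum runs
  over all \<open>i\<close> with the complementary degree \<open>i\<inverse>k\<close>; this is the product of the dual ring as well as
  its action on the direct sum of a comodule.
\<close>

definition conv ::
  "('g, 'y) monoid_scheme \<Rightarrow> ('g \<Rightarrow> ('m, 'z) monoid_scheme) \<Rightarrow> ('g \<Rightarrow> 'g \<Rightarrow> 'm \<Rightarrow> 'd \<Rightarrow> 'm)
    \<Rightarrow> ('g \<Rightarrow> 'm) \<Rightarrow> ('g \<Rightarrow> 'd) \<Rightarrow> ('g \<Rightarrow> 'm)"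
  where "conv G M act x r = (\<lambda>k\<in>carrier G. gfinprod (M k)
    (\<lambda>i. act i (inv\<^bsub>G\<^esub> i \<otimes>\<^bsub>G\<^esub> k) (x i) (r (inv\<^bsub>G\<^esub> i \<otimes>\<^bsub>G\<^esub> k))) (carrier G))"

locale graded_pairing = M: graded_group G M + D: graded_group G D
  for G :: "('g, 'y) monoid_scheme" (structure)
    and M :: "'g \<Rightarrow> ('m, 'u) monoid_scheme" and D :: "'g \<Rightarrow> ('d, 'v) monoid_scheme" +
  fixes act :: "'g \<Rightarrow> 'g \<Rightarrow> 'm \<Rightarrow> 'd \<Rightarrow> 'm"
  assumes act_closed: "\<lbrakk>i \<in> carrier G; j \<in> carrier G; m \<in> carrier (M i); d \<in> carrier (D j)\<rbrakk>
      \<Longrightarrow> act i j m d \<in> carrier (M (i \<otimes> j))"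
    and act_add_left: "\<lbrakk>i \<in> carrier G; j \<in> carrier G; m \<in> carrier (M i); m' \<in> carrier (M i); d \<in> carrier (D j)\<rbrakk>
      \<Longrightarrow> act i j (m \<otimes>\<^bsub>M i\<^esub> m') d = act i j m d \<otimes>\<^bsub>M (i \<otimes> j)\<^esub> act i j m' d"
    and act_add_right: "\<lbrakk>i \<in> carrier G; j \<in> carrier G; m \<in> carrier (M i); d \<in> carrier (D j); d' \<in> carrier (D j)\<rbrakk>
      \<Longrightarrow> act i j m (d \<otimes>\<^bsub>D j\<^esub> d') = act i j m d \<otimes>\<^bsub>M (i \<otimes> j)\<^esub> act i j m d'"
begin

lemma act_one_left:
  assumes "i \<in> carrier G" "j \<in> carrier G" "d \<in> carrier (D j)"
  shows "act i j \<one>\<^bsub>M i\<^esub> d = \<one>\<^bsub>M (i \<otimes> j)\<^esub>"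
proof -
  have "(\<lambda>m. act i j m d) \<in> hom (M i) (M (i \<otimes> j))"
    using assms by (simp add: hom_def act_closed act_add_left)
  then show ?thesis using hom_one M.group_comp assms M.G.m_closed by metis
qed

lemma act_one_right:
  assumes "i \<in> carrier G" "j \<in> carrier G" "m \<in> carrier (M i)"
  shows "act i j m \<one>\<^bsub>D j\<^esub> = \<one>\<^bsub>M (i \<otimes> j)\<^esub>"
proof -
  have "act i j m \<in> hom (D j) (M (i \<otimes> j))"
    using assms by (simp add: hom_def act_closed act_add_right)
  then show ?thesis using hom_one M.group_comp D.group_comp assms M.G.m_closed by metis
qed

lemma mult_inv_cancel: "\<lbrakk>i \<in> carrier G; k \<in> carrier G\<rbrakk> \<Longrightarrow> i \<otimes> (inv i \<otimes> k) = k"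
  by (simp flip: M.G.m_assoc)

abbreviation "summand x r k \<equiv> \<lambda>i. act i (inv i \<otimes> k) (x i) (r (inv i \<otimes> k))"

lemma summand_closed:
  assumes "x \<in> carrier M.dirsum" "r \<in> carrier D.dirsum" "k \<in> carrier G"
  shows "(summand x r k) \<in> carrier G \<rightarrow> carrier (M k)"
proof
  fix i assume "i \<in> carrier G"
  then show "summand x r k i \<in> carrier (M k)"
    using act_closed[of i "inv i \<otimes> k" "x i" "r (inv i \<otimes> k)"] assms
    by (simp add: M.dirsum_comp D.dirsum_comp mult_inv_cancel)
qed

lemma summand_one:
  assumes "x \<in> carrier M.dirsum" "r \<in> carrier D.dirsum" "k \<in> carrier G" "i \<in> carrier G"
    and "x i = \<one>\<^bsub>M i\<^esub> \<or> r (inv i \<otimes> k) = \<one>\<^bsub>D (inv i \<otimes> k)\<^esub>"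
  shows "summand x r k i = \<one>\<^bsub>M k\<^esub>"
  using assms act_one_left[of i "inv i \<otimes> k" "r (inv i \<otimes> k)"] act_one_right[of i "inv i \<otimes> k" "x i"]
  by (auto simp: mult_inv_cancel M.dirsum_comp D.dirsum_comp)

lemma summand_support:
  assumes "x \<in> carrier M.dirsum" "r \<in> carrier D.dirsum" "k \<in> carrier G"
  shows "finite {i \<in> carrier G. summand x r k i \<noteq> \<one>\<^bsub>M k\<^esub>}"
proof (rule finite_subset)
  show "{i \<in> carrier G. summand x r k i \<noteq> \<one>\<^bsub>M k\<^esub>}
      \<subseteq> {i \<in> carrier G. x i \<noteq> \<one>\<^bsub>M i\<^esub>}"
    using summand_one[OF assms] by auto
  show "finite {i \<in> carrier G. x i \<noteq> \<one>\<^bsub>M i\<^esub>}" using assms(1) by (simp add: M.carrier_dirsum)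
qed

text \<open>
  The support of the result lies in the product of the two finite supports.
\<close>

lemma conv_closed:
  assumes x: "x \<in> carrier M.dirsum" and r: "r \<in> carrier D.dirsum"
  shows "conv G M act x r \<in> carrier M.dirsum"
proof -
  let ?X = "{i \<in> carrier G. x i \<noteq> \<one>\<^bsub>M i\<^esub>}" and ?R = "{j \<in> carrier G. r j \<noteq> \<one>\<^bsub>D j\<^esub>}"
  have "{k \<in> carrier G. conv G M act x r k \<noteq> \<one>\<^bsub>M k\<^esub>} \<subseteq> (\<lambda>(i, j). i \<otimes> j) ` (?X \<times> ?R)"
  proof (intro subsetI, rule ccontr)
    fix k assume g: "k \<in> {k \<in> carrier G. conv G M act x r k \<noteq> \<one>\<^bsub>M k\<^esub>}"
      and n: "k \<notin> (\<lambda>(i, j). i \<otimes> j) ` (?X \<times> ?R)"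
    interpret Mg: comm_group "M k" using g M.comm_group_comp by simp
    have "x i = \<one>\<^bsub>M i\<^esub> \<or> r (inv i \<otimes> k) = \<one>\<^bsub>D (inv i \<otimes> k)\<^esub>" if "i \<in> carrier G" for i
    proof (rule ccontr)
      assume "\<not> ?thesis"
      then have "(i, inv i \<otimes> k) \<in> ?X \<times> ?R" using that g by auto
      then have "i \<otimes> (inv i \<otimes> k) \<in> (\<lambda>(i, j). i \<otimes> j) ` (?X \<times> ?R)" by force
      then show False using n g that by (simp add: mult_inv_cancel)
    qed
    then have "{i \<in> carrier G. summand x r k i \<noteq> \<one>\<^bsub>M k\<^esub>} = {}"
      using summand_one[OF x r] g by auto
    then have "gfinprod (M k) (summand x r k) (carrier G) = \<one>\<^bsub>M k\<^esub>"
      unfolding gfinprod_def by (simp only: Mg.finprod_empty finite.emptyI if_True)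
    then have "conv G M act x r k = \<one>\<^bsub>M k\<^esub>" using g by (simp add: conv_def)
    then show False using g by simp
  qed
  moreover have "finite (?X \<times> ?R)" using x r by (simp add: M.carrier_dirsum D.carrier_dirsum)
  ultimately have "finite {k \<in> carrier G. conv G M act x r k \<noteq> \<one>\<^bsub>M k\<^esub>}"
    by (meson finite_imageI finite_subset)
  moreover have "gfinprod (M k) (summand x r k) (carrier G) \<in> carrier (M k)"
    if "k \<in> carrier G" for k
    using comm_monoid.gfinprod_closed[OF comm_group.axioms(1)[OF M.comm_group_comp[OF that]] summand_closed[OF x r that]] .
  ultimately show ?thesis by (auto simp: M.carrier_dirsum conv_def)
qed

lemma conv_add_left:
  assumes x: "x \<in> carrier M.dirsum" and y: "y \<in> carrier M.dirsum" and r: "r \<in> carrier D.dirsum"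
  shows "conv G M act (x \<otimes>\<^bsub>M.dirsum\<^esub> y) r = conv G M act x r \<otimes>\<^bsub>M.dirsum\<^esub> conv G M act y r"
proof (rule M.dirsum_eqI[OF conv_closed[OF M.dirsum.m_closed[OF x y] r] M.dirsum.m_closed[OF conv_closed[OF x r] conv_closed[OF y r]]])
  fix k assume g: "k \<in> carrier G"
  interpret Mg: comm_group "M k" using g M.comm_group_comp by simp
  let ?h = "\<lambda>x. summand x r k"
  have eq: "?h (x \<otimes>\<^bsub>M.dirsum\<^esub> y) i = ?h x i \<otimes>\<^bsub>M k\<^esub> ?h y i" if "i \<in> carrier G" for i
    using that act_add_left[of i "inv i \<otimes> k" "x i" "y i" "r (inv i \<otimes> k)"] g x y r
    by (simp add: mult_inv_cancel M.dirsum_comp D.dirsum_comp)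
  have pc: "(\<lambda>i. ?h x i \<otimes>\<^bsub>M k\<^esub> ?h y i) \<in> carrier G \<rightarrow> carrier (M k)"
    using summand_closed[OF x r g] summand_closed[OF y r g] by auto
  have "gfinprod (M k) (?h (x \<otimes>\<^bsub>M.dirsum\<^esub> y)) (carrier G)
      = gfinprod (M k) (\<lambda>i. ?h x i \<otimes>\<^bsub>M k\<^esub> ?h y i) (carrier G)"
    by (rule Mg.gfinprod_cong[OF refl pc, symmetric]) (unfold simp_implies_def, rule eq[symmetric])
  also have "\<dots> = gfinprod (M k) (?h x) (carrier G) \<otimes>\<^bsub>M k\<^esub> gfinprod (M k) (?h y) (carrier G)"
    by (rule Mg.gfinprod_distrib[OF summand_support[OF x r g] summand_support[OF y r g] summand_closed[OF x r g] summand_closed[OF y r g]])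
  finally show "conv G M act (x \<otimes>\<^bsub>M.dirsum\<^esub> y) r k = (conv G M act x r \<otimes>\<^bsub>M.dirsum\<^esub> conv G M act y r) k"
    using g by (simp add: conv_def)
qed

lemma conv_add_right:
  assumes x: "x \<in> carrier M.dirsum" and r: "r \<in> carrier D.dirsum" and s: "s \<in> carrier D.dirsum"
  shows "conv G M act x (r \<otimes>\<^bsub>D.dirsum\<^esub> s) = conv G M act x r \<otimes>\<^bsub>M.dirsum\<^esub> conv G M act x s"
proof (rule M.dirsum_eqI[OF conv_closed[OF x D.dirsum.m_closed[OF r s]] M.dirsum.m_closed[OF conv_closed[OF x r] conv_closed[OF x s]]])
  fix k assume g: "k \<in> carrier G"
  interpret Mg: comm_group "M k" using g M.comm_group_comp by simp
  let ?h = "\<lambda>r. summand x r k"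
  have eq: "?h (r \<otimes>\<^bsub>D.dirsum\<^esub> s) i = ?h r i \<otimes>\<^bsub>M k\<^esub> ?h s i" if "i \<in> carrier G" for i
    using that act_add_right[of i "inv i \<otimes> k" "x i" "r (inv i \<otimes> k)" "s (inv i \<otimes> k)"] g x r s
    by (simp add: mult_inv_cancel M.dirsum_comp D.dirsum_comp)
  have pc: "(\<lambda>i. ?h r i \<otimes>\<^bsub>M k\<^esub> ?h s i) \<in> carrier G \<rightarrow> carrier (M k)"
    using summand_closed[OF x r g] summand_closed[OF x s g] by auto
  have "gfinprod (M k) (?h (r \<otimes>\<^bsub>D.dirsum\<^esub> s)) (carrier G)
      = gfinprod (M k) (\<lambda>i. ?h r i \<otimes>\<^bsub>M k\<^esub> ?h s i) (carrier G)"
    by (rule Mg.gfinprod_cong[OF refl pc, symmetric]) (unfold simp_implies_def, rule eq[symmetric])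
  also have "\<dots> = gfinprod (M k) (?h r) (carrier G) \<otimes>\<^bsub>M k\<^esub> gfinprod (M k) (?h s) (carrier G)"
    by (rule Mg.gfinprod_distrib[OF summand_support[OF x r g] summand_support[OF x s g] summand_closed[OF x r g] summand_closed[OF x s g]])
  finally show "conv G M act x (r \<otimes>\<^bsub>D.dirsum\<^esub> s) k = (conv G M act x r \<otimes>\<^bsub>M.dirsum\<^esub> conv G M act x s) k"
    using g by (simp add: conv_def)
qed

lemma conv_single:
  assumes a: "i \<in> carrier G" "j \<in> carrier G" and m: "m \<in> carrier (M i)" and d: "d \<in> carrier (D j)"
  shows "conv G M act (single G M i m) (single G D j d) = single G M (i \<otimes> j) (act i j m d)"
proof (rule M.dirsum_eqI)
  have x: "single G M i m \<in> carrier M.dirsum" and r: "single G D j d \<in> carrier D.dirsum"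
    using assms by simp_all
  show "conv G M act (single G M i m) (single G D j d) \<in> carrier M.dirsum" by (rule conv_closed[OF x r])
  show "single G M (i \<otimes> j) (act i j m d) \<in> carrier M.dirsum" using assms by (simp add: act_closed)
  fix k assume g: "k \<in> carrier G"
  interpret Mg: comm_group "M k" using g M.comm_group_comp by simp
  let ?h = "summand (single G M i m) (single G D j d) k"
  have hc: "?h \<in> carrier G \<rightarrow> carrier (M k)" by (rule summand_closed[OF x r g])
  have "gfinprod (M k) ?h (carrier G) = gfinprod (M k) ?h {i}"
  proof (rule Mg.gfinprod_mono_neutral_cong_right[OF _ _ _ hc])
    fix i' assume "i' \<in> carrier G - {i}"
    then show "?h i' = \<one>\<^bsub>M k\<^esub>" by (intro summand_one[OF x r g]) auto
  qed (use a in auto)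
  also have "\<dots> = ?h i" using hc a by (subst Mg.gfinprod_eq_finprod) (auto simp: Pi_iff)
  also have "\<dots> = single G M (i \<otimes> j) (act i j m d) k"
  proof (cases "k = i \<otimes> j")
    case True
    then show ?thesis using a by (simp flip: M.G.m_assoc)
  next
    case False
    then have "inv i \<otimes> k \<noteq> j" using a g mult_inv_cancel by metis
    then show ?thesis using False a g m summand_one[OF x r g a(1)] by simp
  qed
  finally show "conv G M act (single G M i m) (single G D j d) k = single G M (i \<otimes> j) (act i j m d) k"
    using g by (simp add: conv_def)
qed

text \<open>
  Elements of a single degree generate, so a biadditive map is determined by its values on them. This
  identifies the action of a graded module with the extension of its homogeneous components.
\<close>

lemma biadditive_eq_conv:
  assumes closed: "\<And>x r. \<lbrakk>x \<in> carrier M.dirsum; r \<in> carrier D.dirsum\<rbrakk> \<Longrightarrow> b x r \<in> carrier M.dirsum"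
    and left: "\<And>x y r. \<lbrakk>x \<in> carrier M.dirsum; y \<in> carrier M.dirsum; r \<in> carrier D.dirsum\<rbrakk>
      \<Longrightarrow> b (x \<otimes>\<^bsub>M.dirsum\<^esub> y) r = b x r \<otimes>\<^bsub>M.dirsum\<^esub> b y r"
    and right: "\<And>x r s. \<lbrakk>x \<in> carrier M.dirsum; r \<in> carrier D.dirsum; s \<in> carrier D.dirsum\<rbrakk>
      \<Longrightarrow> b x (r \<otimes>\<^bsub>D.dirsum\<^esub> s) = b x r \<otimes>\<^bsub>M.dirsum\<^esub> b x s"
    and singles: "\<And>i j m d. \<lbrakk>i \<in> carrier G; j \<in> carrier G; m \<in> carrier (M i); d \<in> carrier (D j)\<rbrakk>
      \<Longrightarrow> b (single G M i m) (single G D j d) = single G M (i \<otimes> j) (act i j m d)"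
    and x: "x \<in> carrier M.dirsum" and r: "r \<in> carrier D.dirsum"
  shows "b x r = conv G M act x r"
  using x
proof (induction rule: M.dirsum_induct)
  case (single i m)
  from r show ?case
  proof (induction rule: D.dirsum_induct)
    case (single j d)
    with \<open>i \<in> carrier G\<close> \<open>m \<in> carrier (M i)\<close> show ?case by (simp only: singles conv_single)
  next
    case (add r s)
    with \<open>i \<in> carrier G\<close> \<open>m \<in> carrier (M i)\<close> show ?case
      by (simp only: right conv_add_right M.single_closed)
  qed
next
  case (add x y)
  then show ?case using r by (simp only: left conv_add_left)
qed

lemma conv_unit_right:
  assumes u: "u \<in> carrier (D \<one>)"
    and unit: "\<And>i m. \<lbrakk>i \<in> carrier G; m \<in> carrier (M i)\<rbrakk> \<Longrightarrow> act i \<one> m u = m"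
    and x: "x \<in> carrier M.dirsum"
  shows "conv G M act x (single G D \<one> u) = x"
  using x
proof (induction rule: M.dirsum_induct)
  case (single i m)
  then show ?case using u by (simp add: conv_single unit)
next
  case (add x y)
  then show ?case using u by (simp only: conv_add_left D.single_closed M.G.one_closed)
qed

text \<open>
  Both sides are additive in each of the three arguments, which reduces the claim to single degrees.
  The case \<open>M = D\<close> is associativity of the direct sum ring.
\<close>

lemma conv_assoc:
  assumes "graded_pairing G D D mul"
    and assoc: "\<And>i j k m d e. \<lbrakk>i \<in> carrier G; j \<in> carrier G; k \<in> carrier G; m \<in> carrier (M i);
        d \<in> carrier (D j); e \<in> carrier (D k)\<rbrakk>
      \<Longrightarrow> act (i \<otimes> j) k (act i j m d) e = act i (j \<otimes> k) m (mul j k d e)"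
    and x: "x \<in> carrier M.dirsum" and r: "r \<in> carrier D.dirsum" and s: "s \<in> carrier D.dirsum"
  shows "conv G M act (conv G M act x r) s = conv G M act x (conv G D mul r s)"
proof -
  interpret mul: graded_pairing G D D mul by fact
  note [simp del] = mult_sum_group
  from x show ?thesis
  proof (induction rule: M.dirsum_induct)
    case (single i m)
    note m = this
    from r show ?case
    proof (induction rule: D.dirsum_induct)
      case (single j d)
      note d = this
      from s show ?case
      proof (induction rule: D.dirsum_induct)
        case (single k e)
        then show ?case using m d
          by (simp add: conv_single mul.conv_single act_closed mul.act_closed assoc M.G.m_assoc)
      next
        case (add s s')
        then show ?case using m d
          by (simp add: conv_single conv_add_right mul.conv_add_right act_closed mul.conv_closed)
      qed
    next
      case (add r r')
      then show ?case using m s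
        by (simp add: conv_add_right conv_add_left mul.conv_add_left conv_closed mul.conv_closed)
    qed
  next
    case (add x y)
    then show ?case using r s by (simp add: conv_add_left conv_closed mul.conv_closed)
  qed
qed

end

locale graded_multiplication = graded_pairing G D D mul
  for G :: "('g, 'y) monoid_scheme" (structure) and D :: "'g \<Rightarrow> 'd monoid"
    and mul :: "'g \<Rightarrow> 'g \<Rightarrow> 'd \<Rightarrow> 'd \<Rightarrow> 'd" +
  fixes u :: 'd
  assumes unit_closed: "u \<in> carrier (D \<one>)"
    and unit_left: "\<lbrakk>i \<in> carrier G; d \<in> carrier (D i)\<rbrakk> \<Longrightarrow> mul \<one> i u d = d"
    and unit_right: "\<lbrakk>i \<in> carrier G; d \<in> carrier (D i)\<rbrakk> \<Longrightarrow> mul i \<one> d u = d"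
    and mul_assoc: "\<lbrakk>i \<in> carrier G; j \<in> carrier G; k \<in> carrier G; c \<in> carrier (D i);
        d \<in> carrier (D j); e \<in> carrier (D k)\<rbrakk>
      \<Longrightarrow> mul (i \<otimes> j) k (mul i j c d) e = mul i (j \<otimes> k) c (mul j k d e)"
begin

lemma conv_unit_left:
  assumes r: "r \<in> carrier M.dirsum"
  shows "conv G D mul (single G D \<one> u) r = r"
  using r
proof (induction rule: M.dirsum_induct)
  case (single i m)
  then show ?case using unit_closed by (simp add: conv_single unit_left)
next
  case (add x y)
  then show ?case using unit_closed by (simp only: conv_add_right M.single_closed M.G.one_closed)
qed

abbreviation "direct_sum_ring \<equiv>
  \<lparr>carrier = carrier M.dirsum, monoid.mult = conv G D mul, one = single G D \<one> u,
   ring.zero = \<one>\<^bsub>M.dirsum\<^esub>, add = monoid.mult M.dirsum\<rparr>"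

lemma direct_sum_graded_ring: "graded_ring G direct_sum_ring D"
proof (intro graded_ring.intro graded_ring_axioms.intro)
  note [simp del] = mult_sum_group one_sum_group
  show "group G" by (rule M.G.is_group)
  show "ring direct_sum_ring"
  proof (rule ringI)
    show "abelian_group direct_sum_ring"
      by (rule abelian_groupI)
        (use M.dirsum.l_inv_ex in \<open>auto simp: M.dirsum.m_ac\<close>)
    show "monoid direct_sum_ring"
      by (rule monoidI)
        (simp_all add: conv_closed unit_closed conv_unit_left conv_unit_right[OF unit_closed unit_right]
          conv_assoc[OF graded_pairing_axioms mul_assoc])
  qed (simp_all add: conv_add_left conv_add_right)
  show "\<one>\<^bsub>direct_sum_ring\<^esub> \<in> homogeneous G D \<one>" using unit_closed by simp
  fix i j r s
  assume a: "i \<in> carrier G" "j \<in> carrier G" and "r \<in> homogeneous G D i" "s \<in> homogeneous G D j"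
  then obtain c d where "c \<in> carrier (D i)" "d \<in> carrier (D j)" "r = single G D i c" "s = single G D j d"
    by (auto simp: M.homogeneous_iff)
  then show "r \<otimes>\<^bsub>direct_sum_ring\<^esub> s \<in> homogeneous G D (i \<otimes> j)"
    using a by (simp add: conv_single act_closed)
qed (simp_all add: M.comm_group_comp)

end

lemma total_simps:
  "carrier (total G N) = carrier (sum_group (carrier G) (gcomp N))"
  "x \<otimes>\<^bsub>total G N\<^esub> y = x \<otimes>\<^bsub>sum_group (carrier G) (gcomp N)\<^esub> y"
  "\<one>\<^bsub>total G N\<^esub> = \<one>\<^bsub>sum_group (carrier G) (gcomp N)\<^esub>"
  "ract (total G N) = gact N"
  by (simp_all add: total_def)

lemma direct_sum_graded_module:
  assumes "graded_multiplication G D mul u" and "graded_pairing G (gcomp N) D act"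
    and R: "R = graded_multiplication.direct_sum_ring G D mul u"
    and unit: "\<And>i m. \<lbrakk>i \<in> carrier G; m \<in> carrier (gcomp N i)\<rbrakk> \<Longrightarrow> act i \<one>\<^bsub>G\<^esub> m u = m"
    and assoc: "\<And>i j k m d e. \<lbrakk>i \<in> carrier G; j \<in> carrier G; k \<in> carrier G; m \<in> carrier (gcomp N i);
        d \<in> carrier (D j); e \<in> carrier (D k)\<rbrakk>
      \<Longrightarrow> act (i \<otimes>\<^bsub>G\<^esub> j) k (act i j m d) e = act i (j \<otimes>\<^bsub>G\<^esub> k) m (mul j k d e)"
    and gact: "\<And>x r. \<lbrakk>x \<in> carrier (sum_group (carrier G) (gcomp N)); r \<in> carrier (sum_group (carrier G) D)\<rbrakk>
      \<Longrightarrow> gact N x r = conv G (gcomp N) act x r"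
  shows "graded_module G R D N"
proof -
  interpret mul: graded_multiplication G D mul u by fact
  interpret act: graded_pairing G "gcomp N" D act by fact
  interpret R: graded_ring G R D unfolding R by (rule mul.direct_sum_graded_ring)
  note [simp del] = mult_sum_group one_sum_group
  have Rs: "carrier R = carrier mul.M.dirsum" "r \<oplus>\<^bsub>R\<^esub> s = r \<otimes>\<^bsub>mul.M.dirsum\<^esub> s" "r \<otimes>\<^bsub>R\<^esub> s = conv G D mul r s"
    "\<one>\<^bsub>R\<^esub> = single G D \<one>\<^bsub>G\<^esub> u" for r s by (simp_all add: R)
  show ?thesis
  proof (intro graded_module.intro graded_module_axioms.intro R.graded_ring_axioms right_module.intro
      right_module_axioms.intro R.R.ring_axioms)
    show "comm_group (total G N)" by (rule comm_group_transfer[OF act.M.dirsum_comm_group]) (simp_all add: total_simps)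
    fix x r s assume "x \<in> carrier (total G N)" "r \<in> carrier R" "s \<in> carrier R"
    then show "ract (total G N) x (r \<otimes>\<^bsub>R\<^esub> s) = ract (total G N) (ract (total G N) x r) s"
      by (simp add: total_simps Rs gact act.conv_closed mul.conv_closed act.conv_assoc[OF mul.graded_pairing_axioms assoc])
  next
    fix x assume "x \<in> carrier (total G N)"
    then show "ract (total G N) x \<one>\<^bsub>R\<^esub> = x"
      by (simp add: total_simps Rs gact mul.unit_closed act.conv_unit_right[OF mul.unit_closed unit])
  next
    fix i j x r assume a: "i \<in> carrier G" "j \<in> carrier G"
      and "x \<in> homogeneous G (gcomp N) i" "r \<in> homogeneous G D j"
    then obtain m d where m: "m \<in> carrier (gcomp N i)" "d \<in> carrier (D j)"
      and eq: "x = single G (gcomp N) i m" "r = single G D j d"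
      by (auto simp: act.M.homogeneous_iff mul.M.homogeneous_iff)
    have "gact N x r = single G (gcomp N) (i \<otimes>\<^bsub>G\<^esub> j) (act i j m d)"
      unfolding eq using a m by (simp add: gact act.conv_single)
    then show "gact N x r \<in> homogeneous G (gcomp N) (i \<otimes>\<^bsub>G\<^esub> j)"
      using a m by (simp add: act.act_closed)
  qed (simp_all add: total_simps Rs gact act.conv_closed act.conv_add_left act.conv_add_right act.M.comm_group_comp)
qed

text \<open>
  Restricting the action of a graded module to single degrees reverses the passage from pairings of
  homogeneous components to the direct sum.
\<close>

definition homogeneous_action ::
  "('g, 'y) monoid_scheme \<Rightarrow> ('g \<Rightarrow> 'd monoid) \<Rightarrow> ('g, 'g \<Rightarrow> 'd, 'm) gr_module \<Rightarrow> 'g \<Rightarrow> 'g \<Rightarrow> 'm \<Rightarrow> 'd \<Rightarrow> 'm"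
  where "homogeneous_action G D N i j m d =
    gact N (single G (gcomp N) i m) (single G D j d) (i \<otimes>\<^bsub>G\<^esub> j)"

lemma (in graded_group) single_inject:
  "\<lbrakk>i \<in> carrier G; single G D i d = single G D i d'\<rbrakk> \<Longrightarrow> d = d'"
  by (drule fun_cong[of _ _ i]) simp

context graded_multiplication
begin

context
  fixes N :: "('g, 'g \<Rightarrow> 'd, 'm) gr_module"
  assumes N: "graded_module G direct_sum_ring D N"
begin

interpretation N: graded_module G direct_sum_ring D N by (rule N)

lemma gcomp_graded_group: "graded_group G (gcomp N)"
  by (intro graded_group.intro graded_group_axioms.intro M.G.is_group N.gcomp_comm_group)

interpretation NM: graded_group G "gcomp N" by (rule gcomp_graded_group)

abbreviation (input) "hact \<equiv> homogeneous_action G D N"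
abbreviation (input) "nsingle \<equiv> single G (gcomp N)"

lemma homogeneous_action:
  assumes "i \<in> carrier G" "j \<in> carrier G" "m \<in> carrier (gcomp N i)" "d \<in> carrier (D j)"
  shows "gact N (nsingle i m) (single G D j d)
      = nsingle (i \<otimes> j) (hact i j m d)"
    and "hact i j m d \<in> carrier (gcomp N (i \<otimes> j))"
proof -
  have "gact N (nsingle i m) (single G D j d) \<in> homogeneous G (gcomp N) (i \<otimes> j)"
    using assms by (intro N.gact_homogeneous) simp_all
  then obtain e where "e \<in> carrier (gcomp N (i \<otimes> j))"
      "gact N (nsingle i m) (single G D j d) = nsingle (i \<otimes> j) e"
    using assms by (auto simp: NM.homogeneous_iff)
  then show "gact N (nsingle i m) (single G D j d)
      = nsingle (i \<otimes> j) (hact i j m d)"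
    and "hact i j m d \<in> carrier (gcomp N (i \<otimes> j))"
    using assms by (simp_all add: homogeneous_action_def)
qed

lemma gact_closed: "\<lbrakk>x \<in> carrier NM.dirsum; r \<in> carrier M.dirsum\<rbrakk> \<Longrightarrow> gact N x r \<in> carrier NM.dirsum"
  using N.ract_closed[of x r] by (simp add: total_simps)

lemma gact_add_left: "\<lbrakk>x \<in> carrier NM.dirsum; y \<in> carrier NM.dirsum; r \<in> carrier M.dirsum\<rbrakk>
    \<Longrightarrow> gact N (x \<otimes>\<^bsub>NM.dirsum\<^esub> y) r = gact N x r \<otimes>\<^bsub>NM.dirsum\<^esub> gact N y r"
  using N.ract_add_left[of x y r] by (simp add: total_simps del: mult_sum_group)

lemma gact_add_right: "\<lbrakk>x \<in> carrier NM.dirsum; r \<in> carrier M.dirsum; s \<in> carrier M.dirsum\<rbrakk>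
    \<Longrightarrow> gact N x (r \<otimes>\<^bsub>M.dirsum\<^esub> s) = gact N x r \<otimes>\<^bsub>NM.dirsum\<^esub> gact N x s"
  using N.ract_add_right[of x r s] by (simp add: total_simps del: mult_sum_group)

lemma homogeneous_action_pairing: "graded_pairing G (gcomp N) D (hact)"
proof (intro graded_pairing.intro gcomp_graded_group M.graded_group_axioms graded_pairing_axioms.intro
    homogeneous_action(2))
  note [simp del] = mult_sum_group
  fix i j m d assume a: "i \<in> carrier G" "j \<in> carrier G" and m: "m \<in> carrier (gcomp N i)" and d: "d \<in> carrier (D j)"
  have ab: "i \<otimes> j \<in> carrier G" using a by simp
  { fix m' assume m': "m' \<in> carrier (gcomp N i)"
    have "m \<otimes>\<^bsub>gcomp N i\<^esub> m' \<in> carrier (gcomp N i)"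
      using m m' a by (intro monoid.m_closed[OF NM.monoid_comp])
    then show "hact i j (m \<otimes>\<^bsub>gcomp N i\<^esub> m') d
        = hact i j m d \<otimes>\<^bsub>gcomp N (i \<otimes> j)\<^esub> hact i j m' d"
      using a m m' d
      by (intro NM.single_inject[OF ab])
        (simp add: NM.single_mult homogeneous_action gact_add_left flip: homogeneous_action(1)) }
  { fix d' assume d': "d' \<in> carrier (D j)"
    have "d \<otimes>\<^bsub>D j\<^esub> d' \<in> carrier (D j)"
      using d d' a by (intro monoid.m_closed[OF M.monoid_comp])
    then show "hact i j m (d \<otimes>\<^bsub>D j\<^esub> d')
        = hact i j m d \<otimes>\<^bsub>gcomp N (i \<otimes> j)\<^esub> hact i j m d'"
      using a m d' d
      by (intro NM.single_inject[OF ab])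
        (simp add: NM.single_mult M.single_mult homogeneous_action gact_add_right flip: homogeneous_action(1)) }
qed

lemma homogeneous_action_unit:
  assumes "i \<in> carrier G" "m \<in> carrier (gcomp N i)"
  shows "hact i \<one> m u = m"
  using N.ract_one[of "nsingle i m"] homogeneous_action(1)[of i \<one> m u] assms unit_closed
  by (intro NM.single_inject[of i]) (simp_all add: total_simps)

lemma homogeneous_action_mul:
  assumes a: "i \<in> carrier G" "j \<in> carrier G" "k \<in> carrier G" and m: "m \<in> carrier (gcomp N i)"
    and d: "d \<in> carrier (D j)" and e: "e \<in> carrier (D k)"
  shows "hact (i \<otimes> j) k (hact i j m d) e
    = hact i (j \<otimes> k) m (mul j k d e)"
proof (rule NM.single_inject[of "i \<otimes> j \<otimes> k"])
  have "nsingle (i \<otimes> j \<otimes> k) (hact (i \<otimes> j) k (hact i j m d) e)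
      = gact N (gact N (nsingle i m) (single G D j d)) (single G D k e)"
    using assms by (simp add: homogeneous_action)
  also have "\<dots> = gact N (nsingle i m) (conv G D mul (single G D j d) (single G D k e))"
    using N.ract_mult[of "nsingle i m" "single G D j d" "single G D k e"] assms
    by (simp add: total_simps)
  also have "\<dots> = nsingle (i \<otimes> j \<otimes> k) (hact i (j \<otimes> k) m (mul j k d e))"
    using homogeneous_action(1)[of i "j \<otimes> k" m "mul j k d e"] assms
    by (simp add: conv_single act_closed M.G.m_assoc)
  finally show "nsingle (i \<otimes> j \<otimes> k)
      (hact (i \<otimes> j) k (hact i j m d) e)
    = nsingle (i \<otimes> j \<otimes> k) (hact i (j \<otimes> k) m (mul j k d e))" .
qed (use a in simp)

end

end


section \<open>The left dual graded ring and its action on comodules\<close>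

lemma dual_comp_dual: "dual_comp G A C i = dual A (ccomp C (inv\<^bsub>G\<^esub> i))"
  by (simp add: dual_comp_def dual_def Let_def)

lemma dual_action_slice:
  "dual_action G A C M i j m f = slice A (mcomp M (i \<otimes>\<^bsub>G\<^esub> j)) (ccomp C (inv\<^bsub>G\<^esub> j)) f
    (coact M (i \<otimes>\<^bsub>G\<^esub> j) (inv\<^bsub>G\<^esub> j) m)"
  by (simp add: dual_action_def slice_def Let_def)

text \<open>
  The image of \<open>b\<close> under the ring morphism from \<open>A\<close> to the degree \<open>\<one>\<close> part of the dual ring. It is
  through these elements that the action of the dual ring contains the action of \<open>A\<close>.
\<close>

definition (in group_coring) scalar :: "'a \<Rightarrow> 'c \<Rightarrow> 'a"
  where "scalar b = (\<lambda>c\<in>carrier (ccomp C \<one>). counit C c \<otimes>\<^bsub>A\<^esub> b)"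

context group_comodule
begin

lemma comp_module: "i \<in> carrier G \<Longrightarrow> left_module A (ccomp C i)"
  using ccomp_bimodule bimodule.left_mod by blast

lemma tensor_comp: "\<lbrakk>i \<in> carrier G; j \<in> carrier G\<rbrakk> \<Longrightarrow> tensor_product A (mcomp M i) (ccomp C j)"
  by (intro tensor_productI mcomp_module comp_module)

lemma comult_left_linear:
  "\<lbrakk>i \<in> carrier G; j \<in> carrier G\<rbrakk> \<Longrightarrow>
    comult C i j \<in> left_linear A (ccomp C (i \<otimes> j)) (tensor_bimod A (ccomp C i) (ccomp C j))"
  using comult_bilinear by (simp add: bilinear_def)

lemma counit_left_linear: "counit C \<in> left_linear A (ccomp C \<one>) (regular A)"
  using counit_bilinear by (simp add: bilinear_def)

lemma cancel_right: "\<lbrakk>i \<in> carrier G; j \<in> carrier G\<rbrakk> \<Longrightarrow> i \<otimes> j \<otimes> inv j = i"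
  "\<lbrakk>i \<in> carrier G; j \<in> carrier G\<rbrakk> \<Longrightarrow> i \<otimes> inv j \<otimes> j = i"
  by (simp_all add: G.m_assoc)

lemma coact_facts:
  assumes "i \<in> carrier G" "j \<in> carrier G"
  shows "m \<in> carrier (mcomp M (i \<otimes> j)) \<Longrightarrow> coact M i j m \<in> carrier (tensor A (mcomp M i) (ccomp C j))"
    and "\<lbrakk>m \<in> carrier (mcomp M (i \<otimes> j)); n \<in> carrier (mcomp M (i \<otimes> j))\<rbrakk> \<Longrightarrow>
      coact M i j (m \<otimes>\<^bsub>mcomp M (i \<otimes> j)\<^esub> n)
      = coact M i j m \<otimes>\<^bsub>tensor A (mcomp M i) (ccomp C j)\<^esub> coact M i j n"
  using coact_linear[OF assms] by (auto simp: right_linear_iff)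

lemma coact_inv_facts:
  assumes "i \<in> carrier G" "j \<in> carrier G"
  shows "m \<in> carrier (mcomp M i) \<Longrightarrow>
      coact M (i \<otimes> j) (inv j) m \<in> carrier (tensor A (mcomp M (i \<otimes> j)) (ccomp C (inv j)))"
    and "\<lbrakk>m \<in> carrier (mcomp M i); n \<in> carrier (mcomp M i)\<rbrakk> \<Longrightarrow>
      coact M (i \<otimes> j) (inv j) (m \<otimes>\<^bsub>mcomp M i\<^esub> n)
      = coact M (i \<otimes> j) (inv j) m \<otimes>\<^bsub>tensor A (mcomp M (i \<otimes> j)) (ccomp C (inv j))\<^esub> coact M (i \<otimes> j) (inv j) n"
  using coact_facts[of "i \<otimes> j" "inv j" m] coact_facts(2)[of "i \<otimes> j" "inv j" m n] assms
  by (simp_all add: cancel_right)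

lemma dual_comp_comm_group: "i \<in> carrier G \<Longrightarrow> comm_group (dual_comp G A C i)"
  unfolding dual_comp_dual by (intro left_module.dual_comm_group comp_module) simp

lemma action_pairing: "graded_pairing G (mcomp M) (dual_comp G A C) (dual_action G A C M)"
proof (intro graded_pairing.intro graded_group.intro graded_group_axioms.intro graded_pairing_axioms.intro
    G.is_group dual_comp_comm_group)
  show "comm_group (mcomp M i)" if "i \<in> carrier G" for i
    using mcomp_module[OF that] by (simp add: right_module_def)
  fix i j assume a: "i \<in> carrier G" "j \<in> carrier G"
  interpret T: tensor_product A "mcomp M (i \<otimes> j)" "ccomp C (inv j)" using a by (intro tensor_comp) simp_all
  fix m f assume m: "m \<in> carrier (mcomp M i)" and f: "f \<in> carrier (dual_comp G A C j)"
  then have fl: "f \<in> left_linear A (ccomp C (inv j)) (regular A)"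
    by (simp add: dual_comp_dual dual_linear)
  show "dual_action G A C M i j m f \<in> carrier (mcomp M (i \<otimes> j))"
    using coact_inv_facts(1)[OF a m] by (simp add: dual_action_slice T.slice_closed[OF fl])
  { fix n assume n: "n \<in> carrier (mcomp M i)"
    show "dual_action G A C M i j (m \<otimes>\<^bsub>mcomp M i\<^esub> n) f
        = dual_action G A C M i j m f \<otimes>\<^bsub>mcomp M (i \<otimes> j)\<^esub> dual_action G A C M i j n f"
      using coact_inv_facts[OF a] m n by (simp add: dual_action_slice T.slice_mult[OF fl]) }
  { fix g assume "g \<in> carrier (dual_comp G A C j)"
    then have gl: "g \<in> left_linear A (ccomp C (inv j)) (regular A)"
      by (simp add: dual_comp_dual dual_linear)
    show "dual_action G A C M i j m (f \<otimes>\<^bsub>dual_comp G A C j\<^esub> g)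
        = dual_action G A C M i j m f \<otimes>\<^bsub>mcomp M (i \<otimes> j)\<^esub> dual_action G A C M i j m g"
      unfolding dual_action_slice
      by (rule T.slice_add[OF fl gl _ coact_inv_facts(1)[OF a m]]) (simp add: dual_comp_dual dual_simps) }
qed

lemma action_scalar:
  assumes a: "i \<in> carrier G" and m: "m \<in> carrier (mcomp M i)" and b: "b \<in> carrier A"
  shows "dual_action G A C M i \<one> m (scalar b) = ract (mcomp M i) m b"
proof -
  interpret T: tensor_product A "mcomp M i" "ccomp C \<one>" using a by (intro tensor_comp) simp_all
  have t: "coact M i \<one> m \<in> carrier T.T" using coact_facts(1)[of i \<one>] a m by simp
  have "slice A (mcomp M i) (ccomp C \<one>) (scalar b) (coact M i \<one> m)
      = ract (mcomp M i) (slice A (mcomp M i) (ccomp C \<one>) (counit C) (coact M i \<one> m)) b"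
    by (rule T.slice_scale[OF counit_left_linear b _ t]) (simp add: scalar_def)
  also have "slice A (mcomp M i) (ccomp C \<one>) (counit C) (coact M i \<one> m) = m"
    using right_unitor_tensor_map[OF mcomp_module[OF a] comp_module counit_left_linear t] coact_counit[OF a m] by simp
  finally show ?thesis using a by (simp only: dual_action_slice G.r_one G.inv_one)
qed

lemma action_counit:
  assumes a: "i \<in> carrier G" and m: "m \<in> carrier (mcomp M i)"
  shows "dual_action G A C M i \<one> m (restrict (counit C) (carrier (ccomp C \<one>))) = m"
proof -
  interpret Ma: right_module A "mcomp M i" by (rule mcomp_module[OF a])
  have "scalar \<one>\<^bsub>A\<^esub> = restrict (counit C) (carrier (ccomp C \<one>))"
    using counit_left_linear unfolding scalar_def by (intro restrict_ext) (simp add: left_linear_iff)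
  then show ?thesis using action_scalar[OF a m A.one_closed] m by (simp add: Ma.ract_one)
qed

end

lemma tensor_lift_right_of: "tensor_lift A M N (right_of B) b = tensor_lift A M N B b"
  by (simp add: tensor_lift_def)

text \<open>
  The coring as a right comodule over itself: its coassociativity and right counit law are the
  comodule axioms. The action of the dual ring on it is the map \<open>c \<mapsto> c\<^sub>1 f(c\<^sub>2)\<close>.
\<close>

definition regular_comodule :: "('g, 'a, 'c) coring \<Rightarrow> ('g, 'a, 'c, 'c) comodule"
  where "regular_comodule C = \<lparr>mcomp = (\<lambda>i. right_of (ccomp C i)), coact = comult C\<rparr>"

lemma regular_comodule_simps [simp]:
  "mcomp (regular_comodule C) i = right_of (ccomp C i)" "coact (regular_comodule C) = comult C"
  by (simp_all add: regular_comodule_def)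

lemma (in group_coring) regular_comodule: "group_comodule G A C (regular_comodule C)"
proof (intro group_comodule.intro group_comodule_axioms.intro group_coring_axioms)
  fix i assume a: "i \<in> carrier G"
  show "right_module A (mcomp (regular_comodule C) i)"
    using bimodule.right_mod[OF ccomp_bimodule[OF a]] by simp
  fix j assume "j \<in> carrier G"
  then show "coact (regular_comodule C) i j \<in> right_linear A (mcomp (regular_comodule C) (i \<otimes> j))
      (tensor_rmod A (mcomp (regular_comodule C) i) (ccomp C j))"
    using comult_bilinear[OF a] by (simp add: bilinear_def right_of_tensor_bimod)
qed (use coassoc counit_right in \<open>simp_all add: right_of_tensor_bimod\<close>)

context group_coring
begin

sublocale self: group_comodule G A C "regular_comodule C" by (rule regular_comodule)

abbreviation "dual_degree i \<equiv> carrier (dual_comp G A C i)"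
abbreviation "coring_action i j c f \<equiv> dual_action G A C (regular_comodule C) i j c f"

sublocale self: graded_pairing G "mcomp (regular_comodule C)" "dual_comp G A C"
    "dual_action G A C (regular_comodule C)"
  by (rule self.action_pairing)

lemma inv_mult_cancel: "\<lbrakk>i \<in> carrier G; j \<in> carrier G\<rbrakk> \<Longrightarrow> inv (i \<otimes> j) \<otimes> i = inv j"
  by (simp add: G.inv_mult_group G.m_assoc)

text \<open>
  \<open>(f # g)(c) = g(c \<cdot> f)\<close>. This lets facts about the action on comodules be used for the product.
\<close>

lemma dual_mult_action:
  assumes "i \<in> carrier G" "j \<in> carrier G" "c \<in> carrier (ccomp C (inv (i \<otimes> j)))"
  shows "dual_mult G A C i j f g c = g (coring_action (inv (i \<otimes> j)) i c f)"
  using assms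
  by (simp add: dual_mult_def dual_action_slice slice_def tensor_lift_right_of inv_mult_cancel Let_def)

lemma dual_mult_extensional: "dual_mult G A C i j f g \<in> extensional (carrier (ccomp C (inv (i \<otimes> j))))"
  by (simp add: dual_mult_def)

lemma coring_action_closed:
  assumes "i \<in> carrier G" "j \<in> carrier G" "c \<in> carrier (ccomp C i)" "f \<in> dual_degree j"
  shows "coring_action i j c f \<in> carrier (ccomp C (i \<otimes> j))"
  using self.act_closed[of i j c f] assms by simp

lemma coring_action_left_linear:
  assumes a: "i \<in> carrier G" "j \<in> carrier G" and f: "f \<in> dual_degree j"
  shows "(\<lambda>c. coring_action i j c f) \<in> left_linear A (ccomp C i) (ccomp C (i \<otimes> j))"
proof -
  have "comult C (i \<otimes> j) (inv j) \<in> left_linear A (ccomp C i) (tensor_bimod A (ccomp C (i \<otimes> j)) (ccomp C (inv j)))"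
    using self.comult_left_linear[of "i \<otimes> j" "inv j"] a by (simp add: self.cancel_right)
  moreover have "slice A (right_of (ccomp C (i \<otimes> j))) (ccomp C (inv j)) f
      \<in> left_linear A (tensor_bimod A (ccomp C (i \<otimes> j)) (ccomp C (inv j))) (ccomp C (i \<otimes> j))"
    using a f by (intro slice_left_linear ccomp_bimodule) (simp_all add: dual_comp_dual dual_linear)
  ultimately show ?thesis
    unfolding dual_action_slice regular_comodule_simps by (rule left_linear_comp)
qed

lemma dual_mult_closed:
  assumes a: "i \<in> carrier G" "j \<in> carrier G" and f: "f \<in> dual_degree i" and g: "g \<in> dual_degree j"
  shows "dual_mult G A C i j f g \<in> dual_degree (i \<otimes> j)"
proof -
  interpret B: left_module A "ccomp C (inv (i \<otimes> j))" using a by (intro self.comp_module) simp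
  have l: "(\<lambda>c. coring_action (inv (i \<otimes> j)) i c f) \<in> left_linear A (ccomp C (inv (i \<otimes> j))) (ccomp C (inv j))"
    using coring_action_left_linear[of "inv (i \<otimes> j)" i f] a f by (simp add: inv_mult_cancel)
  have gl: "g \<in> left_linear A (ccomp C (inv j)) (regular A)"
    using g by (simp add: dual_comp_dual dual_linear)
  have "dual_mult G A C i j f g \<in> left_linear A (ccomp C (inv (i \<otimes> j))) (regular A)"
    using left_linear_comp[OF l gl]
    by (subst left_linear_cong[OF B.left_module_axioms, of _ "\<lambda>c. g (coring_action (inv (i \<otimes> j)) i c f)"])
      (simp_all only: dual_mult_action[OF a])
  then show ?thesis using dual_mult_extensional by (simp add: dual_comp_dual dual_simps)
qed

lemma dual_degree_add:
  "\<lbrakk>f \<in> dual_degree i; c \<in> carrier (ccomp C (inv i)); d \<in> carrier (ccomp C (inv i))\<rbrakk>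
    \<Longrightarrow> f (c \<otimes>\<^bsub>ccomp C (inv i)\<^esub> d) = f c \<oplus>\<^bsub>A\<^esub> f d"
  by (simp add: dual_comp_dual dual_simps left_linear_iff)

lemma dual_degree_eqI:
  "\<lbrakk>f \<in> dual_degree i; g \<in> dual_degree i; \<And>c. c \<in> carrier (ccomp C (inv i)) \<Longrightarrow> f c = g c\<rbrakk> \<Longrightarrow> f = g"
  unfolding dual_comp_dual by (rule dual_eqI)

lemma dual_comp_mult:
  "c \<in> carrier (ccomp C (inv i)) \<Longrightarrow> (f \<otimes>\<^bsub>dual_comp G A C i\<^esub> g) c = f c \<oplus>\<^bsub>A\<^esub> g c"
  by (simp add: dual_comp_dual dual_simps)

lemma
  assumes a: "i \<in> carrier G" "j \<in> carrier G"
  shows dual_mult_add_left: "\<lbrakk>f \<in> dual_degree i; g \<in> dual_degree i; h \<in> dual_degree j\<rbrakk> \<Longrightarrow>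
      dual_mult G A C i j (f \<otimes>\<^bsub>dual_comp G A C i\<^esub> g) h
      = dual_mult G A C i j f h \<otimes>\<^bsub>dual_comp G A C (i \<otimes> j)\<^esub> dual_mult G A C i j g h"
    and dual_mult_add_right: "\<lbrakk>f \<in> dual_degree i; g \<in> dual_degree j; h \<in> dual_degree j\<rbrakk> \<Longrightarrow>
      dual_mult G A C i j f (g \<otimes>\<^bsub>dual_comp G A C j\<^esub> h)
      = dual_mult G A C i j f g \<otimes>\<^bsub>dual_comp G A C (i \<otimes> j)\<^esub> dual_mult G A C i j f h"
proof -
  have ab: "inv (i \<otimes> j) \<in> carrier G" "i \<otimes> j \<in> carrier G" using a by simp_all
  interpret Dab: comm_group "dual_comp G A C (i \<otimes> j)" by (rule self.dual_comp_comm_group[OF ab(2)])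
  interpret Da: comm_group "dual_comp G A C i" by (rule self.dual_comp_comm_group[OF a(1)])
  interpret Db: comm_group "dual_comp G A C j" by (rule self.dual_comp_comm_group[OF a(2)])
  note cc = coring_action_closed[OF ab(1) a(1), unfolded inv_mult_cancel[OF a]]
  { assume f: "f \<in> dual_degree i" "g \<in> dual_degree i" and h: "h \<in> dual_degree j"
    show "dual_mult G A C i j (f \<otimes>\<^bsub>dual_comp G A C i\<^esub> g) h
        = dual_mult G A C i j f h \<otimes>\<^bsub>dual_comp G A C (i \<otimes> j)\<^esub> dual_mult G A C i j g h"
    proof (rule dual_degree_eqI[of _ "i \<otimes> j"])
      fix c assume c: "c \<in> carrier (ccomp C (inv (i \<otimes> j)))"
      have "coring_action (inv (i \<otimes> j)) i c (f \<otimes>\<^bsub>dual_comp G A C i\<^esub> g)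
          = coring_action (inv (i \<otimes> j)) i c f \<otimes>\<^bsub>ccomp C (inv j)\<^esub> coring_action (inv (i \<otimes> j)) i c g"
        using self.act_add_right[OF ab(1) a(1), of c f g] c f by (simp add: inv_mult_cancel[OF a])
      then show "dual_mult G A C i j (f \<otimes>\<^bsub>dual_comp G A C i\<^esub> g) h c
          = (dual_mult G A C i j f h \<otimes>\<^bsub>dual_comp G A C (i \<otimes> j)\<^esub> dual_mult G A C i j g h) c"
        using c f h by (simp add: dual_mult_action[OF a] dual_comp_mult dual_degree_add cc)
    qed (use a f h in \<open>simp_all add: dual_mult_closed\<close>) }
  { assume f: "f \<in> dual_degree i" and h: "g \<in> dual_degree j" "h \<in> dual_degree j"
    show "dual_mult G A C i j f (g \<otimes>\<^bsub>dual_comp G A C j\<^esub> h)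
        = dual_mult G A C i j f g \<otimes>\<^bsub>dual_comp G A C (i \<otimes> j)\<^esub> dual_mult G A C i j f h"
      by (rule dual_degree_eqI[of _ "i \<otimes> j"])
        (use a f h in \<open>simp_all add: dual_mult_closed dual_mult_action[OF a] dual_comp_mult cc\<close>) }
qed

lemma dual_pairing: "graded_pairing G (dual_comp G A C) (dual_comp G A C) (dual_mult G A C)"
  by (intro graded_pairing.intro graded_pairing_axioms.intro self.D.graded_group_axioms
      dual_mult_closed dual_mult_add_left dual_mult_add_right)

lemma counit_closed: "restrict (counit C) (carrier (ccomp C \<one>)) \<in> dual_degree \<one>"
  using left_module.restrict_dual[OF self.comp_module[OF G.one_closed] self.counit_left_linear]
  by (simp add: dual_comp_dual)

end

context group_comodule
begin

text \<open>
  The left side slices \<open>\<rho>(m)\<close> by \<open>f\<close>, coacts and slices by \<open>g\<close>. By coassociativity this is the slice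
  of \<open>\<rho>(m)\<close>, taken in degree \<open>(jk)\<inverse>\<close>, by the functional \<open>c \<mapsto> g(c\<^sub>1 f(c\<^sub>2))\<close>, which is \<open>f # g\<close>.
\<close>

lemma action_dual_mult:
  assumes a: "i \<in> carrier G" "j \<in> carrier G" "k \<in> carrier G" and m: "m \<in> carrier (mcomp M i)"
    and f: "f \<in> dual_degree j" and g: "g \<in> dual_degree k"
  shows "dual_action G A C M (i \<otimes> j) k (dual_action G A C M i j m f) g
    = dual_action G A C M i (j \<otimes> k) m (dual_mult G A C j k f g)"
proof -
  let ?d = "i \<otimes> j \<otimes> k"
  let ?Q = "mcomp M ?d" and ?P = "mcomp M (i \<otimes> j)" and ?B = "ccomp C (inv k)" and ?B' = "ccomp C (inv j)"
  have deg: "?d \<otimes> inv k = i \<otimes> j" "i \<otimes> j \<otimes> inv j = i" "inv (j \<otimes> k) = inv k \<otimes> inv j"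
    "i \<otimes> (j \<otimes> k) = ?d"
    using a by (simp_all add: cancel_right G.inv_mult_group G.m_assoc)
  have B: "bimodule A ?B" "bimodule A ?B'" "left_module A ?B'" using a by (simp_all add: ccomp_bimodule comp_module)
  have fl: "f \<in> left_linear A ?B' (regular A)" and gl: "g \<in> left_linear A ?B (regular A)"
    using f g by (simp_all add: dual_comp_dual dual_linear)
  have Q: "right_module A ?Q" "right_module A ?P" using a by (simp_all add: mcomp_module)
  let ?phi = "\<lambda>s. g (slice A (right_of ?B) ?B' f s)"
  have phi: "?phi \<in> left_linear A (tensor_bimod A ?B ?B') (regular A)"
    by (rule left_linear_comp[OF slice_left_linear[OF B(1,2) fl] gl])
  have D: "comult C (inv k) (inv j) \<in> left_linear A (ccomp C (inv k \<otimes> inv j)) (tensor_bimod A ?B ?B')"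
    using a by (intro comult_left_linear) simp_all
  have r: "coact M ?d (inv k) \<in> right_linear A ?P (tensor_rmod A ?Q ?B)"
    using coact_linear[of ?d "inv k"] a by (simp add: deg)
  have t: "coact M (i \<otimes> j) (inv j) m \<in> carrier (tensor A ?P ?B')"
    using a m by (intro coact_inv_facts) simp_all
  have t': "coact M ?d (inv k \<otimes> inv j) m \<in> carrier (tensor A ?Q (ccomp C (inv k \<otimes> inv j)))"
    using coact_facts(1)[of ?d "inv k \<otimes> inv j" m] a m by (simp add: deg flip: G.m_assoc)
  have BB: "left_module A (tensor_bimod A ?B ?B')" by (rule tensor_bimod_left_module[OF B(1,2)])
  have "slice A ?Q ?B g (coact M ?d (inv k) (slice A ?P ?B' f (coact M (i \<otimes> j) (inv j) m)))
      = slice A ?Q (tensor_bimod A ?B ?B') ?phi (associator A ?Q ?B ?B'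
          (tensor_map A ?P ?B' (tensor_rmod A ?Q ?B) ?B' (coact M ?d (inv k)) (\<lambda>c. c) (coact M (i \<otimes> j) (inv j) m)))"
    by (rule slice_associator_tensor_map[OF Q B(1,2) fl gl r t, symmetric])
  also have "\<dots> = slice A ?Q (tensor_bimod A ?B ?B') ?phi
      (tensor_map A ?Q (ccomp C (inv k \<otimes> inv j)) ?Q (tensor_bimod A ?B ?B') (\<lambda>m. m) (comult C (inv k) (inv j))
        (coact M ?d (inv k \<otimes> inv j) m))"
    using coact_coassoc[of ?d "inv k" "inv j" m] a m by (simp add: deg)
  also have "\<dots> = slice A ?Q (ccomp C (inv k \<otimes> inv j)) (\<lambda>c. ?phi (comult C (inv k) (inv j) c))
      (coact M ?d (inv k \<otimes> inv j) m)"
    using a by (intro slice_tensor_map_right[OF Q(1) _ BB D phi t'] comp_module) simp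
  also have "slice A ?Q (ccomp C (inv k \<otimes> inv j)) (\<lambda>c. ?phi (comult C (inv k) (inv j) c))
      = slice A ?Q (ccomp C (inv k \<otimes> inv j)) (dual_mult G A C j k f g)"
  proof (rule tensor_product.slice_cong)
    show "tensor_product A ?Q (ccomp C (inv k \<otimes> inv j))" using a by (intro tensor_comp) simp_all
  qed (use a in \<open>simp add: dual_mult_def deg slice_def tensor_lift_right_of Let_def\<close>)
  finally show ?thesis using a by (simp add: dual_action_slice deg)
qed

end

context group_coring
begin

text \<open>
  Associativity is the module law for the coring acting on itself, with the last factor applied
  to it. The left unit
  law is \<open>c \<cdot> \<epsilon> = c\<close>, a consequence of the right counit law; the right unit law needs the left counit
  law, with the functional applied to it.
\<close>

lemma dual_multiplication:
  "graded_multiplication G (dual_comp G A C) (dual_mult G A C) (restrict (counit C) (carrier (ccomp C \<one>)))"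
proof (intro graded_multiplication.intro graded_multiplication_axioms.intro dual_pairing counit_closed)
  let ?e = "restrict (counit C) (carrier (ccomp C \<one>))"
  fix i f assume a: "i \<in> carrier G" and f: "f \<in> dual_degree i"
  show "dual_mult G A C \<one> i ?e f = f"
  proof (rule dual_degree_eqI[of _ i, OF _ f])
    show "dual_mult G A C \<one> i ?e f \<in> dual_degree i"
      using dual_mult_closed[OF G.one_closed a counit_closed f] a by simp
    fix c assume "c \<in> carrier (ccomp C (inv i))"
    then show "dual_mult G A C \<one> i ?e f c = f c"
      using dual_mult_action[of \<one> i c] self.action_counit[of "inv i" c] a by simp
  qed
  show "dual_mult G A C i \<one> f ?e = f"
  proof (rule dual_degree_eqI[of _ i, OF _ f])
    show "dual_mult G A C i \<one> f ?e \<in> dual_degree i"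
      using dual_mult_closed[OF a G.one_closed f counit_closed] a by simp
    fix c assume c: "c \<in> carrier (ccomp C (inv i))"
    have fl: "f \<in> left_linear A (ccomp C (inv i)) (regular A)" using f by (simp add: dual_comp_dual dual_linear)
    have t: "comult C \<one> (inv i) c \<in> carrier (tensor A (right_of (ccomp C \<one>)) (ccomp C (inv i)))"
      using self.coact_facts(1)[of \<one> "inv i" c] a c by simp
    have "dual_mult G A C i \<one> f ?e c = ?e (coring_action (inv i) i c f)"
      using dual_mult_action[of i \<one> c] a c by simp
    also have "\<dots> = counit C (coring_action (inv i) i c f)"
      using coring_action_closed[of "inv i" i c f] a c f by simp
    also have "coring_action (inv i) i c f = slice A (right_of (ccomp C \<one>)) (ccomp C (inv i)) f (comult C \<one> (inv i) c)"
      using a by (simp add: dual_action_slice)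
    also have "counit C \<dots> = f (left_unitor A (ccomp C (inv i))
        (tensor_map A (right_of (ccomp C \<one>)) (ccomp C (inv i)) (right_of (regular A)) (ccomp C (inv i))
          (counit C) (\<lambda>c. c) (comult C \<one> (inv i) c)))"
      using left_unitor_tensor_map[OF ccomp_bimodule[OF G.one_closed] self.comp_module[of "inv i"] _ fl t]
        counit_bilinear a by (simp add: bilinear_def)
    also have "\<dots> = f c" using counit_left[of "inv i" c] a c by simp
    finally show "dual_mult G A C i \<one> f ?e c = f c" .
  qed
next
  fix i j k f g h assume a: "i \<in> carrier G" "j \<in> carrier G" "k \<in> carrier G"
    and f: "f \<in> dual_degree i" and g: "g \<in> dual_degree j" and h: "h \<in> dual_degree k"
  show "dual_mult G A C (i \<otimes> j) k (dual_mult G A C i j f g) h = dual_mult G A C i (j \<otimes> k) f (dual_mult G A C j k g h)"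
  proof (rule dual_degree_eqI[of _ "i \<otimes> j \<otimes> k"])
    let ?i = "inv (i \<otimes> j \<otimes> k)"
    fix c assume c: "c \<in> carrier (ccomp C ?i)"
    have i: "?i \<in> carrier G" using a by simp
    have deg: "?i \<otimes> i = inv (j \<otimes> k)" "inv (i \<otimes> (j \<otimes> k)) = ?i"
      using inv_mult_cancel[of i "j \<otimes> k"] a by (simp_all add: G.m_assoc)
    have "dual_mult G A C (i \<otimes> j) k (dual_mult G A C i j f g) h c
        = h (coring_action ?i (i \<otimes> j) c (dual_mult G A C i j f g))"
      using a c by (simp add: dual_mult_action)
    also have "\<dots> = h (coring_action (inv (j \<otimes> k)) j (coring_action ?i i c f) g)"
      using self.action_dual_mult[OF i a(1,2) _ f g, of c] c by (simp add: deg)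
    also have "\<dots> = dual_mult G A C j k g h (coring_action ?i i c f)"
      using coring_action_closed[OF i a(1) c f] a by (simp add: dual_mult_action deg)
    also have "\<dots> = dual_mult G A C i (j \<otimes> k) f (dual_mult G A C j k g h) c"
      using dual_mult_action[of i "j \<otimes> k" c] a c by (simp add: deg)
    finally show "dual_mult G A C (i \<otimes> j) k (dual_mult G A C i j f g) h c
      = dual_mult G A C i (j \<otimes> k) f (dual_mult G A C j k g h) c" .
  next
    show "dual_mult G A C i (j \<otimes> k) f (dual_mult G A C j k g h) \<in> dual_degree (i \<otimes> j \<otimes> k)"
      using dual_mult_closed[of i "j \<otimes> k" f "dual_mult G A C j k g h"] a f g h
      by (simp add: dual_mult_closed G.m_assoc)
  qed (use a f g h in \<open>simp add: dual_mult_closed\<close>)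
qed

sublocale dual: graded_multiplication G "dual_comp G A C" "dual_mult G A C"
    "restrict (counit C) (carrier (ccomp C \<one>))"
  by (rule dual_multiplication)

lemma scalar_closed:
  assumes "b \<in> carrier A"
  shows "scalar b \<in> dual_degree \<one>"
proof -
  interpret B: left_module A "ccomp C \<one>" by (rule self.comp_module) simp
  have "(\<lambda>c. counit C c \<otimes>\<^bsub>A\<^esub> b) \<in> left_linear A (ccomp C \<one>) (regular A)"
    using self.counit_left_linear assms by (simp add: left_linear_iff A.l_distr A.m_assoc)
  then show ?thesis using B.restrict_dual by (simp add: dual_comp_dual scalar_def)
qed

lemma counit_carrier: "c \<in> carrier (ccomp C \<one>) \<Longrightarrow> counit C c \<in> carrier A"
  using self.counit_left_linear by (simp add: left_linear_iff)

lemma scalar_add: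
  "\<lbrakk>a \<in> carrier A; b \<in> carrier A\<rbrakk> \<Longrightarrow> scalar (a \<oplus>\<^bsub>A\<^esub> b) = scalar a \<otimes>\<^bsub>dual_comp G A C \<one>\<^esub> scalar b"
  by (auto simp: scalar_def dual_comp_dual dual_simps A.r_distr counit_carrier intro!: restrict_ext)

lemma scalar_one: "scalar \<one>\<^bsub>A\<^esub> = restrict (counit C) (carrier (ccomp C \<one>))"
  by (auto simp: scalar_def counit_carrier intro!: restrict_ext)

text \<open>
  The product with scalars from either side is the bimodule structure of the dual. From the right it
  is post-multiplication of the values, from the left pre-composition with the right action on \<open>C\<close>.
\<close>

lemma dual_mult_scalar_right:
  assumes a: "i \<in> carrier G" and f: "f \<in> dual_degree i" and b: "b \<in> carrier A"
  shows "dual_mult G A C i \<one> f (scalar b) = (\<lambda>c\<in>carrier (ccomp C (inv i)). f c \<otimes>\<^bsub>A\<^esub> b)"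
proof (rule extensionalityI[of _ "carrier (ccomp C (inv i))"])
  show "dual_mult G A C i \<one> f (scalar b) \<in> extensional (carrier (ccomp C (inv i)))"
    using dual_mult_extensional[of i \<one>] a by simp
  fix c assume c: "c \<in> carrier (ccomp C (inv i))"
  have cc: "coring_action (inv i) i c f \<in> carrier (ccomp C \<one>)"
    using coring_action_closed[of "inv i" i c f] a c f by simp
  have "counit C (coring_action (inv i) i c f)
      = dual_mult G A C i \<one> f (restrict (counit C) (carrier (ccomp C \<one>))) c"
    using dual_mult_action[of i \<one> c] a c cc by simp
  then have "counit C (coring_action (inv i) i c f) = f c" by (simp add: dual.unit_right[OF a f])
  then show "dual_mult G A C i \<one> f (scalar b) c = (\<lambda>c\<in>carrier (ccomp C (inv i)). f c \<otimes>\<^bsub>A\<^esub> b) c"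
    using dual_mult_action[of i \<one> c] a c cc by (simp add: scalar_def)
qed simp

lemma dual_mult_scalar_left:
  assumes a: "i \<in> carrier G" and f: "f \<in> dual_degree i" and b: "b \<in> carrier A"
  shows "dual_mult G A C \<one> i (scalar b) f = (\<lambda>c\<in>carrier (ccomp C (inv i)). f (bract (ccomp C (inv i)) c b))"
proof (rule extensionalityI[of _ "carrier (ccomp C (inv i))"])
  show "dual_mult G A C \<one> i (scalar b) f \<in> extensional (carrier (ccomp C (inv i)))"
    using dual_mult_extensional[of \<one> i] a by simp
  fix c assume c: "c \<in> carrier (ccomp C (inv i))"
  then have "coring_action (inv i) \<one> c (scalar b) = bract (ccomp C (inv i)) c b"
    using self.action_scalar[of "inv i" c b] a b by simp
  then show "dual_mult G A C \<one> i (scalar b) f c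
      = (\<lambda>c\<in>carrier (ccomp C (inv i)). f (bract (ccomp C (inv i)) c b)) c"
    using dual_mult_action[of \<one> i c] a c by simp
qed simp

lemma scalar_mult:
  assumes "a \<in> carrier A" "b \<in> carrier A"
  shows "scalar (a \<otimes>\<^bsub>A\<^esub> b) = dual_mult G A C \<one> \<one> (scalar a) (scalar b)"
  using dual_mult_scalar_right[OF G.one_closed scalar_closed[OF assms(1)] assms(2)] assms
  by (auto simp: scalar_def A.m_assoc counit_carrier intro!: restrict_ext)

lemma left_dual_ring_direct_sum: "left_dual_ring G A C = dual.direct_sum_ring"
  by (simp add: left_dual_ring_def conv_def[abs_def] single_def Let_def)

end

text \<open>
  The action read backwards: every slice of a component of the coaction is a value of the action.
\<close>

lemma (in group_comodule) slice_coact: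
  assumes "i \<in> carrier G" "j \<in> carrier G"
  shows "slice A (mcomp M i) (ccomp C j) d (coact M i j m) = dual_action G A C M (i \<otimes> j) (inv j) m d"
  using assms by (simp add: dual_action_slice cancel_right)

lemma (in group_coring) dual_degree_inv: "j \<in> carrier G \<Longrightarrow> dual_comp G A C (inv j) = dual A (ccomp C j)"
  by (simp add: dual_comp_dual)


section \<open>The two categories\<close>

lemma compose_right_linear:
  assumes "right_module R M" "f \<in> right_linear R M N" "g \<in> right_linear R N P"
  shows "compose (carrier M) g f \<in> right_linear R M P"
proof -
  interpret M: right_module R M by fact
  show ?thesis using assms(2,3) by (simp add: right_linear_iff compose_def M.ract_closed)
qed

lemma restrict_id_right_linear:
  assumes "right_module R M"
  shows "(\<lambda>m\<in>carrier M. m) \<in> right_linear R M M"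
proof -
  interpret M: right_module R M by fact
  show ?thesis by (simp add: right_linear_iff M.ract_closed)
qed

lemma compose_id_right: "f \<in> extensional S \<Longrightarrow> compose S f (\<lambda>x\<in>S. x) = f"
  by (auto simp: compose_def extensional_def)

lemma compose_id_left: "\<lbrakk>f \<in> extensional S; f ` S \<subseteq> U\<rbrakk> \<Longrightarrow> compose S (\<lambda>x\<in>U. x) f = f"
  by (rule extensionalityI[of _ S]) (auto simp: compose_def)

lemma right_linear_image: "f \<in> right_linear R M N \<Longrightarrow> f ` carrier M \<subseteq> carrier N"
  by (auto simp: right_linear_iff)

lemma graded_module_category_simps:
  "Obj (graded_module_category G R D) = {N. graded_module G R D N \<and> extensional_gr_module G R N}"
  "Hom (graded_module_category G R D) = graded_morphisms G R"
  "Idm (graded_module_category G R D) N = (\<lambda>x\<in>carrier (total G N). x)"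
  "Cmp (graded_module_category G R D) N N' N'' g f = compose (carrier (total G N)) g f"
  by (simp_all add: graded_module_category_def)

lemma homogeneous_total: "x \<in> homogeneous G (gcomp N) i \<Longrightarrow> x \<in> carrier (total G N)"
  by (simp add: homogeneous_def total_def)

lemma graded_module_category:
  fixes G :: "('g, 'y) monoid_scheme" and R :: "('g \<Rightarrow> 'd, 'x) ring_scheme"
  shows "category (graded_module_category G R D :: (('g, 'g \<Rightarrow> 'd, 'm) gr_module, ('g \<Rightarrow> 'm) \<Rightarrow> 'g \<Rightarrow> 'm) category_data)"
    (is "category ?L")
proof
  have rm: "right_module R (total G N)" if "graded_module G R D N" for N
    using that by (simp add: graded_module_def)
  fix U assume U: "U \<in> Obj ?L"
  then show "Idm ?L U \<in> Hom ?L U U"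
    using restrict_id_right_linear[OF rm]
    by (auto simp: graded_module_category_simps graded_morphisms_def homogeneous_total)
  fix V assume V: "V \<in> Obj ?L"
  fix f assume f: "f \<in> Hom ?L U V"
  then have fl: "f \<in> right_linear R (total G U) (total G V)" and fe: "f \<in> extensional (carrier (total G U))"
    and fh: "\<And>i x. \<lbrakk>i \<in> carrier G; x \<in> homogeneous G (gcomp U) i\<rbrakk> \<Longrightarrow> f x \<in> homogeneous G (gcomp V) i"
    by (auto simp: graded_module_category_simps graded_morphisms_def)
  show "Cmp ?L U U V f (Idm ?L U) = f"
    by (simp add: graded_module_category_simps compose_id_right fe)
  show "Cmp ?L U V V (Idm ?L V) f = f"
    by (simp add: graded_module_category_simps compose_id_left fe right_linear_image[OF fl])
  fix W assume W: "W \<in> Obj ?L"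
  fix g assume g: "g \<in> Hom ?L V W"
  then have gl: "g \<in> right_linear R (total G V) (total G W)"
    and gh: "\<And>i x. \<lbrakk>i \<in> carrier G; x \<in> homogeneous G (gcomp V) i\<rbrakk> \<Longrightarrow> g x \<in> homogeneous G (gcomp W) i"
    by (auto simp: graded_module_category_simps graded_morphisms_def)
  show "Cmp ?L U V W g f \<in> Hom ?L U W"
    using compose_right_linear[OF rm fl gl] U
    by (auto simp: graded_module_category_simps graded_morphisms_def compose_def fh gh homogeneous_total)
  fix S h
  show "Cmp ?L U V S (Cmp ?L V W S h g) f
      = Cmp ?L U W S h (Cmp ?L U V W g f)"
    using right_linear_image[OF fl] by (auto simp: graded_module_category_simps compose_def intro!: restrict_ext)
qed

lemma comodule_category_simps:
  "Obj (comodule_category G A C) = {M. group_comodule G A C M \<and> extensional_comodule G A M}"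
  "Hom (comodule_category G A C) = comodule_morphisms G A C"
  "Idm (comodule_category G A C) M = (\<lambda>i\<in>carrier G. \<lambda>m\<in>carrier (mcomp M i). m)"
  "Cmp (comodule_category G A C) M N P g f = (\<lambda>i\<in>carrier G. compose (carrier (mcomp M i)) (g i) (f i))"
  by (simp_all add: comodule_category_def)

lemma comodule_morphisms_iff:
  "f \<in> comodule_morphisms G A C M N \<longleftrightarrow>
    f \<in> extensional (carrier G) \<and>
    (\<forall>i\<in>carrier G. f i \<in> right_linear A (mcomp M i) (mcomp N i) \<and> f i \<in> extensional (carrier (mcomp M i))) \<and>
    (\<forall>i\<in>carrier G. \<forall>j\<in>carrier G. \<forall>m\<in>carrier (mcomp M (i \<otimes>\<^bsub>G\<^esub> j)).
      tensor_map A (mcomp M i) (ccomp C j) (mcomp N i) (ccomp C j) (f i) (\<lambda>c. c) (coact M i j m)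
      = coact N i j (f (i \<otimes>\<^bsub>G\<^esub> j) m))"
  by (auto simp: comodule_morphisms_def PiE_iff)

lemma comodule_morphismD:
  assumes "f \<in> comodule_morphisms G A C M N"
  shows "f \<in> extensional (carrier G)"
    and "i \<in> carrier G \<Longrightarrow> f i \<in> right_linear A (mcomp M i) (mcomp N i)"
    and "i \<in> carrier G \<Longrightarrow> f i \<in> extensional (carrier (mcomp M i))"
    and "\<lbrakk>i \<in> carrier G; j \<in> carrier G; m \<in> carrier (mcomp M (i \<otimes>\<^bsub>G\<^esub> j))\<rbrakk> \<Longrightarrow>
      tensor_map A (mcomp M i) (ccomp C j) (mcomp N i) (ccomp C j) (f i) (\<lambda>c. c) (coact M i j m)
      = coact N i j (f (i \<otimes>\<^bsub>G\<^esub> j) m)"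
    and "\<lbrakk>i \<in> carrier G; m \<in> carrier (mcomp M i)\<rbrakk> \<Longrightarrow> f i m \<in> carrier (mcomp N i)"
  using assms by (auto simp: comodule_morphisms_iff right_linear_iff)

lemma (in group_coring) comodule_category:
  "category (comodule_category G A C :: (('g, 'a, 'c, 'm) comodule, 'g \<Rightarrow> 'm \<Rightarrow> 'm) category_data)"
    (is "category ?K")
proof
  fix U assume "U \<in> Obj ?K"
  then interpret U: group_comodule G A C U by (simp add: comodule_category_simps)
  show "Idm ?K U \<in> Hom ?K U U"
    using U.coact_facts(1)
    by (auto simp: comodule_category_simps comodule_morphisms_iff restrict_id_right_linear[OF U.mcomp_module]
        tensor_map_id[OF U.tensor_comp])
  fix V assume "V \<in> Obj ?K"
  then interpret V: group_comodule G A C V by (simp add: comodule_category_simps)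
  fix f assume "f \<in> Hom ?K U V"
  then have f: "f \<in> comodule_morphisms G A C U V" by (simp add: comodule_category_simps)
  note f' = comodule_morphismD[OF f]
  show "Cmp ?K U U V f (Idm ?K U) = f"
    using f' by (intro extensionalityI[of _ "carrier G"]) (simp_all add: comodule_category_simps compose_id_right)
  show "Cmp ?K U V V (Idm ?K V) f = f"
    using f' by (intro extensionalityI[of _ "carrier G"])
      (simp_all add: comodule_category_simps compose_id_left right_linear_image)
  fix W assume "W \<in> Obj ?K"
  then interpret W: group_comodule G A C W by (simp add: comodule_category_simps)
  fix g assume "g \<in> Hom ?K V W"
  then have g: "g \<in> comodule_morphisms G A C V W" by (simp add: comodule_category_simps)
  note g' = comodule_morphismD[OF g]
  show "Cmp ?K U V W g f \<in> Hom ?K U W"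
    unfolding comodule_category_simps comodule_morphisms_iff
  proof (intro conjI ballI)
    fix i assume a: "i \<in> carrier G"
    show "(\<lambda>i\<in>carrier G. compose (carrier (mcomp U i)) (g i) (f i)) i \<in> right_linear A (mcomp U i) (mcomp W i)"
      using a compose_right_linear[OF U.mcomp_module f'(2) g'(2)] by simp
    show "(\<lambda>i\<in>carrier G. compose (carrier (mcomp U i)) (g i) (f i)) i \<in> extensional (carrier (mcomp U i))"
      using a by simp
    fix j m assume b: "j \<in> carrier G" and m: "m \<in> carrier (mcomp U (i \<otimes> j))"
    have "tensor_map A (mcomp U i) (ccomp C j) (mcomp W i) (ccomp C j)
          ((\<lambda>i\<in>carrier G. compose (carrier (mcomp U i)) (g i) (f i)) i) (\<lambda>c. c) (coact U i j m)
        = tensor_map A (mcomp V i) (ccomp C j) (mcomp W i) (ccomp C j) (g i) (\<lambda>c. c)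
            (tensor_map A (mcomp U i) (ccomp C j) (mcomp V i) (ccomp C j) (f i) (\<lambda>c. c) (coact U i j m))"
      using a by (intro tensor_map_comp[OF U.tensor_comp[OF a b] V.tensor_comp[OF a b] W.tensor_comp[OF a b]
            f'(2)[OF a] left_linear_id g'(2)[OF a] left_linear_id _ _ U.coact_facts(1)[OF a b m]])
        (simp_all add: compose_def)
    also have "\<dots> = coact W i j (g (i \<otimes> j) (f (i \<otimes> j) m))"
      using a b m f'(5)[of "i \<otimes> j" m] by (simp add: f'(4) g'(4))
    finally show "tensor_map A (mcomp U i) (ccomp C j) (mcomp W i) (ccomp C j)
          ((\<lambda>i\<in>carrier G. compose (carrier (mcomp U i)) (g i) (f i)) i) (\<lambda>c. c) (coact U i j m)
        = coact W i j ((\<lambda>i\<in>carrier G. compose (carrier (mcomp U i)) (g i) (f i)) (i \<otimes> j) m)"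
      using a b m by (simp add: compose_def)
  qed simp
  fix S h
  show "Cmp ?K U V S (Cmp ?K V W S h g) f
      = Cmp ?K U W S h (Cmp ?K U V W g f)"
    using f'(5) by (auto simp: comodule_category_simps compose_def intro!: restrict_ext)
qed


section \<open>The functor\<close>

text \<open>
  The components of \<open>F3_obj\<close> are the additive groups of those of the comodule without the action of
  \<open>A\<close>, hence records of another type.
\<close>

lemma graded_pairing_transfer:
  assumes "graded_pairing G M D act"
    and eq: "\<And>i. i \<in> carrier G \<Longrightarrow> carrier (M' i) = carrier (M i)"
      "\<And>i x y. i \<in> carrier G \<Longrightarrow> x \<otimes>\<^bsub>M' i\<^esub> y = x \<otimes>\<^bsub>M i\<^esub> y"
      "\<And>i. i \<in> carrier G \<Longrightarrow> \<one>\<^bsub>M' i\<^esub> = \<one>\<^bsub>M i\<^esub>"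
  shows "graded_pairing G M' D act"
    and "\<lbrakk>x \<in> carrier (sum_group (carrier G) M); r \<in> carrier (sum_group (carrier G) D)\<rbrakk>
      \<Longrightarrow> conv G M act x r = conv G M' act x r"
proof -
  interpret P: graded_pairing G M D act by fact
  show P': "graded_pairing G M' D act"
    by (intro graded_pairing.intro graded_group.intro graded_group_axioms.intro graded_pairing_axioms.intro
        P.M.G.is_group P.D.comm_group_comp comm_group_transfer[OF P.M.comm_group_comp])
      (simp_all add: eq P.act_closed P.act_add_left P.act_add_right)
  interpret P': graded_pairing G M' D act by (rule P')
  have s: "sum_group (carrier G) M' = sum_group (carrier G) M" by (rule sum_group_cong) (simp_all add: eq)
  have sg: "single G M' i m = single G M i m" for i m
    unfolding single_def by (rule restrict_ext) (simp add: eq)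
  note [simp del] = mult_sum_group
  assume "x \<in> carrier (sum_group (carrier G) M)" "r \<in> carrier (sum_group (carrier G) D)"
  then show "conv G M act x r = conv G M' act x r"
    by (intro P'.biadditive_eq_conv[where b = "conv G M act"])
      (simp_all add: s sg eq P.conv_closed P.conv_add_left P.conv_add_right P.conv_single)
qed

definition dirsum_map ::
  "('g, 'y) monoid_scheme \<Rightarrow> ('g \<Rightarrow> ('m, 'u) monoid_scheme) \<Rightarrow> ('g \<Rightarrow> 'm \<Rightarrow> 'n) \<Rightarrow> ('g \<Rightarrow> 'm) \<Rightarrow> ('g \<Rightarrow> 'n)"
  where "dirsum_map G M f = (\<lambda>x\<in>carrier (sum_group (carrier G) M). \<lambda>i\<in>carrier G. f i (x i))"

lemma
  assumes "graded_group G M" "graded_group G N" and f: "\<And>i. i \<in> carrier G \<Longrightarrow> f i \<in> hom (M i) (N i)"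
  shows dirsum_map_hom: "dirsum_map G M f \<in> hom (sum_group (carrier G) M) (sum_group (carrier G) N)"
    and dirsum_map_single: "\<lbrakk>i \<in> carrier G; m \<in> carrier (M i)\<rbrakk>
      \<Longrightarrow> dirsum_map G M f (single G M i m) = single G N i (f i m)"
proof -
  interpret M: graded_group G M by fact
  interpret N: graded_group G N by fact
  have one: "f i \<one>\<^bsub>M i\<^esub> = \<one>\<^bsub>N i\<^esub>" if "i \<in> carrier G" for i
    using f that M.group_comp N.group_comp by (simp add: hom_one)
  have fc: "f i m \<in> carrier (N i)" if "i \<in> carrier G" "m \<in> carrier (M i)" for i m
    using f[OF that(1)] that(2) by (auto simp: hom_def)
  have c: "dirsum_map G M f x \<in> carrier N.dirsum" if x: "x \<in> carrier M.dirsum" for x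
  proof -
    have "{i \<in> carrier G. f i (x i) \<noteq> \<one>\<^bsub>N i\<^esub>} \<subseteq> {i \<in> carrier G. x i \<noteq> \<one>\<^bsub>M i\<^esub>}"
      using one by auto
    then have "finite {i \<in> carrier G. f i (x i) \<noteq> \<one>\<^bsub>N i\<^esub>}"
      using x finite_subset by (auto simp: M.carrier_dirsum)
    then have "(\<lambda>i\<in>carrier G. f i (x i)) \<in> carrier N.dirsum"
      using fc M.dirsum_comp[OF x] by (auto simp: N.carrier_dirsum cong: conj_cong)
    then show ?thesis using x by (simp add: dirsum_map_def)
  qed
  show "dirsum_map G M f \<in> hom M.dirsum N.dirsum"
  proof (rule homI)
    fix x y assume "x \<in> carrier M.dirsum" "y \<in> carrier M.dirsum"
    then show "dirsum_map G M f (x \<otimes>\<^bsub>M.dirsum\<^esub> y) = dirsum_map G M f x \<otimes>\<^bsub>N.dirsum\<^esub> dirsum_map G M f y"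
      using M.dirsum.m_closed[of x y] M.dirsum_comp
      by (auto simp: dirsum_map_def hom_mult[OF f] intro!: restrict_ext)
  qed (rule c)
  assume m: "i \<in> carrier G" "m \<in> carrier (M i)"
  show "dirsum_map G M f (single G M i m) = single G N i (f i m)"
    using m by (intro N.dirsum_eqI c) (simp_all add: fc, simp add: dirsum_map_def one)
qed

text \<open>
  Slicing commutes with linear maps on the left tensor factor, so a map compatible with the coactions
  is compatible with all their slices.
\<close>

lemma comodule_morphism_action:
  assumes "group_comodule G A C M" "group_comodule G A C N" and f: "f \<in> comodule_morphisms G A C M N"
    and a: "i \<in> carrier G" "j \<in> carrier G" and m: "m \<in> carrier (mcomp M i)"
    and d: "d \<in> carrier (dual_comp G A C j)"
  shows "f (i \<otimes>\<^bsub>G\<^esub> j) (dual_action G A C M i j m d) = dual_action G A C N i j (f i m) d"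
proof -
  interpret M: group_comodule G A C M by fact
  interpret N: group_comodule G A C N by fact
  have dl: "d \<in> left_linear A (ccomp C (inv\<^bsub>G\<^esub> j)) (regular A)"
    using d by (simp add: dual_comp_dual dual_linear)
  have c: "i \<otimes>\<^bsub>G\<^esub> j \<in> carrier G" "inv\<^bsub>G\<^esub> j \<in> carrier G" using a by simp_all
  show ?thesis
    using slice_tensor_map_left[OF M.mcomp_module[OF c(1)] N.mcomp_module[OF c(1)] M.comp_module[OF c(2)]
        comodule_morphismD(2)[OF f c(1)] dl M.coact_inv_facts(1)[OF a m]]
      comodule_morphismD(4)[OF f c, of m] a m
    by (simp add: dual_action_slice M.cancel_right)
qed

lemma F3_obj_gcomp:
  assumes "i \<in> carrier G"
  shows "carrier (gcomp (F3_obj G A C M) i) = carrier (mcomp M i)"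
    "x \<otimes>\<^bsub>gcomp (F3_obj G A C M) i\<^esub> y = x \<otimes>\<^bsub>mcomp M i\<^esub> y"
    "\<one>\<^bsub>gcomp (F3_obj G A C M) i\<^esub> = \<one>\<^bsub>mcomp M i\<^esub>"
  using assms by (simp_all add: F3_obj_def)

lemma F3_obj_sum: "sum_group (carrier G) (gcomp (F3_obj G A C M)) = sum_group (carrier G) (mcomp M)"
  by (rule sum_group_cong) (simp_all add: F3_obj_gcomp)

lemma F3_obj_homogeneous: "homogeneous G (gcomp (F3_obj G A C M)) i = homogeneous G (mcomp M) i"
  by (auto simp: homogeneous_def F3_obj_sum F3_obj_gcomp)

lemma left_dual_ring_carrier: "carrier (left_dual_ring G A C) = carrier (sum_group (carrier G) (dual_comp G A C))"
  by (simp add: left_dual_ring_def Let_def)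

lemma F3_obj_gact:
  "\<lbrakk>x \<in> carrier (sum_group (carrier G) (mcomp M)); r \<in> carrier (sum_group (carrier G) (dual_comp G A C))\<rbrakk>
    \<Longrightarrow> gact (F3_obj G A C M) x r = conv G (mcomp M) (dual_action G A C M) x r"
  by (simp add: F3_obj_def conv_def left_dual_ring_carrier)

lemma (in group_comodule) F3_obj_graded_module:
  "graded_module G (left_dual_ring G A C) (dual_comp G A C) (F3_obj G A C M)"
proof (rule direct_sum_graded_module[OF dual_multiplication graded_pairing_transfer(1)[OF action_pairing]
      left_dual_ring_direct_sum])
  fix x r
  assume "x \<in> carrier (sum_group (carrier G) (gcomp (F3_obj G A C M)))"
    "r \<in> carrier (sum_group (carrier G) (dual_comp G A C))"
  then show "gact (F3_obj G A C M) x r = conv G (gcomp (F3_obj G A C M)) (dual_action G A C M) x r"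
    using graded_pairing_transfer(2)[OF action_pairing, of "gcomp (F3_obj G A C M)"]
    by (simp add: F3_obj_sum F3_obj_gact F3_obj_gcomp)
qed (simp_all add: F3_obj_gcomp action_counit action_dual_mult)

lemma F3_obj_extensional:
  assumes "extensional_comodule G A M"
  shows "extensional_gr_module G (left_dual_ring G A C) (F3_obj G A C M)"
  using assms
  by (auto simp: extensional_gr_module_def extensional_comodule_def extensional_monoid_def F3_obj_def total_def
      F3_obj_sum[unfolded F3_obj_def, simplified])

lemma F3_simps:
  "FObj (F3 G A C) = F3_obj G A C"
  "FMor (F3 G A C) M N f = dirsum_map G (mcomp M) f"
  by (simp_all add: F3_def dirsum_map_def)

lemma (in group_comodule) mcomp_graded_group: "graded_group G (mcomp M)"
  using action_pairing by (simp add: graded_pairing_def)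

lemma right_linear_hom: "f \<in> right_linear A M N \<Longrightarrow> f \<in> hom M N"
  by (simp add: right_linear_def)

lemma F3_morphism:
  assumes M: "group_comodule G A C M" and N: "group_comodule G A C N"
    and f: "f \<in> comodule_morphisms G A C M N"
  shows "dirsum_map G (mcomp M) f \<in> graded_morphisms G (left_dual_ring G A C) (F3_obj G A C M) (F3_obj G A C N)"
proof -
  interpret M: group_comodule G A C M by fact
  interpret N: group_comodule G A C N by fact
  interpret MP: graded_pairing G "mcomp M" "dual_comp G A C" "dual_action G A C M" by (rule M.action_pairing)
  interpret NP: graded_pairing G "mcomp N" "dual_comp G A C" "dual_action G A C N" by (rule N.action_pairing)
  note f' = comodule_morphismD[OF f]
  let ?h = "dirsum_map G (mcomp M) f"
  note hom = dirsum_map_hom[OF M.mcomp_graded_group N.mcomp_graded_group right_linear_hom[OF f'(2)]]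
    and on_single = dirsum_map_single[OF M.mcomp_graded_group N.mcomp_graded_group right_linear_hom[OF f'(2)]]
  have hc: "?h x \<in> carrier NP.M.dirsum" if "x \<in> carrier MP.M.dirsum" for x
    using hom that by (auto simp: hom_def)
  note [simp del] = mult_sum_group
  have act: "?h (conv G (mcomp M) (dual_action G A C M) x r) = conv G (mcomp N) (dual_action G A C N) (?h x) r"
    if "x \<in> carrier MP.M.dirsum" and r: "r \<in> carrier (sum_group (carrier G) (dual_comp G A C))" for x r
    using that(1)
  proof (induction rule: MP.M.dirsum_induct)
    case (single i m)
    note m = this
    from r show ?case
    proof (induction rule: M.self.D.dirsum_induct)
      case (single j d)
      then show ?case
        using m f'(5)[OF m] comodule_morphism_action[OF M N f m(1) single(1) m(2) single(2)]
        by (simp add: MP.conv_single NP.conv_single on_single MP.act_closed)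
    next
      case (add r s)
      then show ?case using m
        by (simp add: MP.conv_add_right NP.conv_add_right hc hom_mult[OF hom] MP.conv_closed)
    qed
  next
    case (add x y)
    then show ?case using r
      by (simp add: MP.conv_add_left NP.conv_add_left hc hom_mult[OF hom] MP.conv_closed)
  qed
  have "?h \<in> right_linear (left_dual_ring G A C) (total G (F3_obj G A C M)) (total G (F3_obj G A C N))"
    using hc act
    by (simp add: right_linear_iff total_simps F3_obj_sum F3_obj_gact left_dual_ring_carrier hom_mult[OF hom])
  moreover have "?h ` homogeneous G (mcomp M) i \<subseteq> homogeneous G (mcomp N) i" if "i \<in> carrier G" for i
    using that f'(5) by (auto simp: MP.M.homogeneous_iff on_single)
  ultimately show ?thesis
    by (simp add: graded_morphisms_def F3_obj_homogeneous total_simps F3_obj_sum, simp add: dirsum_map_def)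
qed

lemma (in group_coring) F3_functor:
  "cat_functor (comodule_category G A C :: (('g, 'a, 'c, 'm) comodule, 'g \<Rightarrow> 'm \<Rightarrow> 'm) category_data)
    (graded_module_category G (left_dual_ring G A C) (dual_comp G A C)) (F3 G A C)"
    (is "cat_functor ?K ?L _")
proof (intro cat_functor.intro comodule_category graded_module_category cat_functor_axioms.intro)
  fix U :: "('g, 'a, 'c, 'm) comodule" assume "U \<in> Obj ?K"
  then have U: "group_comodule G A C U" "extensional_comodule G A U" by (simp_all add: comodule_category_simps)
  interpret U: graded_group G "mcomp U" by (rule group_comodule.mcomp_graded_group[OF U(1)])
  show "FObj (F3 G A C) U \<in> Obj ?L"
    using group_comodule.F3_obj_graded_module[OF U(1)] F3_obj_extensional[OF U(2)]
    by (simp add: graded_module_category_simps F3_simps)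
  show "FMor (F3 G A C) U U (Idm ?K U) = Idm ?L (FObj (F3 G A C) U)"
    unfolding F3_simps comodule_category_simps graded_module_category_simps total_simps F3_obj_sum dirsum_map_def
  proof (rule restrict_ext)
    fix x assume x: "x \<in> carrier U.dirsum"
    then have "x \<in> extensional (carrier G)" by (simp add: U.carrier_dirsum PiE_iff)
    then show "(\<lambda>i\<in>carrier G. (\<lambda>i\<in>carrier G. \<lambda>m\<in>carrier (mcomp U i). m) i (x i)) = x"
      using U.dirsum_comp[OF x] by (intro extensionalityI[of _ "carrier G"]) simp_all
  qed
  fix V :: "('g, 'a, 'c, 'm) comodule" assume "V \<in> Obj ?K"
  then have V: "group_comodule G A C V" by (simp add: comodule_category_simps)
  fix f assume "f \<in> Hom ?K U V"
  then have f: "f \<in> comodule_morphisms G A C U V" by (simp add: comodule_category_simps)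
  show "FMor (F3 G A C) U V f \<in> Hom ?L (FObj (F3 G A C) U) (FObj (F3 G A C) V)"
    using F3_morphism[OF U(1) V f] by (simp add: graded_module_category_simps F3_simps)
  have hc: "dirsum_map G (mcomp U) f x \<in> carrier (sum_group (carrier G) (mcomp V))" if "x \<in> carrier U.dirsum" for x
    using dirsum_map_hom[OF U.graded_group_axioms group_comodule.mcomp_graded_group[OF V]
        right_linear_hom[OF comodule_morphismD(2)[OF f]]] that by (auto simp: hom_def)
  fix W g
  show "FMor (F3 G A C) U W (Cmp ?K U V W g f)
      = Cmp ?L (FObj (F3 G A C) U) (FObj (F3 G A C) V) (FObj (F3 G A C) W) (FMor (F3 G A C) V W g) (FMor (F3 G A C) U V f)"
    unfolding F3_simps comodule_category_simps graded_module_category_simps total_simps F3_obj_sum compose_def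
  proof (rule extensionalityI[of _ "carrier U.dirsum"])
    fix x assume x: "x \<in> carrier U.dirsum"
    then show "dirsum_map G (mcomp U) (\<lambda>i\<in>carrier G. \<lambda>x\<in>carrier (mcomp U i). g i (f i x)) x
        = (\<lambda>x\<in>carrier U.dirsum. dirsum_map G (mcomp V) g (dirsum_map G (mcomp U) f x)) x"
      using hc[OF x] by (auto simp: dirsum_map_def U.dirsum_comp intro!: restrict_ext)
  qed (simp_all add: dirsum_map_def)
qed


section \<open>Comodules from graded modules\<close>

context group_coring
begin

text \<open>
  In degree \<open>i\<close>, the ring \<open>A\<close> acts through the scalars of the dual ring. The value outside the carriers
  is the one that the objects of the comodule category have there.
\<close>

definition module_comp :: "('g, 'g \<Rightarrow> 'c \<Rightarrow> 'a, 'm) gr_module \<Rightarrow> 'g \<Rightarrow> ('a, 'm) rmod"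
  where "module_comp N i =
    \<lparr>carrier = carrier (gcomp N i), monoid.mult = monoid.mult (gcomp N i), one = one (gcomp N i),
     ract = (\<lambda>m a. if m \<in> carrier (gcomp N i) \<and> a \<in> carrier A
       then homogeneous_action G (dual_comp G A C) N i \<one> m (scalar a) else undefined)\<rparr>"

text \<open>
  The coaction is prescribed by its slices; \<open>module_coact\<close> below shows that they determine it. The
  functional \<open>d\<close> on the component of degree \<open>j\<close> has degree \<open>j\<inverse>\<close> in the dual ring.
\<close>

definition module_coact :: "('g, 'g \<Rightarrow> 'c \<Rightarrow> 'a, 'm) gr_module \<Rightarrow> 'g \<Rightarrow> 'g \<Rightarrow> 'm \<Rightarrow> ('m \<times> 'c \<Rightarrow>\<^sub>0 int) set"
  where "module_coact N i j m =
    (THE t. t \<in> carrier (tensor A (module_comp N i) (ccomp C j)) \<and>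
      (\<forall>d\<in>carrier (dual A (ccomp C j)). slice A (module_comp N i) (ccomp C j) d t
        = homogeneous_action G (dual_comp G A C) N (i \<otimes> j) (inv j) m d))"

definition module_comodule :: "('g, 'g \<Rightarrow> 'c \<Rightarrow> 'a, 'm) gr_module \<Rightarrow> ('g, 'a, 'c, 'm) comodule"
  where "module_comodule N =
    \<lparr>mcomp = (\<lambda>i\<in>carrier G. module_comp N i),
     coact = (\<lambda>i j m. if i \<in> carrier G \<and> j \<in> carrier G \<and> m \<in> carrier (gcomp N (i \<otimes> j))
       then module_coact N i j m else undefined)\<rparr>"

lemma module_comp_simps [simp]:
  "carrier (module_comp N i) = carrier (gcomp N i)"
  "x \<otimes>\<^bsub>module_comp N i\<^esub> y = x \<otimes>\<^bsub>gcomp N i\<^esub> y"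
  "\<one>\<^bsub>module_comp N i\<^esub> = \<one>\<^bsub>gcomp N i\<^esub>"
  by (simp_all add: module_comp_def)

lemma module_comp_ract:
  "\<lbrakk>m \<in> carrier (gcomp N i); a \<in> carrier A\<rbrakk>
    \<Longrightarrow> ract (module_comp N i) m a = homogeneous_action G (dual_comp G A C) N i \<one> m (scalar a)"
  by (simp add: module_comp_def)

context
  fixes N :: "('g, 'g \<Rightarrow> 'c \<Rightarrow> 'a, 'm) gr_module"
  assumes N: "graded_module G (left_dual_ring G A C) (dual_comp G A C) N"
begin

abbreviation (input) "hact \<equiv> homogeneous_action G (dual_comp G A C) N"

interpretation P: graded_pairing G "gcomp N" "dual_comp G A C" hact
  by (rule dual.homogeneous_action_pairing[OF N[unfolded left_dual_ring_direct_sum]])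

lemmas hact_unit = dual.homogeneous_action_unit[OF N[unfolded left_dual_ring_direct_sum]]
  and hact_mult = dual.homogeneous_action_mul[OF N[unfolded left_dual_ring_direct_sum]]

lemma module_comp_right_module:
  assumes a: "i \<in> carrier G"
  shows "right_module A (module_comp N i)"
proof (intro right_module.intro right_module_axioms.intro A.ring_axioms)
  interpret Na: comm_group "gcomp N i" by (rule P.M.comm_group_comp[OF a])
  show "comm_group (module_comp N i)" by (rule comm_group_transfer[OF Na.comm_group_axioms]) simp_all
  note r = P.act_closed[OF a G.one_closed _ scalar_closed] P.act_add_left[OF a G.one_closed _ _ scalar_closed]
    P.act_add_right[OF a G.one_closed _ scalar_closed scalar_closed]
  fix m b assume m: "m \<in> carrier (module_comp N i)" and b: "b \<in> carrier A"
  then show c: "ract (module_comp N i) m b \<in> carrier (module_comp N i)"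
    using r a by (simp add: module_comp_ract)
  { fix n assume "n \<in> carrier (module_comp N i)"
    then show "ract (module_comp N i) (m \<otimes>\<^bsub>module_comp N i\<^esub> n) b
        = ract (module_comp N i) m b \<otimes>\<^bsub>module_comp N i\<^esub> ract (module_comp N i) n b"
      using m b r a by (simp add: module_comp_ract) }
  { fix d assume d: "d \<in> carrier A"
    show "ract (module_comp N i) m (b \<oplus>\<^bsub>A\<^esub> d)
        = ract (module_comp N i) m b \<otimes>\<^bsub>module_comp N i\<^esub> ract (module_comp N i) m d"
      using m b d r a by (simp add: module_comp_ract scalar_add)
    show "ract (module_comp N i) m (b \<otimes>\<^bsub>A\<^esub> d) = ract (module_comp N i) (ract (module_comp N i) m b) d"
      using hact_mult[OF a G.one_closed G.one_closed _ scalar_closed[OF b] scalar_closed[OF d], of m] m b d a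
        r(1)[of m b]
      by (simp add: module_comp_ract scalar_mult) }
next
  fix m assume "m \<in> carrier (module_comp N i)"
  then show "ract (module_comp N i) m \<one>\<^bsub>A\<^esub> = m"
    using a by (simp add: module_comp_ract scalar_one hact_unit)
qed

context
  assumes fin: "\<And>i. i \<in> carrier G \<Longrightarrow> \<exists>S f. dual_basis A (ccomp C i) S f"
begin

abbreviation (input) "Nr \<equiv> module_comp N"
abbreviation (input) "rho \<equiv> module_coact N"

text \<open>
  The hypothesis of \<open>functional_is_slice\<close> on right multiples is the module law for products
  \<open>d # \<epsilon>(-)b\<close>.
\<close>

lemma module_coact:
  assumes a: "i \<in> carrier G" "j \<in> carrier G" and m: "m \<in> carrier (gcomp N (i \<otimes> j))"
  shows "rho i j m \<in> carrier (tensor A (Nr i) (ccomp C j))"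
    and "d \<in> carrier (dual A (ccomp C j)) \<Longrightarrow>
      slice A (Nr i) (ccomp C j) d (rho i j m) = hact (i \<otimes> j) (inv j) m d"
proof -
  interpret T: tensor_product A "Nr i" "ccomp C j"
    by (intro tensor_productI module_comp_right_module self.comp_module a)
  obtain S f where basis: "dual_basis A (ccomp C j) S f" using fin[OF a(2)] by blast
  have ab: "i \<otimes> j \<in> carrier G" "inv j \<in> carrier G" "i \<otimes> j \<otimes> inv j = i"
    using a by (simp_all add: self.cancel_right)
  have "\<exists>!t. t \<in> carrier T.T \<and>
      (\<forall>d\<in>carrier (dual A (ccomp C j)). slice A (Nr i) (ccomp C j) d t = hact (i \<otimes> j) (inv j) m d)"
  proof (rule T.functional_is_slice[OF basis])
    show "hact (i \<otimes> j) (inv j) m \<in> hom (dual A (ccomp C j)) (Nr i)"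
      using P.act_closed[OF ab(1,2) m] P.act_add_right[OF ab(1,2) m] a
      by (simp add: hom_def dual_degree_inv ab(3))
    fix d b assume "d \<in> carrier (dual A (ccomp C j))" and b: "b \<in> carrier A"
    then have d: "d \<in> dual_degree (inv j)" using a by (simp add: dual_degree_inv)
    have "hact (i \<otimes> j) (inv j) m (\<lambda>c\<in>carrier (ccomp C j). d c \<otimes>\<^bsub>A\<^esub> b)
        = hact (i \<otimes> j) (inv j \<otimes> \<one>) m (dual_mult G A C (inv j) \<one> d (scalar b))"
      using a d b by (simp add: dual_mult_scalar_right)
    also have "\<dots> = hact i \<one> (hact (i \<otimes> j) (inv j) m d) (scalar b)"
      using hact_mult[OF ab(1,2) G.one_closed m d scalar_closed[OF b]] by (simp only: ab(3))
    also have "\<dots> = ract (Nr i) (hact (i \<otimes> j) (inv j) m d) b"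
      using P.act_closed[OF ab(1,2) m d] b by (simp add: ab(3) module_comp_ract)
    finally show "hact (i \<otimes> j) (inv j) m (\<lambda>c\<in>carrier (ccomp C j). d c \<otimes>\<^bsub>A\<^esub> b)
        = ract (Nr i) (hact (i \<otimes> j) (inv j) m d) b" .
  qed
  from theI'[OF this] show "rho i j m \<in> carrier T.T"
    and "d \<in> carrier (dual A (ccomp C j)) \<Longrightarrow>
      slice A (Nr i) (ccomp C j) d (rho i j m) = hact (i \<otimes> j) (inv j) m d"
    by (simp_all add: module_coact_def)
qed

text \<open>
  Compared by their slices. For the action of \<open>b\<close> this is the module law for \<open>\<epsilon>(-)b # d\<close>, which is
  \<open>c \<mapsto> d(c b)\<close>.
\<close>

lemma module_coact_right_linear:
  assumes a: "i \<in> carrier G" "j \<in> carrier G"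
  shows "rho i j \<in> right_linear A (Nr (i \<otimes> j)) (tensor_rmod A (Nr i) (ccomp C j))"
proof -
  interpret B: bimodule A "ccomp C j" by (rule ccomp_bimodule[OF a(2)])
  interpret T: tensor_product A "Nr i" "ccomp C j"
    by (intro tensor_productI module_comp_right_module self.comp_module a)
  interpret TR: right_module A "tensor_rmod A (Nr i) (ccomp C j)"
    by (intro tensor_rmod_right_module module_comp_right_module ccomp_bimodule a)
  obtain S f where basis: "dual_basis A (ccomp C j) S f" using fin[OF a(2)] by blast
  have ab: "i \<otimes> j \<in> carrier G" "inv j \<in> carrier G" "i \<otimes> j \<otimes> inv j = i"
    using a by (simp_all add: self.cancel_right)
  interpret Mab: right_module A "Nr (i \<otimes> j)" by (rule module_comp_right_module[OF ab(1)])
  note c = module_coact[OF a]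
  have rc: "ract (tensor_rmod A (Nr i) (ccomp C j)) t b \<in> carrier T.T"
    if "t \<in> carrier T.T" "b \<in> carrier A" for t b
    using TR.ract_closed[of t b] that by simp
  show ?thesis unfolding right_linear_iff module_comp_simps tensor_rmod_simps
  proof (intro conjI ballI)
    fix m assume m: "m \<in> carrier (gcomp N (i \<otimes> j))"
    show "rho i j m \<in> carrier T.T" by (rule c(1)[OF m])
    { fix n assume n: "n \<in> carrier (gcomp N (i \<otimes> j))"
      have mn: "m \<otimes>\<^bsub>gcomp N (i \<otimes> j)\<^esub> n \<in> carrier (gcomp N (i \<otimes> j))"
        using Mab.M.m_closed[of m n] m n by simp
      show "rho i j (m \<otimes>\<^bsub>gcomp N (i \<otimes> j)\<^esub> n) = rho i j m \<otimes>\<^bsub>T.T\<^esub> rho i j n"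
      proof (rule T.slices_separate[OF basis c(1)[OF mn] T.T.m_closed[OF c(1)[OF m] c(1)[OF n]]])
        fix d assume d: "d \<in> carrier (dual A (ccomp C j))"
        then have d': "d \<in> dual_degree (inv j)" using a by (simp add: dual_degree_inv)
        show "slice A (Nr i) (ccomp C j) d (rho i j (m \<otimes>\<^bsub>gcomp N (i \<otimes> j)\<^esub> n))
            = slice A (Nr i) (ccomp C j) d (rho i j m \<otimes>\<^bsub>T.T\<^esub> rho i j n)"
          using P.act_add_left[OF ab(1,2) m n d']
          by (simp add: T.slice_mult[OF dual_linear[OF d]] c[OF m] c[OF n] c[OF mn] d ab(3))
      qed }
    fix b assume b: "b \<in> carrier A"
    have mb: "ract (Nr (i \<otimes> j)) m b \<in> carrier (gcomp N (i \<otimes> j))"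
      using Mab.ract_closed[of m b] m b by simp
    show "rho i j (ract (Nr (i \<otimes> j)) m b)
        = ract (tensor_rmod A (Nr i) (ccomp C j)) (rho i j m) b"
    proof (rule T.slices_separate[OF basis c(1)[OF mb] rc[OF c(1)[OF m] b]])
      fix d assume d: "d \<in> carrier (dual A (ccomp C j))"
      then have d': "d \<in> dual_degree (inv j)" using a by (simp add: dual_degree_inv)
      let ?bd = "\<lambda>c\<in>carrier (ccomp C j). d (bract (ccomp C j) c b)"
      have bd: "?bd = dual_mult G A C \<one> (inv j) (scalar b) d"
        using dual_mult_scalar_left[OF ab(2) d' b] a by simp
      then have bd_dual: "?bd \<in> carrier (dual A (ccomp C j))"
        using dual_mult_closed[OF G.one_closed ab(2) scalar_closed[OF b] d'] a by (simp add: dual_degree_inv)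
      have "slice A (Nr i) (ccomp C j) d (rho i j (ract (Nr (i \<otimes> j)) m b))
          = hact (i \<otimes> j) (inv j) (hact (i \<otimes> j) \<one> m (scalar b)) d"
        unfolding c(2)[OF mb d] by (simp add: module_comp_ract m b)
      also have "\<dots> = hact (i \<otimes> j) (inv j) m ?bd"
        using hact_mult[OF ab(1) G.one_closed ab(2) m scalar_closed[OF b] d'] ab(1,2)
        by (simp only: G.r_one G.l_one bd)
      also have "\<dots> = slice A (Nr i) (ccomp C j) ?bd (rho i j m)"
        by (rule c(2)[OF m bd_dual, symmetric])
      also have "slice A (Nr i) (ccomp C j) ?bd
          = slice A (Nr i) (ccomp C j) (\<lambda>c. d (bract (ccomp C j) c b))"
        by (rule T.slice_cong) simp
      also have "\<dots> (rho i j m) = slice A (Nr i) (ccomp C j) d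
          (ract (tensor_rmod A (Nr i) (ccomp C j)) (rho i j m) b)"
        by (rule slice_tensor_rmod_ract[OF module_comp_right_module[OF a(1)] B.bimodule_axioms dual_linear[OF d]
              c(1)[OF m] b, symmetric])
      finally show "slice A (Nr i) (ccomp C j) d (rho i j (ract (Nr (i \<otimes> j)) m b))
          = slice A (Nr i) (ccomp C j) d
              (ract (tensor_rmod A (Nr i) (ccomp C j)) (rho i j m) b)" .
    qed
  qed
qed

text \<open>
  Sliced by a functional \<open>e\<close> on the last tensor factor and \<open>d\<close> on the middle one, the left side becomes \<open>m \<cdot> (e # d)\<close> and the right side
  \<open>(m \<cdot> e) \<cdot> d\<close>.
\<close>

lemma module_coact_coassoc:
  assumes a: "i \<in> carrier G" "j \<in> carrier G" "k \<in> carrier G" and m: "m \<in> carrier (gcomp N (i \<otimes> j \<otimes> k))"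
  shows "tensor_map A (Nr i) (ccomp C (j \<otimes> k)) (Nr i) (tensor_bimod A (ccomp C j) (ccomp C k))
        (\<lambda>m. m) (comult C j k) (rho i (j \<otimes> k) m)
      = associator A (Nr i) (ccomp C j) (ccomp C k)
          (tensor_map A (Nr (i \<otimes> j)) (ccomp C k) (tensor_rmod A (Nr i) (ccomp C j)) (ccomp C k)
            (rho i j) (\<lambda>c. c) (rho (i \<otimes> j) k m))"
    (is "?l = ?r")
proof -
  let ?Q = "Nr i" and ?P = "Nr (i \<otimes> j)" and ?B = "ccomp C j" and ?B' = "ccomp C k"
  have g: "i \<otimes> j \<in> carrier G" "j \<otimes> k \<in> carrier G" "i \<otimes> j \<otimes> k \<in> carrier G" "inv j \<in> carrier G" "inv k \<in> carrier G"
    and deg: "i \<otimes> (j \<otimes> k) = i \<otimes> j \<otimes> k" "inv (j \<otimes> k) = inv k \<otimes> inv j" "i \<otimes> j \<otimes> k \<otimes> inv k = i \<otimes> j"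
    using a by (simp_all add: G.inv_mult_group self.cancel_right, simp add: G.m_assoc)
  have Q: "right_module A ?Q" "right_module A ?P" using a by (simp_all add: module_comp_right_module)
  have B: "bimodule A ?B" "bimodule A ?B'" "left_module A ?B'" using a by (simp_all add: ccomp_bimodule self.comp_module)
  have BB: "left_module A (tensor_bimod A ?B ?B')" by (rule tensor_bimod_left_module[OF B(1,2)])
  have QB: "right_module A (tensor_rmod A ?Q ?B)" by (rule tensor_rmod_right_module[OF Q(1) B(1)])
  have m': "m \<in> carrier (gcomp N (i \<otimes> (j \<otimes> k)))" using m by (simp add: deg)
  note t = module_coact(1)[OF a(1) g(2) m'] and t' = module_coact(1)[OF g(1) a(3) m]
  note r = module_coact_right_linear[OF a(1,2)]
  have D: "comult C j k \<in> left_linear A (ccomp C (j \<otimes> k)) (tensor_bimod A ?B ?B')"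
    by (rule self.comult_left_linear[OF a(2,3)])
  have C': "left_module A (ccomp C (j \<otimes> k))" by (rule self.comp_module[OF g(2)])
  interpret T: tensor_product A ?Q "ccomp C (j \<otimes> k)" by (rule tensor_productI[OF Q(1) C'])
  obtain S f S' f' where basis: "dual_basis A ?B S f" "dual_basis A ?B' S' f'"
    using fin[OF a(2)] fin[OF a(3)] by blast
  show ?thesis
  proof (rule iterated_slices_separate[OF Q(1) B(1,2) basis])
    show "?l \<in> carrier (tensor A ?Q (tensor_bimod A ?B ?B'))"
      by (rule tensor_map_closed[OF T.tensor_product_axioms tensor_productI[OF Q(1) BB] right_linear_id D t])
    have "tensor_map A ?P ?B' (tensor_rmod A ?Q ?B) ?B' (rho i j) (\<lambda>c. c) (rho (i \<otimes> j) k m)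
        \<in> carrier (tensor A (tensor_rmod A ?Q ?B) ?B')"
      by (rule tensor_map_closed[OF tensor_productI[OF Q(2) B(3)] tensor_productI[OF QB B(3)] r left_linear_id t'])
    then show "?r \<in> carrier (tensor A ?Q (tensor_bimod A ?B ?B'))"
      using associator_hom[OF Q(1) B(1,2)] by (auto simp: hom_def)
    fix d e assume d: "d \<in> carrier (dual A ?B)" and e: "e \<in> carrier (dual A ?B')"
    then have d': "d \<in> dual_degree (inv j)" and e': "e \<in> dual_degree (inv k)" using a by (simp_all add: dual_degree_inv)
    let ?phi = "\<lambda>x. d (slice A (right_of ?B) ?B' e x)"
    have phi: "?phi \<in> left_linear A (tensor_bimod A ?B ?B') (regular A)"
      by (rule left_linear_comp[OF slice_left_linear[OF B(1,2) dual_linear[OF e]] dual_linear[OF d]])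
    have ed: "dual_mult G A C (inv k) (inv j) e d \<in> carrier (dual A (ccomp C (j \<otimes> k)))"
      using dual_mult_closed[OF g(5,4) e' d'] g(2) by (simp add: dual_degree_inv flip: deg(2))
    have "slice A ?Q (tensor_bimod A ?B ?B') ?phi ?l
        = slice A ?Q (ccomp C (j \<otimes> k)) (\<lambda>c. ?phi (comult C j k c)) (rho i (j \<otimes> k) m)"
      by (rule slice_tensor_map_right[OF Q(1) C' BB D phi t])
    also have "slice A ?Q (ccomp C (j \<otimes> k)) (\<lambda>c. ?phi (comult C j k c))
        = slice A ?Q (ccomp C (j \<otimes> k)) (dual_mult G A C (inv k) (inv j) e d)"
    proof (rule T.slice_cong)
      have "inv (inv k \<otimes> inv j) = j \<otimes> k" using a by (simp add: G.inv_mult_group)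
      then show "?phi (comult C j k c) = dual_mult G A C (inv k) (inv j) e d c"
        if "c \<in> carrier (ccomp C (j \<otimes> k))" for c
        using that a by (simp add: dual_mult_def slice_def tensor_lift_right_of Let_def)
    qed
    also have "\<dots> (rho i (j \<otimes> k) m)
        = hact (i \<otimes> j \<otimes> k) (inv k \<otimes> inv j) m (dual_mult G A C (inv k) (inv j) e d)"
      using module_coact(2)[OF a(1) g(2) m' ed] by (simp add: deg)
    also have "\<dots> = hact (i \<otimes> j) (inv j) (hact (i \<otimes> j \<otimes> k) (inv k) m e) d"
      using hact_mult[OF g(3,5,4) m e' d'] by (simp only: deg)
    also have "\<dots> = slice A ?Q ?B d (rho i j (slice A ?P ?B' e (rho (i \<otimes> j) k m)))"
      using P.act_closed[OF g(3,5) m e'] by (simp add: module_coact(2)[OF g(1) a(3) m e] module_coact(2)[OF a(1,2) _ d] deg)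
    also have "\<dots> = slice A ?Q (tensor_bimod A ?B ?B') ?phi ?r"
      by (rule slice_associator_tensor_map[OF Q B(1,2) dual_linear[OF e] dual_linear[OF d] r t', symmetric])
    finally show "slice A ?Q (tensor_bimod A ?B ?B') ?phi ?l = slice A ?Q (tensor_bimod A ?B ?B') ?phi ?r" .
  qed
qed

lemma module_coact_counit:
  assumes a: "i \<in> carrier G" and m: "m \<in> carrier (gcomp N i)"
  shows "right_unitor A (Nr i)
    (tensor_map A (Nr i) (ccomp C \<one>) (Nr i) (regular A) (\<lambda>m. m) (counit C) (rho i \<one> m)) = m"
proof -
  interpret T: tensor_product A "Nr i" "ccomp C \<one>"
    by (intro tensor_productI module_comp_right_module self.comp_module a G.one_closed)
  have m': "m \<in> carrier (gcomp N (i \<otimes> \<one>))" using m a by simp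
  have "right_unitor A (Nr i)
      (tensor_map A (Nr i) (ccomp C \<one>) (Nr i) (regular A) (\<lambda>m. m) (counit C) (rho i \<one> m))
      = slice A (Nr i) (ccomp C \<one>) (counit C) (rho i \<one> m)"
    by (rule right_unitor_tensor_map[OF T.M.right_module_axioms T.N.left_module_axioms self.counit_left_linear
          module_coact(1)[OF a G.one_closed m']])
  also have "slice A (Nr i) (ccomp C \<one>) (counit C)
      = slice A (Nr i) (ccomp C \<one>) (restrict (counit C) (carrier (ccomp C \<one>)))"
    by (rule T.slice_cong) simp
  also have "\<dots> (rho i \<one> m) = hact i \<one> m (restrict (counit C) (carrier (ccomp C \<one>)))"
    using module_coact(2)[OF a G.one_closed m', of "restrict (counit C) (carrier (ccomp C \<one>))"] counit_closed a
      dual_degree_inv[OF G.one_closed] by simp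
  also have "\<dots> = m" by (rule hact_unit[OF a m])
  finally show ?thesis .
qed

lemma module_comodule_simps:
  "i \<in> carrier G \<Longrightarrow> mcomp (module_comodule N) i = module_comp N i"
  "\<lbrakk>i \<in> carrier G; j \<in> carrier G; m \<in> carrier (gcomp N (i \<otimes> j))\<rbrakk>
    \<Longrightarrow> coact (module_comodule N) i j m = module_coact N i j m"
  by (simp_all add: module_comodule_def)

lemma module_comodule: "group_comodule G A C (module_comodule N)"
proof (intro group_comodule.intro group_comodule_axioms.intro group_coring_axioms)
  fix i assume a: "i \<in> carrier G"
  show "right_module A (mcomp (module_comodule N) i)" by (simp add: module_comodule_simps a module_comp_right_module)
  { fix m assume m: "m \<in> carrier (mcomp (module_comodule N) i)"
    then show "right_unitor A (mcomp (module_comodule N) i)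
        (tensor_map A (mcomp (module_comodule N) i) (ccomp C \<one>) (mcomp (module_comodule N) i) (regular A)
          (\<lambda>m. m) (counit C) (coact (module_comodule N) i \<one> m)) = m"
      using module_coact_counit[OF a] a by (simp add: module_comodule_simps) }
  fix j assume b: "j \<in> carrier G"
  have lin: "coact (module_comodule N) i j \<in> right_linear A (module_comp N (i \<otimes> j)) (tensor_rmod A (module_comp N i) (ccomp C j))"
  proof -
    interpret Mab: right_module A "module_comp N (i \<otimes> j)" using a b by (simp add: module_comp_right_module)
    show ?thesis using module_coact_right_linear[OF a b] Mab.ract_closed Mab.M.m_closed
      by (simp add: right_linear_iff module_comodule_simps a b)
  qed
  then show "coact (module_comodule N) i j
      \<in> right_linear A (mcomp (module_comodule N) (i \<otimes> j)) (tensor_rmod A (mcomp (module_comodule N) i) (ccomp C j))"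
    using a b by (simp add: module_comodule_simps)
  fix k m assume c: "k \<in> carrier G" and "m \<in> carrier (mcomp (module_comodule N) (i \<otimes> j \<otimes> k))"
  then have m: "m \<in> carrier (gcomp N (i \<otimes> j \<otimes> k))" "m \<in> carrier (gcomp N (i \<otimes> (j \<otimes> k)))"
    using a b by (simp_all add: module_comodule_simps G.m_assoc)
  have g: "i \<otimes> j \<in> carrier G" "j \<otimes> k \<in> carrier G" using a b c by simp_all
  have "tensor_lift A (module_comp N (i \<otimes> j)) (ccomp C k) (tensor A (tensor_rmod A (module_comp N i) (ccomp C j)) (ccomp C k))
        (\<lambda>m n. pure_tensor A (tensor_rmod A (module_comp N i) (ccomp C j)) (ccomp C k) (coact (module_comodule N) i j m) n)
      = tensor_lift A (module_comp N (i \<otimes> j)) (ccomp C k) (tensor A (tensor_rmod A (module_comp N i) (ccomp C j)) (ccomp C k))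
        (\<lambda>m n. pure_tensor A (tensor_rmod A (module_comp N i) (ccomp C j)) (ccomp C k) (module_coact N i j m) n)"
    by (rule tensor_product.tensor_lift_cong[OF tensor_productI[OF module_comp_right_module[OF g(1)] self.comp_module[OF c]]])
      (simp add: module_comodule_simps a b)
  then show "tensor_map A (mcomp (module_comodule N) i) (ccomp C (j \<otimes> k)) (mcomp (module_comodule N) i)
        (tensor_bimod A (ccomp C j) (ccomp C k)) (\<lambda>m. m) (comult C j k) (coact (module_comodule N) i (j \<otimes> k) m)
      = associator A (mcomp (module_comodule N) i) (ccomp C j) (ccomp C k)
          (tensor_map A (mcomp (module_comodule N) (i \<otimes> j)) (ccomp C k)
            (tensor_rmod A (mcomp (module_comodule N) i) (ccomp C j)) (ccomp C k)
            (coact (module_comodule N) i j) (\<lambda>c. c) (coact (module_comodule N) (i \<otimes> j) k m))"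
    using module_coact_coassoc[OF a b c m(1)] a b c g m
    by (simp only: module_comodule_simps tensor_map_def)
qed

lemma module_comodule_extensional:
  assumes "extensional_gr_module G (left_dual_ring G A C) N"
  shows "extensional_comodule G A (module_comodule N)"
  using assms
  by (auto simp: extensional_comodule_def extensional_gr_module_def module_comodule_def module_comp_def
      extensional_monoid_def)

lemma F3_module_comodule:
  assumes extN: "extensional_gr_module G (left_dual_ring G A C) N"
  shows "F3_obj G A C (module_comodule N) = N"
proof -
  let ?M = "module_comodule N"
  interpret M: group_comodule G A C ?M by (rule module_comodule)
  interpret MP: graded_pairing G "mcomp ?M" "dual_comp G A C" "dual_action G A C ?M" by (rule M.action_pairing)
  note [simp del] = mult_sum_group
  have comp: "carrier (mcomp ?M i) = carrier (gcomp N i)" "x \<otimes>\<^bsub>mcomp ?M i\<^esub> y = x \<otimes>\<^bsub>gcomp N i\<^esub> y"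
    "\<one>\<^bsub>mcomp ?M i\<^esub> = \<one>\<^bsub>gcomp N i\<^esub>" if "i \<in> carrier G" for i x y
    using that by (simp_all add: module_comodule_simps)
  have sums: "MP.M.dirsum = P.M.dirsum" by (rule sum_group_cong) (simp_all add: comp)
  have singles: "single G (mcomp ?M) i m = single G (gcomp N) i m" for i m
    unfolding single_def by (rule restrict_ext) (simp add: comp)
  have act: "dual_action G A C ?M i j m d = hact i j m d"
    if a: "i \<in> carrier G" "j \<in> carrier G" and m: "m \<in> carrier (gcomp N i)" and d: "d \<in> dual_degree j" for i j m d
  proof -
    have ab: "i \<otimes> j \<in> carrier G" "inv j \<in> carrier G" "i \<otimes> j \<otimes> inv j = i"
      using a by (simp_all add: self.cancel_right)
    have m': "m \<in> carrier (gcomp N (i \<otimes> j \<otimes> inv j))" using m by (simp add: ab(3))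
    show ?thesis
      using module_coact(2)[OF ab(1,2) m', of d] d a
      by (simp add: dual_action_slice module_comodule_simps ab m m' dual_comp_dual)
  qed
  have "gact (F3_obj G A C ?M) x r = gact N x r" for x r
  proof (cases "x \<in> carrier P.M.dirsum \<and> r \<in> carrier (sum_group (carrier G) (dual_comp G A C))")
    case True
    have N': "graded_module G dual.direct_sum_ring (dual_comp G A C) N"
      using N by (simp add: left_dual_ring_direct_sum)
    have "gact N x r = conv G (mcomp ?M) (dual_action G A C ?M) x r"
      using True
      by (intro MP.biadditive_eq_conv[where b = "gact N"])
        (simp_all add: sums singles comp act dual.homogeneous_action[OF N'] dual.gact_closed[OF N']
          dual.gact_add_left[OF N'] dual.gact_add_right[OF N'])
    then show ?thesis using True by (simp add: F3_obj_gact sums)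
  next
    case False
    have "gact N x r = undefined"
      using extN False by (auto simp: extensional_gr_module_def total_simps left_dual_ring_carrier)
    moreover have "gact (F3_obj G A C ?M) x r = undefined"
      using F3_obj_extensional[OF module_comodule_extensional[OF extN]] False
      by (auto simp: extensional_gr_module_def total_simps left_dual_ring_carrier F3_obj_sum sums)
    ultimately show ?thesis by simp
  qed
  moreover have "gcomp (F3_obj G A C ?M) = gcomp N"
  proof (rule extensionalityI[of _ "carrier G"])
    show "gcomp (F3_obj G A C ?M) \<in> extensional (carrier G)" by (simp add: F3_obj_def)
    show "gcomp N \<in> extensional (carrier G)" using extN by (simp add: extensional_gr_module_def)
    fix i assume a: "i \<in> carrier G"
    have "monoid.mult (gcomp (F3_obj G A C ?M) i) = monoid.mult (gcomp N i)"
      by (intro ext) (simp only: F3_obj_gcomp[OF a] comp[OF a])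
    then show "gcomp (F3_obj G A C ?M) i = gcomp N i"
      using a by (intro monoid.equality) (simp_all add: F3_obj_gcomp comp)
  qed
  ultimately show ?thesis by (intro gr_module.equality ext) simp_all
qed

end

end

end

section \<open>The isomorphism of categories\<close>

text \<open>
  The inverse is given by the inverse bijections; it is functorial because the functor is injective on
  morphisms.
\<close>

lemma isomorphism_of_categoriesI:
  assumes F: "cat_functor K L F"
    and obj: "bij_betw (FObj F) (Obj K) (Obj L)"
    and mor: "\<And>U V. \<lbrakk>U \<in> Obj K; V \<in> Obj K\<rbrakk>
      \<Longrightarrow> bij_betw (FMor F U V) (Hom K U V) (Hom L (FObj F U) (FObj F V))"
  shows "isomorphism_of_categories K L F"
proof -
  interpret F: cat_functor K L F by fact
  define e where "e = inv_into (Obj K) (FObj F)"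
  define E where "E = \<lparr>FObj = e, FMor = (\<lambda>U V. inv_into (Hom K (e U) (e V)) (FMor F (e U) (e V)))\<rparr>"
  have E: "FObj E = e" "FMor E U V = inv_into (Hom K (e U) (e V)) (FMor F (e U) (e V))" for U V
    by (simp_all add: E_def)
  have e: "e U \<in> Obj K" "FObj F (e U) = U" if "U \<in> Obj L" for U
    using that obj bij_betw_inv_into_right[OF obj] bij_betwE[OF bij_betw_inv_into[OF obj]] by (auto simp: e_def)
  have eF: "e (FObj F U) = U" if "U \<in> Obj K" for U
    using that bij_betw_inv_into_left[OF obj] by (auto simp: e_def)
  have m: "FMor E U V f \<in> Hom K (e U) (e V)" "FMor F (e U) (e V) (FMor E U V f) = f"
    if "U \<in> Obj L" "V \<in> Obj L" "f \<in> Hom L U V" for U V f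
    using that e mor[of "e U" "e V"]
      bij_betw_inv_into_right[OF mor[of "e U" "e V"]] bij_betwE[OF bij_betw_inv_into[OF mor[of "e U" "e V"]]]
    by (auto simp: E)
  have inj: "f = g" if "U \<in> Obj L" "V \<in> Obj L" "f \<in> Hom K (e U) (e V)" "g \<in> Hom K (e U) (e V)"
    "FMor F (e U) (e V) f = FMor F (e U) (e V) g" for U V f g
    using that e mor[of "e U" "e V"] by (auto simp: bij_betw_def dest: inj_onD)
  have "cat_functor L K E"
  proof (intro cat_functor.intro F.L.category_axioms F.K.category_axioms cat_functor_axioms.intro)
    fix U assume U: "U \<in> Obj L"
    show "FObj E U \<in> Obj K" using e U by (simp add: E(1))
    show "FMor E U U (Idm L U) = Idm K (FObj E U)"
      using m[OF U U F.L.Idm_in[OF U]] F.FMor_Idm[OF e(1)[OF U]] e[OF U] F.K.Idm_in[OF e(1)[OF U]]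
      by (intro inj[OF U U]) (simp_all add: E(1))
    fix V f assume V: "V \<in> Obj L" and f: "f \<in> Hom L U V"
    show "FMor E U V f \<in> Hom K (FObj E U) (FObj E V)" using m(1)[OF U V f] by (simp add: E(1))
    fix W g assume W: "W \<in> Obj L" and g: "g \<in> Hom L V W"
    have gf: "Cmp L U V W g f \<in> Hom L U W" using F.L.Cmp_in U V W f g by blast
    show "FMor E U W (Cmp L U V W g f)
        = Cmp K (FObj E U) (FObj E V) (FObj E W) (FMor E V W g) (FMor E U V f)"
      using m[OF U W gf] m[OF U V f] m[OF V W g] e[OF U] e[OF V] e[OF W]
        F.FMor_Cmp[OF e(1)[OF U] e(1)[OF V] e(1)[OF W] m(1)[OF U V f] m(1)[OF V W g]]
        F.K.Cmp_in[OF e(1)[OF U] e(1)[OF V] e(1)[OF W] m(1)[OF U V f] m(1)[OF V W g]]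
      by (intro inj[OF U W]) (simp_all add: E(1))
  qed
  moreover have "left_inverse_functor K F E"
    unfolding left_inverse_functor_def
    using eF bij_betw_inv_into_left[OF mor] by (auto simp: E)
  moreover have "left_inverse_functor L E F"
    unfolding left_inverse_functor_def using e m(2) by (auto simp: E(1))
  ultimately show ?thesis unfolding isomorphism_of_categories_def using F by blast
qed

lemma F3_morphism_single:
  assumes M: "group_comodule G A C M" and N: "group_comodule G A C N"
    and f: "f \<in> comodule_morphisms G A C M N" and "i \<in> carrier G" "m \<in> carrier (mcomp M i)"
  shows "dirsum_map G (mcomp M) f (single G (mcomp M) i m) = single G (mcomp N) i (f i m)"
  using assms(4,5) by (intro dirsum_map_single group_comodule.mcomp_graded_group[OF M]
      group_comodule.mcomp_graded_group[OF N] right_linear_hom[OF comodule_morphismD(2)[OF f]])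

lemma F3_faithful:
  assumes M: "group_comodule G A C M" and N: "group_comodule G A C N"
  shows "inj_on (dirsum_map G (mcomp M)) (comodule_morphisms G A C M N)"
proof (rule inj_onI)
  fix f g assume f: "f \<in> comodule_morphisms G A C M N" and g: "g \<in> comodule_morphisms G A C M N"
    and eq: "dirsum_map G (mcomp M) f = dirsum_map G (mcomp M) g"
  interpret N: graded_group G "mcomp N" by (rule group_comodule.mcomp_graded_group[OF N])
  have "f i = g i" if a: "i \<in> carrier G" for i
  proof (rule extensionalityI[OF comodule_morphismD(3)[OF f a] comodule_morphismD(3)[OF g a]])
    fix m assume m: "m \<in> carrier (mcomp M i)"
    show "f i m = g i m"
      using F3_morphism_single[OF M N f a m] F3_morphism_single[OF M N g a m] eq
      by (intro N.single_inject[OF a]) simp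
  qed
  then show "f = g"
    by (rule extensionalityI[OF comodule_morphismD(1)[OF f] comodule_morphismD(1)[OF g]])
qed

text \<open>
  A graded linear map restricts to maps \<open>f\<^sub>i\<close> of the components. They are \<open>A\<close>-linear because \<open>A\<close> acts
  through scalars of the dual ring, and they respect the coactions because they respect all slices.
\<close>

lemma F3_full:
  assumes M: "group_comodule G A C M" and N: "group_comodule G A C N"
    and fin: "\<And>i. i \<in> carrier G \<Longrightarrow> \<exists>S f. dual_basis A (ccomp C i) S f"
    and h: "h \<in> graded_morphisms G (left_dual_ring G A C) (F3_obj G A C M) (F3_obj G A C N)"
  shows "h \<in> dirsum_map G (mcomp M) ` comodule_morphisms G A C M N"
proof -
  interpret M: group_comodule G A C M by fact
  interpret N: group_comodule G A C N by fact
  interpret MP: graded_pairing G "mcomp M" "dual_comp G A C" "dual_action G A C M" by (rule M.action_pairing)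
  interpret NP: graded_pairing G "mcomp N" "dual_comp G A C" "dual_action G A C N" by (rule N.action_pairing)
  note [simp del] = mult_sum_group
  have hl: "h \<in> right_linear (left_dual_ring G A C) (total G (F3_obj G A C M)) (total G (F3_obj G A C N))"
    and he: "h \<in> extensional (carrier MP.M.dirsum)"
    and hh: "\<And>i x. \<lbrakk>i \<in> carrier G; x \<in> homogeneous G (mcomp M) i\<rbrakk> \<Longrightarrow> h x \<in> homogeneous G (mcomp N) i"
    using h by (auto simp: graded_morphisms_def F3_obj_homogeneous total_simps F3_obj_sum)
  have hc: "h x \<in> carrier NP.M.dirsum" if "x \<in> carrier MP.M.dirsum" for x
    using hl that by (simp add: right_linear_iff total_simps F3_obj_sum)
  have hhom: "h \<in> hom MP.M.dirsum NP.M.dirsum"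
    using hl by (simp add: right_linear_iff total_simps F3_obj_sum hom_def)
  have hact: "h (conv G (mcomp M) (dual_action G A C M) x r) = conv G (mcomp N) (dual_action G A C N) (h x) r"
    if "x \<in> carrier MP.M.dirsum" "r \<in> carrier (sum_group (carrier G) (dual_comp G A C))" for x r
    using hl that hc[OF that(1)]
    by (simp add: right_linear_iff total_simps F3_obj_sum F3_obj_gact left_dual_ring_carrier)
  define f where "f = (\<lambda>i\<in>carrier G. \<lambda>m\<in>carrier (mcomp M i). h (single G (mcomp M) i m) i)"
  have f: "h (single G (mcomp M) i m) = single G (mcomp N) i (f i m)" "f i m \<in> carrier (mcomp N i)"
    if a: "i \<in> carrier G" and m: "m \<in> carrier (mcomp M i)" for i m
  proof -
    have "h (single G (mcomp M) i m) \<in> homogeneous G (mcomp N) i" using a m by (intro hh) simp_all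
    then obtain n where "n \<in> carrier (mcomp N i)" "h (single G (mcomp M) i m) = single G (mcomp N) i n"
      using a by (auto simp: NP.M.homogeneous_iff)
    then show "h (single G (mcomp M) i m) = single G (mcomp N) i (f i m)" "f i m \<in> carrier (mcomp N i)"
      using a m by (simp_all add: f_def)
  qed
  have fadd: "f i (m \<otimes>\<^bsub>mcomp M i\<^esub> n) = f i m \<otimes>\<^bsub>mcomp N i\<^esub> f i n"
    if a: "i \<in> carrier G" and m: "m \<in> carrier (mcomp M i)" "n \<in> carrier (mcomp M i)" for i m n
  proof -
    have "m \<otimes>\<^bsub>mcomp M i\<^esub> n \<in> carrier (mcomp M i)" using a m by (intro monoid.m_closed[OF MP.M.monoid_comp])
    then show ?thesis
      using a m f by (intro NP.M.single_inject[OF a])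
        (simp add: NP.M.single_mult MP.M.single_mult hom_mult[OF hhom] flip: f(1))
  qed
  have fact: "f (i \<otimes>\<^bsub>G\<^esub> j) (dual_action G A C M i j m d) = dual_action G A C N i j (f i m) d"
    if a: "i \<in> carrier G" "j \<in> carrier G" and m: "m \<in> carrier (mcomp M i)"
      and d: "d \<in> carrier (dual_comp G A C j)" for i j m d
  proof (rule NP.M.single_inject[of "i \<otimes>\<^bsub>G\<^esub> j"])
    show "i \<otimes>\<^bsub>G\<^esub> j \<in> carrier G" using a by simp
    show "single G (mcomp N) (i \<otimes>\<^bsub>G\<^esub> j) (f (i \<otimes>\<^bsub>G\<^esub> j) (dual_action G A C M i j m d))
        = single G (mcomp N) (i \<otimes>\<^bsub>G\<^esub> j) (dual_action G A C N i j (f i m) d)"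
      using hact[of "single G (mcomp M) i m" "single G (dual_comp G A C) j d"] a m d f MP.act_closed
      by (simp add: MP.conv_single NP.conv_single)
  qed
  note scalar = M.scalar_closed
  have fl: "f i \<in> right_linear A (mcomp M i) (mcomp N i)" if a: "i \<in> carrier G" for i
    unfolding right_linear_iff
  proof (intro conjI ballI fadd f(2) a)
    fix m b assume m: "m \<in> carrier (mcomp M i)" and b: "b \<in> carrier A"
    show "f i (ract (mcomp M i) m b) = ract (mcomp N i) (f i m) b"
      using fact[OF a M.G.one_closed m scalar[OF b]] a
      by (simp only: M.action_scalar[OF a m b] N.action_scalar[OF a f(2)[OF a m] b] M.G.r_one)
  qed
  have fm: "f \<in> comodule_morphisms G A C M N"
    unfolding comodule_morphisms_iff
  proof (intro conjI ballI fl)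
    show "f \<in> extensional (carrier G)" by (simp add: f_def)
    fix i assume a: "i \<in> carrier G"
    show "f i \<in> extensional (carrier (mcomp M i))" using a by (simp add: f_def)
    fix j m assume b: "j \<in> carrier G" and m: "m \<in> carrier (mcomp M (i \<otimes>\<^bsub>G\<^esub> j))"
    interpret T: tensor_product A "mcomp N i" "ccomp C j" by (rule N.tensor_comp[OF a b])
    have ab: "i \<otimes>\<^bsub>G\<^esub> j \<in> carrier G" using a b by simp
    obtain S p where basis: "dual_basis A (ccomp C j) S p" using fin b by blast
    show "tensor_map A (mcomp M i) (ccomp C j) (mcomp N i) (ccomp C j) (f i) (\<lambda>c. c) (coact M i j m)
        = coact N i j (f (i \<otimes>\<^bsub>G\<^esub> j) m)"
    proof (rule T.slices_separate[OF basis])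
      show "tensor_map A (mcomp M i) (ccomp C j) (mcomp N i) (ccomp C j) (f i) (\<lambda>c. c) (coact M i j m) \<in> carrier T.T"
        by (rule tensor_map_closed[OF M.tensor_comp[OF a b] N.tensor_comp[OF a b] fl[OF a] left_linear_id
              M.coact_facts(1)[OF a b m]])
      show "coact N i j (f (i \<otimes>\<^bsub>G\<^esub> j) m) \<in> carrier T.T"
        by (rule N.coact_facts(1)[OF a b f(2)[OF ab m]])
      fix d assume d: "d \<in> carrier (dual A (ccomp C j))"
      show "slice A (mcomp N i) (ccomp C j) d
            (tensor_map A (mcomp M i) (ccomp C j) (mcomp N i) (ccomp C j) (f i) (\<lambda>c. c) (coact M i j m))
          = slice A (mcomp N i) (ccomp C j) d (coact N i j (f (i \<otimes>\<^bsub>G\<^esub> j) m))"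
        using fact[OF ab, of "inv\<^bsub>G\<^esub> j" m d] a b m d
        by (simp add: slice_tensor_map_left[OF M.mcomp_module[OF a] N.mcomp_module[OF a] M.comp_module[OF b]
              fl[OF a] dual_linear[OF d] M.coact_facts(1)[OF a b m]] M.slice_coact N.slice_coact
            M.dual_degree_inv M.cancel_right)
    qed
  qed
  have "h = dirsum_map G (mcomp M) f"
  proof (rule extensionalityI[OF he])
    show "dirsum_map G (mcomp M) f \<in> extensional (carrier MP.M.dirsum)" by (simp add: dirsum_map_def)
    fix x assume x: "x \<in> carrier MP.M.dirsum"
    have "dirsum_map G (mcomp M) f \<in> hom MP.M.dirsum NP.M.dirsum"
      by (intro dirsum_map_hom M.mcomp_graded_group N.mcomp_graded_group right_linear_hom[OF fl])
    then show "h x = dirsum_map G (mcomp M) f x"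
      by (rule MP.M.dirsum_hom_eqI[OF hhom _ x]) (simp add: f F3_morphism_single[OF M N fm])
  qed
  then show ?thesis using fm by blast
qed

text \<open>
  The graded module remembers the action of every homogeneous functional, therefore the action of \<open>A\<close>
  and all slices of the coaction. Outside the carriers both comodules have the same default value.
\<close>

lemma F3_obj_inj:
  assumes M: "group_comodule G A C M" "extensional_comodule G A M"
    and N: "group_comodule G A C N" "extensional_comodule G A N"
    and fin: "\<And>i. i \<in> carrier G \<Longrightarrow> \<exists>S f. dual_basis A (ccomp C i) S f"
    and eq: "F3_obj G A C M = F3_obj G A C N"
  shows "M = N"
proof -
  interpret M: group_comodule G A C M by fact
  interpret N: group_comodule G A C N by fact
  interpret MP: graded_pairing G "mcomp M" "dual_comp G A C" "dual_action G A C M" by (rule M.action_pairing)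
  interpret NP: graded_pairing G "mcomp N" "dual_comp G A C" "dual_action G A C N" by (rule N.action_pairing)
  have car: "carrier (mcomp M i) = carrier (mcomp N i)" and mul: "x \<otimes>\<^bsub>mcomp M i\<^esub> y = x \<otimes>\<^bsub>mcomp N i\<^esub> y"
    and one: "\<one>\<^bsub>mcomp M i\<^esub> = \<one>\<^bsub>mcomp N i\<^esub>" if "i \<in> carrier G" for i x y
    using F3_obj_gcomp[OF that, of A C M] F3_obj_gcomp[OF that, of A C N] by (simp_all add: eq)
  have sums: "MP.M.dirsum = NP.M.dirsum" by (rule sum_group_cong) (simp_all add: car mul one)
  have singles: "single G (mcomp M) i m = single G (mcomp N) i m" for i m
    unfolding single_def by (rule restrict_ext) (simp add: one)
  have act: "dual_action G A C M i j m d = dual_action G A C N i j m d"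
    if a: "i \<in> carrier G" "j \<in> carrier G" and m: "m \<in> carrier (mcomp M i)" and d: "d \<in> carrier (dual_comp G A C j)"
    for i j m d
  proof (rule NP.M.single_inject[of "i \<otimes>\<^bsub>G\<^esub> j"])
    have mN: "m \<in> carrier (mcomp N i)" using m car a by simp
    have "single G (mcomp M) (i \<otimes>\<^bsub>G\<^esub> j) (dual_action G A C M i j m d)
        = gact (F3_obj G A C M) (single G (mcomp M) i m) (single G (dual_comp G A C) j d)"
      using a m d by (simp add: F3_obj_gact MP.conv_single)
    also have "\<dots> = gact (F3_obj G A C N) (single G (mcomp N) i m) (single G (dual_comp G A C) j d)"
      by (simp add: eq singles)
    also have "\<dots> = single G (mcomp N) (i \<otimes>\<^bsub>G\<^esub> j) (dual_action G A C N i j m d)"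
      using a mN d by (simp add: F3_obj_gact NP.conv_single)
    finally show "single G (mcomp N) (i \<otimes>\<^bsub>G\<^esub> j) (dual_action G A C M i j m d)
        = single G (mcomp N) (i \<otimes>\<^bsub>G\<^esub> j) (dual_action G A C N i j m d)" by (simp add: singles)
  qed (use a in simp)
  note scalar = M.scalar_closed
  have comps: "mcomp M i = mcomp N i" for i
  proof (cases "i \<in> carrier G")
    case a: True
    have "ract (mcomp M i) m b = ract (mcomp N i) m b" for m b
    proof (cases "m \<in> carrier (mcomp M i) \<and> b \<in> carrier A")
      case True
      then have m: "m \<in> carrier (mcomp M i)" "m \<in> carrier (mcomp N i)" and b: "b \<in> carrier A" using car a by simp_all
      show ?thesis
        using act[OF a M.G.one_closed m(1) scalar[OF b]]
        by (simp only: M.action_scalar[OF a m(1) b] N.action_scalar[OF a m(2) b])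
    next
      case False
      then show ?thesis using M(2) N(2) a car[OF a] by (simp add: extensional_comodule_def)
    qed
    then show ?thesis using a by (intro rmod.equality ext) (simp_all add: car mul one)
  next
    case False
    then show ?thesis using M(2) N(2) by (simp add: extensional_comodule_def extensional_def)
  qed
  then have comp: "mcomp M = mcomp N" by (rule ext)
  have "coact M i j m = coact N i j m" for i j m
  proof (cases "i \<in> carrier G \<and> j \<in> carrier G \<and> m \<in> carrier (mcomp M (i \<otimes>\<^bsub>G\<^esub> j))")
    case True
    then have a: "i \<in> carrier G" and b: "j \<in> carrier G" and m: "m \<in> carrier (mcomp M (i \<otimes>\<^bsub>G\<^esub> j))" by simp_all
    interpret T: tensor_product A "mcomp N i" "ccomp C j" by (rule N.tensor_comp[OF a b])
    obtain S p where basis: "dual_basis A (ccomp C j) S p" using fin b by blast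
    show ?thesis
    proof (rule T.slices_separate[OF basis])
      show "coact M i j m \<in> carrier T.T" "coact N i j m \<in> carrier T.T"
        using M.coact_facts(1)[OF a b m] N.coact_facts(1)[OF a b] m by (simp_all add: comp)
      fix d assume "d \<in> carrier (dual A (ccomp C j))"
      then have d: "d \<in> carrier (dual_comp G A C (inv\<^bsub>G\<^esub> j))" using b by (simp add: M.dual_degree_inv)
      have "slice A (mcomp M i) (ccomp C j) d (coact M i j m) = slice A (mcomp N i) (ccomp C j) d (coact N i j m)"
        unfolding M.slice_coact[OF a b] N.slice_coact[OF a b] using a b m d by (intro act) simp_all
      then show "slice A (mcomp N i) (ccomp C j) d (coact M i j m) = slice A (mcomp N i) (ccomp C j) d (coact N i j m)"
        by (simp add: comp)
    qed
  next
    case False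
    then have "coact M i j m = undefined" using M(2) unfolding extensional_comodule_def by blast
    moreover have "coact N i j m = undefined" using False N(2) unfolding extensional_comodule_def comp by blast
    ultimately show ?thesis by simp
  qed
  then show ?thesis using comp by (intro comodule.equality ext) simp_all
qed

lemma (in group_coring) F3_isomorphism:
  assumes fin: "left_homogeneously_finite G A C"
  shows "isomorphism_of_categories
    (comodule_category G A C :: (('g, 'a, 'c, 'm) comodule, 'g \<Rightarrow> 'm \<Rightarrow> 'm) category_data)
    (graded_module_category G (left_dual_ring G A C) (dual_comp G A C)) (F3 G A C)"
proof -
  have basis: "\<exists>S f. dual_basis A (ccomp C i) S f" if "i \<in> carrier G" for i
    using fin that fg_projective_dual_basis unfolding left_homogeneously_finite_def by metis
  show ?thesis
  proof (rule isomorphism_of_categoriesI[OF F3_functor])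
    show "bij_betw (FObj (F3 G A C))
        (Obj (comodule_category G A C :: (('g, 'a, 'c, 'm) comodule, 'g \<Rightarrow> 'm \<Rightarrow> 'm) category_data))
        (Obj (graded_module_category G (left_dual_ring G A C) (dual_comp G A C)))"
      unfolding F3_simps comodule_category_simps graded_module_category_simps
    proof (rule bij_betw_imageI)
      show "inj_on (F3_obj G A C) {M :: ('g, 'a, 'c, 'm) comodule. group_comodule G A C M \<and> extensional_comodule G A M}"
        by (rule inj_onI) (use F3_obj_inj[OF _ _ _ _ basis] in blast)
      show "F3_obj G A C ` {M :: ('g, 'a, 'c, 'm) comodule. group_comodule G A C M \<and> extensional_comodule G A M}
          = {N. graded_module G (left_dual_ring G A C) (dual_comp G A C) N
              \<and> extensional_gr_module G (left_dual_ring G A C) N}" (is "?F = ?N")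
      proof (intro equalityI subsetI)
        fix N assume "N \<in> ?F"
        then show "N \<in> ?N" using group_comodule.F3_obj_graded_module F3_obj_extensional by blast
      next
        fix N assume "N \<in> ?N"
        then have N: "graded_module G (left_dual_ring G A C) (dual_comp G A C) N"
          "extensional_gr_module G (left_dual_ring G A C) N" by simp_all
        show "N \<in> ?F"
          using F3_module_comodule[OF N(1) basis N(2)] module_comodule[OF N(1) basis]
            module_comodule_extensional[OF N(1) basis N(2)]
          by (intro image_eqI[of _ _ "module_comodule N"]) simp_all
      qed
    qed
    fix M N :: "('g, 'a, 'c, 'm) comodule"
    assume "M \<in> Obj (comodule_category G A C)" "N \<in> Obj (comodule_category G A C)"
    then have M: "group_comodule G A C M" and N: "group_comodule G A C N" by (simp_all add: comodule_category_simps)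
    show "bij_betw (FMor (F3 G A C) M N) (Hom (comodule_category G A C) M N)
        (Hom (graded_module_category G (left_dual_ring G A C) (dual_comp G A C)) (FObj (F3 G A C) M) (FObj (F3 G A C) N))"
      unfolding F3_simps comodule_category_simps graded_module_category_simps
      using F3_faithful[OF M N] F3_full[OF M N basis] F3_morphism[OF M N]
      by (intro bij_betw_imageI) (simp_all, blast)
  qed
qed

theorem proposition4p1:
  fixes G :: "('g, 'y) monoid_scheme" and A :: "('a, 'x) ring_scheme"
    and C :: "('g, 'a, 'c) coring"
  assumes "group_coring G A C"
  shows "cat_functor
      (comodule_category G A C :: (('g, 'a, 'c, 'm) comodule, 'g \<Rightarrow> 'm \<Rightarrow> 'm) category_data)
      (graded_module_category G (left_dual_ring G A C) (dual_comp G A C))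
      (F3 G A C)
    \<and> (left_homogeneously_finite G A C \<longrightarrow>
      isomorphism_of_categories
        (comodule_category G A C :: (('g, 'a, 'c, 'm) comodule, 'g \<Rightarrow> 'm \<Rightarrow> 'm) category_data)
        (graded_module_category G (left_dual_ring G A C) (dual_comp G A C))
        (F3 G A C))"
  using group_coring.F3_functor[OF assms] group_coring.F3_isomorphism[OF assms] by blast

end
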